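(* Under the setting and assumptions (A.0)–(A.5) listed in the context, the variances of the plug-in estimators $\hat{\mathbf{G}}_k$ and $\tilde{\mathbf{G}}_k$ are identical up to leading terms: there are constants $c_4$ and $c_5$, depending on $g$ and $f$, such that, as $M,N\to\infty$, $$\mathbb{V}(\hat{\mathbf{G}}_k)=c_4\left(\frac1N\right)+c_5\left(\frac1M\right)+o\left(\frac1M+\frac1N\right),$$ $$\mathbb{V}(\tilde{\mathbf{G}}_k)=c_4\left(\frac1N\right)+c_5\left(\frac1M\right)+o\left(\frac1M+\frac1N\right).$$
   Context: Setting. $f$ is a probability density on $\mathbb{R}^d$ with known support $\mathcal S=[a,b]^d$, and $G(f)=\int g(f(x),x)f(x)\,dx$ for a function $g(f,x)$. $T=N+M$ i.i.d. realizations $\mathbf{X}_1,\dots,\mathbf{X}_N,\mathbf{X}_{N+1},\dots,\mathbf{X}_{N+M}$ from $f$ are available. $\mathbb{V}$ denotes variance. Density estimators. For real $0<k\le M$ let $d_k=(k/M)^{1/d}$, $S_k(X)=\{Y\in\mathcal S:\|X-Y\|_\infty\le d_k/2\}$ for $X\in\mathcal S$, $V_k(X)=\int_{S_k(X)}dz$, and let $\mathbf{l}_k(X)$ be the number of the $M$ samples $\mathbf{X}_{N+1},\dots,\mathbf{X}_{N+M}$ falling in $S_k(X)$. The truncated uniform kernel density estimator is $\hat{\mathbf{f}}_k(X)=\mathbf{l}_k(X)/(MV_k(X))$. The standard kernel density estimator $\tilde{\mathbf{f}}_k$ is defined identically except that the volume is always set to $k/M$, i.e. $\tilde{\mathbf{f}}_k(X)=\mathbf{l}_k(X)/k$.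 Plug-in estimators. $\hat{\mathbf{G}}_k=\frac1N\sum_{i=1}^N g(\hat{\mathbf{f}}_k(\mathbf{X}_i),\mathbf{X}_i)$ and $\tilde{\mathbf{G}}_k=\frac1N\sum_{i=1}^N g(\tilde{\mathbf{f}}_k(\mathbf{X}_i),\mathbf{X}_i)$. Assumptions. (A.0) $k=k_0M^\beta$ for constants $k_0>0$ and $0<\beta<1$; $M=\alpha_{frac}T$, $N=(1-\alpha_{frac})T$ with $0<\alpha_{frac}<1$ constant. (A.1) There are constants $\epsilon_0,\epsilon_\infty$ with $0<\epsilon_0\le f(x)\le\epsilon_\infty<\infty$ for all $x\in\mathcal S$. (A.2) $f$ has continuous partial derivatives of order $d$ in the interior of $\mathcal S$, and these derivatives are upper bounded. (A.3) $g(f,x)$ has $\max\{\lambda,d\}$ partial derivatives with respect to the argument $f$, where $\lambda$ satisfies $\lambda\beta>1$. The $n$-th partial derivative of $g(f,x)$ with respect to $f$ is denoted $g^{(n)}(f,x)$. (A.4) The absolute values of $g(f,x)$ and its partial derivatives are strictly upper bounded in the range $\epsilon_0\le f\le\epsilon_\infty$ for all $x$. (A.5) Let $\epsilon\in(0,1)$ and $\delta\in(2/3,1)$ be fixed, let $\mathcal C(M)$ be a positive function with $\mathcal C(M)=\Theta(\exp(-M^{\beta(1-\delta)}))$, and put $p_l=(1-\epsilon)\epsilon_0$, $p_u=(1+\epsilon)\epsilon_\infty$. For each of $h=g$, $h=g^{(3)}$, $h=g^{(\lambda)}$ the following hold for some constants $G_1,G_2,G_3,G_4$: (i) $\sup_x|h(0,x)|<G_1<\infty$;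 (ii) $\sup_{f\in(p_l,p_u),x}|h(f,x)|<G_2<\infty$; (iii) $\sup_{f\in(1/k,p_u),x}|h(f,x)|\,\mathcal C(M)<G_3<\infty$ for all $M$; (iv) $\sup_{f\in(p_l,2^dM/k),x}|h(f,x)|\,\mathcal C(M)<G_4<\infty$ for all $M$. In (A.3)–(A.5) the letter $f$ as an argument of $g$ or $h$ denotes a real variable. The constants $c_4,c_5$ do not depend on $k$, $M$, $N$. *)

theory Defs
  imports "HOL-Probability.Probability"
begin

definition cube :: "real \<Rightarrow> real \<Rightarrow> (real ^ 'n) set" where
  "cube a b = cbox (\<chi> i. a) (\<chi> i. b)"

definition density_with_support :: "(real ^ 'n \<Rightarrow> real) \<Rightarrow> (real ^ 'n) set \<Rightarrow> bool" where
  "density_with_support f S \<longleftrightarrow>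
     f \<in> borel_measurable borel \<and> (\<forall>x. 0 \<le> f x) \<and>
     (\<integral>\<^sup>+ x. ennreal (f x) \<partial>lborel) = 1 \<and> closure {x. f x \<noteq> 0} = S"

definition iid_sample ::
    "'w measure \<Rightarrow> (nat \<Rightarrow> 'w \<Rightarrow> real ^ 'n) \<Rightarrow> (real ^ 'n \<Rightarrow> real) \<Rightarrow> bool" where
  "iid_sample P X f \<longleftrightarrow>
     prob_space P \<and> prob_space.indep_vars P (\<lambda>_. borel) X {1..} \<and>
     (\<forall>i\<ge>1. distributed P lborel (X i) (\<lambda>x. ennreal (f x)))"


text \<open>
  Below, \<open>X\<close> is one realization of the whole sample: the points \<open>X 1, \<dots>, X N\<close> are those at which
  the density estimate is evaluated, and \<open>X (N + 1), \<dots>, X (N + M)\<close> are those from which it is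
  built. The bandwidth parameter \<open>k\<close> is real.
\<close>

definition kernel_region ::
    "(real ^ 'n) set \<Rightarrow> real \<Rightarrow> nat \<Rightarrow> real ^ 'n \<Rightarrow> (real ^ 'n) set" where
  "kernel_region S k M x =
     {y \<in> S. infnorm (x - y) \<le> (k / real M) powr (1 / real CARD('n)) / 2}"

definition kernel_volume :: "(real ^ 'n) set \<Rightarrow> real \<Rightarrow> nat \<Rightarrow> real ^ 'n \<Rightarrow> real" where
  "kernel_volume S k M x = measure lborel (kernel_region S k M x)"

definition kernel_count ::
    "(real ^ 'n) set \<Rightarrow> real \<Rightarrow> nat \<Rightarrow> nat \<Rightarrow> (nat \<Rightarrow> real ^ 'n) \<Rightarrow> real ^ 'n \<Rightarrow> nat" where
  "kernel_count S k N M X x = card {i \<in> {N + 1..N + M}. X i \<in> kernel_region S k M x}"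

definition truncated_kde ::
    "(real ^ 'n) set \<Rightarrow> real \<Rightarrow> nat \<Rightarrow> nat \<Rightarrow> (nat \<Rightarrow> real ^ 'n) \<Rightarrow> real ^ 'n \<Rightarrow> real" where
  "truncated_kde S k N M X x =
     real (kernel_count S k N M X x) / (real M * kernel_volume S k M x)"

definition standard_kde ::
    "(real ^ 'n) set \<Rightarrow> real \<Rightarrow> nat \<Rightarrow> nat \<Rightarrow> (nat \<Rightarrow> real ^ 'n) \<Rightarrow> real ^ 'n \<Rightarrow> real" where
  "standard_kde S k N M X x = real (kernel_count S k N M X x) / (real M * (k / real M))"

definition plug_in ::
    "(real \<Rightarrow> real ^ 'n \<Rightarrow> real) \<Rightarrow> (real ^ 'n \<Rightarrow> real) \<Rightarrow> nat \<Rightarrow> (nat \<Rightarrow> real ^ 'n) \<Rightarrow> real" where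
  "plug_in g fe N X = (1 / real N) * (\<Sum>i=1..N. g (fe (X i)) (X i))"

definition G_hat ::
    "(real \<Rightarrow> real ^ 'n \<Rightarrow> real) \<Rightarrow> (real ^ 'n) set \<Rightarrow> real \<Rightarrow> nat \<Rightarrow> nat \<Rightarrow> (nat \<Rightarrow> real ^ 'n) \<Rightarrow> real"
  where "G_hat g S k N M X = plug_in g (truncated_kde S k N M X) N X"

definition G_tilde ::
    "(real \<Rightarrow> real ^ 'n \<Rightarrow> real) \<Rightarrow> (real ^ 'n) set \<Rightarrow> real \<Rightarrow> nat \<Rightarrow> nat \<Rightarrow> (nat \<Rightarrow> real ^ 'n) \<Rightarrow> real"
  where "G_tilde g S k N M X = plug_in g (standard_kde S k N M X) N X"


definition partial_deriv :: "'n \<Rightarrow> (real ^ 'n \<Rightarrow> real) \<Rightarrow> real ^ 'n \<Rightarrow> real" where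
  "partial_deriv i f x = deriv (\<lambda>t. f (x + t *\<^sub>R axis i 1)) 0"

definition iter_partial :: "'n list \<Rightarrow> (real ^ 'n \<Rightarrow> real) \<Rightarrow> real ^ 'n \<Rightarrow> real" where
  "iter_partial is f = foldr partial_deriv is f"

text \<open>
  Continuity of the partial derivatives of lower order is not listed: on an open set it follows
  from the existence and continuity of all those of order \<open>n\<close>.
\<close>

definition bounded_cont_partials ::
    "nat \<Rightarrow> (real ^ 'n) set \<Rightarrow> (real ^ 'n \<Rightarrow> real) \<Rightarrow> bool" where
  "bounded_cont_partials n U f \<longleftrightarrow>
     (\<forall>is i. length is < n \<longrightarrow>
        (\<forall>x\<in>U. (\<lambda>t. iter_partial is f (x + t *\<^sub>R axis i 1)) differentiable (at 0))) \<and>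
     (\<forall>is. length is = n \<longrightarrow>
        continuous_on U (iter_partial is f) \<and> (\<exists>B. \<forall>x\<in>U. iter_partial is f x \<le> B))"


text \<open>
  \<open>gd n t x\<close> is the \<open>n\<close>-th partial derivative of \<open>g\<close> with respect to its first argument. The
  derivatives are taken at \<open>t > 0\<close> only. The value \<open>gd n 0 x\<close>, which enters the growth condition
  below, need not be a derivative at the end point, so that functions with a prescribed value at
  \<open>0\<close>, such as \<open>- ln t\<close> for \<open>t > 0\<close> and \<open>1\<close> for \<open>t = 0\<close>, are covered.
\<close>

definition first_arg_derivs ::
    "nat \<Rightarrow> (real ^ 'n) set \<Rightarrow> (real \<Rightarrow> real ^ 'n \<Rightarrow> real) \<Rightarrow>
     (nat \<Rightarrow> real \<Rightarrow> real ^ 'n \<Rightarrow> real) \<Rightarrow> bool" where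
  "first_arg_derivs m S g gd \<longleftrightarrow>
     gd 0 = g \<and>
     (\<forall>n<m. \<forall>x\<in>S. \<forall>t>0. ((\<lambda>s. gd n s x) has_real_derivative gd (Suc n) t x) (at t))"

definition growth_condition ::
    "(real ^ 'n) set \<Rightarrow> real \<Rightarrow> real \<Rightarrow> (nat \<Rightarrow> real) \<Rightarrow> (nat \<Rightarrow> real) \<Rightarrow>
     (real \<Rightarrow> real ^ 'n \<Rightarrow> real) \<Rightarrow> bool" where
  "growth_condition S pl pu k C h \<longleftrightarrow>
     (\<exists>G1. \<forall>x\<in>S. \<bar>h 0 x\<bar> < G1) \<and>
     (\<exists>G2. \<forall>x\<in>S. \<forall>t\<in>{pl<..<pu}. \<bar>h t x\<bar> < G2) \<and>
     (\<exists>G3. \<forall>M\<ge>1. \<forall>x\<in>S. \<forall>t\<in>{1 / k M<..<pu}. \<bar>h t x\<bar> * C M < G3) \<and>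
     (\<exists>G4. \<forall>M\<ge>1. \<forall>x\<in>S. \<forall>t\<in>{pl<..<2 ^ CARD('n) * real M / k M}. \<bar>h t x\<bar> * C M < G4)"

end

theory Submission
  imports Defs "HOL-Real_Asymp.Real_Asymp"
begin

text \<open>
  Both estimators divide the number of neighbours of \<open>x\<close> among \<open>M\<close> sample points by \<open>M * q x\<close>, where
  \<open>q\<close> is the exact volume of the truncated cell or the constant \<open>k / M\<close>. With \<open>r\<close> half the side of a
  cell and \<open>d\<close> the dimension, the argument needs of \<open>q\<close> only that \<open>r ^ d \<le> q x \<le> (2 * r) ^ d\<close>, and
  that the upper bound is attained at distance at least \<open>r\<close> from the boundary. So one proof serves
  both, with the same constants.

  Write \<open>\<psi> x = g (f x) x\<close> and \<open>\<Phi> x = f x * w x\<close>, where \<open>w x\<close> is the derivative of \<open>g\<close> in its first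
  argument at \<open>(f x, x)\<close>. The mean of \<open>\<psi>\<close> over the \<open>N\<close> evaluation points plus the mean of \<open>\<Phi>\<close> over the
  \<open>M\<close> other points is a sum of independent terms, with variance exactly \<open>c4 / N + c5 / M\<close> for
  \<open>c4\<close> the variance of \<open>\<psi>\<close> and \<open>c5\<close> that of \<open>\<Phi>\<close>. By \<open>variance_perturbation\<close> it is enough that the
  plug-in estimator differs from this linear statistic by a variable of variance
  \<open>o(1 / M + 1 / N)\<close>.

  That variable splits into two parts. Given the \<open>M\<close> points, the first is a mean of centred
  independent terms; its variance is at most \<open>1 / N\<close> times the mean square error of the plug-in value at a
  single point. The second depends on the \<open>M\<close> points only, and the Efron-Stein inequality
  (\<open>efron_stein\<close>) bounds its variance by the effect of deleting one of them. Deleting \<open>y\<close> changes the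
  estimate only near \<open>y\<close>, by one unit of the count; \<open>M\<close> times the effect is an average, over the
  neighbours of \<open>y\<close>, of difference quotients of \<open>g\<close>, from which \<open>\<Phi> y\<close> is subtracted
  (\<open>variance_linearisation_error\<close>).

  What remains are two limits. First, the estimate is close to \<open>f x\<close> in mean square. It stays in a
  fixed compact interval of positive numbers, where \<open>g\<close> and its derivative are Lipschitz, except
  with a probability of order \<open>exp (- c * k)\<close> for some \<open>c > 0\<close>. On the exceptional event \<open>g\<close> is at most of
  order \<open>exp (M powr (\<beta> * (1 - \<delta>)))\<close>, which the probability outweighs because \<open>k\<close> is of order
  \<open>M powr \<beta>\<close> (\<open>hits_functional_error\<close>, \<open>growth_condition_range\<close>, \<open>superpolynomial_decay\<close>). Second,
  averages of a bounded measurable function over shrinking cells converge to it in \<open>L\<^sup>1\<close>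
  (\<open>approximate_identity_L1\<close>). Near the boundary the standard estimator is biased by a factor of
  up to \<open>2 ^ d\<close>; there the functional is still bounded, and the layer has vanishing volume.
\<close>

section \<open>Variances on product spaces\<close>

lemma power2_sum_le: "(u + v)\<^sup>2 \<le> 2 * u\<^sup>2 + 2 * (v::real)\<^sup>2"
  using zero_le_power2[of "u - v"] by (simp add: power2_eq_square algebra_simps)

lemma (in prob_space) integrable_bounded:
  fixes F :: "'a \<Rightarrow> real"
  assumes "F \<in> borel_measurable M" and "\<And>x. x \<in> space M \<Longrightarrow> \<bar>F x\<bar> \<le> B"
  shows "integrable M F"
  using assms by (intro integrable_const_bound[of _ B]) auto

lemma (in prob_space) abs_expectation_le:
  fixes F :: "'a \<Rightarrow> real"
  assumes "\<And>x. x \<in> space M \<Longrightarrow> \<bar>F x\<bar> \<le> B" and "0 \<le> B"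
  shows "\<bar>\<integral>x. F x \<partial>M\<bar> \<le> B"
proof (cases "integrable M F")
  case True
  have "\<bar>\<integral>x. F x \<partial>M\<bar> \<le> (\<integral>x. \<bar>F x\<bar> \<partial>M)" by simp
  also have "\<dots> \<le> B" using True assms by (intro integral_le_const) auto
  finally show ?thesis .
qed (use assms in \<open>auto simp: not_integrable_integral_eq\<close>)

lemma (in prob_space) expectation_le_bound:
  fixes F :: "'a \<Rightarrow> real"
  assumes "\<And>x. x \<in> space M \<Longrightarrow> F x \<le> B" and "0 \<le> B"
  shows "(\<integral>x. F x \<partial>M) \<le> B"
proof (cases "integrable M F")
  case True
  then show ?thesis using assms by (intro integral_le_const) auto
qed (use assms in \<open>auto simp: not_integrable_integral_eq\<close>)

lemma (in prob_space) integrable_square_bounded: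
  fixes F :: "'a \<Rightarrow> real"
  assumes [measurable]: "F \<in> borel_measurable M" and B: "\<And>x. x \<in> space M \<Longrightarrow> \<bar>F x\<bar> \<le> B"
  shows "integrable M (\<lambda>x. (F x)\<^sup>2)"
proof (rule integrable_bounded[of _ "B\<^sup>2"])
  fix x assume "x \<in> space M"
  then have "\<bar>F x\<bar> \<le> \<bar>B\<bar>" using B by (smt (verit))
  then show "\<bar>(F x)\<^sup>2\<bar> \<le> B\<^sup>2" by (simp only: abs_power2 abs_le_square_iff)
qed measurable

lemma (in prob_space) square_expectation_le:
  fixes F :: "'a \<Rightarrow> real"
  assumes F: "F \<in> borel_measurable M" and B: "\<And>x. x \<in> space M \<Longrightarrow> \<bar>F x\<bar> \<le> B"
  shows "(\<integral>x. F x \<partial>M)\<^sup>2 \<le> (\<integral>x. (F x)\<^sup>2 \<partial>M)"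
proof -
  have "0 \<le> variance F" by simp
  then show ?thesis
    using variance_eq[OF integrable_bounded[OF F B] integrable_square_bounded[OF F B]] by simp
qed

lemma (in prob_space) variance_add_le:
  fixes F G :: "'a \<Rightarrow> real"
  assumes [measurable]: "F \<in> borel_measurable M" "G \<in> borel_measurable M"
    and FB: "\<And>x. x \<in> space M \<Longrightarrow> \<bar>F x\<bar> \<le> B" and GB: "\<And>x. x \<in> space M \<Longrightarrow> \<bar>G x\<bar> \<le> B"
  shows "variance (\<lambda>x. F x + G x) \<le> 2 * expectation (\<lambda>x. (F x)\<^sup>2) + 2 * variance G"
proof -
  have i: "integrable M F" "integrable M G"
    by (rule integrable_bounded, measurable, erule FB GB)+
  have i2: "integrable M (\<lambda>x. (F x)\<^sup>2)" "integrable M (\<lambda>x. (G x)\<^sup>2)"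
    by (rule integrable_square_bounded, measurable, erule FB GB)+
  define c where "c = expectation F"
  define d where "d = expectation G"
  have i3: "integrable M (\<lambda>x. (F x - c)\<^sup>2)" "integrable M (\<lambda>x. (G x - d)\<^sup>2)"
    using i i2 by (auto simp: power2_diff)
  have "variance (\<lambda>x. F x + G x) = (\<integral>x. ((F x - c) + (G x - d))\<^sup>2 \<partial>M)"
    using i by (simp add: c_def d_def algebra_simps)
  also have "\<dots> \<le> (\<integral>x. 2 * (F x - c)\<^sup>2 + 2 * (G x - d)\<^sup>2 \<partial>M)"
    using i3 by (intro integral_mono' power2_sum_le) auto
  also have "\<dots> = 2 * variance F + 2 * variance G"
    using i3 by (simp add: c_def d_def)
  also have "variance F \<le> expectation (\<lambda>x. (F x)\<^sup>2)"
    using variance_eq[OF i(1) i2(1)] by simp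
  finally show ?thesis by simp
qed

text \<open>
  The mixed term is estimated by \<open>2 * \<bar>u * v\<bar> \<le> t * u\<^sup>2 + v\<^sup>2 / t\<close>. When the difference of \<open>F\<close> and \<open>G\<close> has a
  variance of smaller order than \<open>G\<close>, a small fixed \<open>t\<close> makes the whole error of smaller order.
\<close>
lemma (in prob_space) variance_perturbation:
  fixes F G :: "'a \<Rightarrow> real"
  assumes [measurable]: "F \<in> borel_measurable M" "G \<in> borel_measurable M"
    and FB: "\<And>x. x \<in> space M \<Longrightarrow> \<bar>F x\<bar> \<le> B" and GB: "\<And>x. x \<in> space M \<Longrightarrow> \<bar>G x\<bar> \<le> B" and t: "0 < t"
  shows "\<bar>variance F - variance G\<bar> \<le> t * variance G + (1 + 1 / t) * variance (\<lambda>x. F x - G x)"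
proof -
  have i: "integrable M F" "integrable M G"
    by (rule integrable_bounded, measurable, erule FB GB)+
  define u where "u x = G x - expectation G" for x
  define v where "v x = (F x - G x) - expectation (\<lambda>x. F x - G x)" for x
  have uv_meas [measurable]: "u \<in> borel_measurable M" "v \<in> borel_measurable M"
    unfolding u_def[abs_def] v_def[abs_def] by measurable
  have B: "0 \<le> B" using FB not_empty by (meson abs_ge_zero ex_in_conv order_trans)
  have eF: "\<bar>expectation F\<bar> \<le> B" "\<bar>expectation G\<bar> \<le> B" using FB GB B by (auto intro!: abs_expectation_le)
  have ub: "\<bar>u x\<bar> \<le> 4 * B" "\<bar>v x\<bar> \<le> 4 * B" if "x \<in> space M" for x
    using FB[OF that] GB[OF that] eF i by (auto simp: u_def v_def)
  have iu: "integrable M (\<lambda>x. (u x)\<^sup>2)" "integrable M (\<lambda>x. (v x)\<^sup>2)"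
    by (rule integrable_square_bounded[where B = "4 * B"], measurable, erule ub)+
  have iuv: "integrable M (\<lambda>x. u x * v x)"
  proof (rule integrable_bounded[where B = "(4 * B) * (4 * B)"])
    show "\<bar>u x * v x\<bar> \<le> (4 * B) * (4 * B)" if "x \<in> space M" for x
      unfolding abs_mult using ub[OF that] B by (intro mult_mono) auto
  qed measurable
  have F: "F x - expectation F = u x + v x" for x using i by (simp add: u_def v_def)
  have VF: "variance F = expectation (\<lambda>x. (u x)\<^sup>2) + 2 * expectation (\<lambda>x. u x * v x) + expectation (\<lambda>x. (v x)\<^sup>2)"
    unfolding F power2_sum using iu iuv by (simp add: mult.assoc)
  have "\<bar>2 * expectation (\<lambda>x. u x * v x)\<bar> \<le> expectation (\<lambda>x. \<bar>2 * (u x * v x)\<bar>)"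
    using integral_abs_bound[of M "\<lambda>x. 2 * (u x * v x)"] by simp
  also have "\<dots> \<le> expectation (\<lambda>x. t * (u x)\<^sup>2 + (1 / t) * (v x)\<^sup>2)"
  proof (rule integral_mono)
    fix x
    have "0 \<le> (t * \<bar>u x\<bar> - \<bar>v x\<bar>)\<^sup>2 / t" using t by simp
    also have "\<dots> = t * (u x)\<^sup>2 + (1 / t) * (v x)\<^sup>2 - \<bar>2 * (u x * v x)\<bar>"
      using t by (simp add: power2_diff power_mult_distrib abs_mult field_simps power2_eq_square[of t])
    finally show "\<bar>2 * (u x * v x)\<bar> \<le> t * (u x)\<^sup>2 + (1 / t) * (v x)\<^sup>2" by simp
  qed (use iu iuv in auto)
  also have "\<dots> = t * expectation (\<lambda>x. (u x)\<^sup>2) + (1 / t) * expectation (\<lambda>x. (v x)\<^sup>2)"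
    using iu by simp
  finally have cross: "\<bar>2 * expectation (\<lambda>x. u x * v x)\<bar>
      \<le> t * expectation (\<lambda>x. (u x)\<^sup>2) + (1 / t) * expectation (\<lambda>x. (v x)\<^sup>2)" .
  have V: "variance G = expectation (\<lambda>x. (u x)\<^sup>2)" "variance (\<lambda>x. F x - G x) = expectation (\<lambda>x. (v x)\<^sup>2)"
    by (simp_all only: u_def v_def)
  have "0 \<le> expectation (\<lambda>x. (v x)\<^sup>2)" by simp
  then show ?thesis using cross unfolding VF V distrib_right by linarith
qed

lemma (in prob_space) variance_divide:
  fixes F :: "'a \<Rightarrow> real"
  shows "variance (\<lambda>x. F x / c) = variance F / c\<^sup>2"
  by (simp add: diff_divide_distrib[symmetric] power_divide)

lemma (in prob_space) expectation_square_orthogonal_sum: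
  fixes U :: "'i \<Rightarrow> 'a \<Rightarrow> real"
  assumes "finite A" and meas: "\<And>i. i \<in> A \<Longrightarrow> U i \<in> borel_measurable M"
    and bd: "\<And>i x. i \<in> A \<Longrightarrow> x \<in> space M \<Longrightarrow> \<bar>U i x\<bar> \<le> B"
    and orth: "\<And>i j. i \<in> A \<Longrightarrow> j \<in> A \<Longrightarrow> i \<noteq> j \<Longrightarrow> expectation (\<lambda>x. U i x * U j x) = 0"
  shows "expectation (\<lambda>x. (\<Sum>i\<in>A. U i x)\<^sup>2) = (\<Sum>i\<in>A. expectation (\<lambda>x. (U i x)\<^sup>2))"
proof -
  have int: "integrable M (\<lambda>x. U i x * U j x)" if "i \<in> A" "j \<in> A" for i j
  proof (rule integrable_bounded[where B = "B * B"])
    show "\<bar>U i x * U j x\<bar> \<le> B * B" if "x \<in> space M" for x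
      unfolding abs_mult using bd[OF \<open>i \<in> A\<close> that] bd[OF \<open>j \<in> A\<close> that] by (intro mult_mono) auto
  qed (use meas that in simp)
  have "expectation (\<lambda>x. (\<Sum>i\<in>A. U i x)\<^sup>2) = (\<Sum>i\<in>A. \<Sum>j\<in>A. expectation (\<lambda>x. U i x * U j x))"
    using int by (simp add: power2_eq_square sum_product Bochner_Integration.integral_sum)
  also have "\<dots> = (\<Sum>i\<in>A. \<Sum>j\<in>A. if j = i then expectation (\<lambda>x. (U i x)\<^sup>2) else 0)"
    by (intro sum.cong) (auto simp: orth power2_eq_square)
  also have "\<dots> = (\<Sum>i\<in>A. expectation (\<lambda>x. (U i x)\<^sup>2))"
    using \<open>finite A\<close> by (intro sum.cong) auto
  finally show ?thesis .
qed

lemma (in prob_space) iid_coordinate_expectation: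
  fixes F :: "'a \<Rightarrow> real"
  assumes "finite I" "i \<in> I" "F \<in> borel_measurable M"
  shows "(\<integral>\<xi>. F (\<xi> i) \<partial>PiM I (\<lambda>_. M)) = (\<integral>y. F y \<partial>M)"
proof -
  have "(\<lambda>\<xi>. \<xi> i) \<in> measurable (PiM I (\<lambda>_. M)) M" using assms by simp
  then show ?thesis
    using integral_distr[of "\<lambda>\<xi>. \<xi> i" "PiM I (\<lambda>_. M)" M F] assms
      distr_PiM_component[of I "\<lambda>_. M" i] prob_space_axioms by simp
qed

text \<open>
  The index \<open>i\<close> may or may not belong to \<open>I\<close>. For a new \<open>i\<close> this is Fubini's theorem, as used in
  inductions on the index set; for an old one it says that overwriting a coordinate by a fresh
  independent draw does not change the expectation, which is how independence of the coordinates
  enters.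
\<close>
lemma integral_PiM_insert_resample:
  fixes F :: "('i \<Rightarrow> 'a) \<Rightarrow> real"
  assumes D: "prob_space D" and F: "integrable (PiM (insert i I) (\<lambda>_. D)) F"
  shows "(\<integral>\<xi>. F \<xi> \<partial>PiM (insert i I) (\<lambda>_. D)) = (\<integral>\<xi>. (\<integral>t. F (\<xi>(i := t)) \<partial>D) \<partial>PiM I (\<lambda>_. D))"
    and "(\<lambda>\<xi>. \<integral>t. F (\<xi>(i := t)) \<partial>D) \<in> borel_measurable (PiM I (\<lambda>_. D))"
proof -
  interpret D: prob_space D by fact
  interpret I: prob_space "PiM I (\<lambda>_. D)" by (intro prob_space_PiM D)
  interpret pair_sigma_finite D "PiM I (\<lambda>_. D)" ..
  let ?up = "\<lambda>(t, \<xi>). \<xi>(i := t)"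
  have [measurable]: "F \<in> borel_measurable (PiM (insert i I) (\<lambda>_. D))" using F by auto
  have up [measurable]: "?up \<in> measurable (D \<Otimes>\<^sub>M PiM I (\<lambda>_. D)) (PiM (insert i I) (\<lambda>_. D))"
    by measurable
  have eq: "distr (D \<Otimes>\<^sub>M PiM I (\<lambda>_. D)) (PiM (insert i I) (\<lambda>_. D)) ?up = PiM (insert i I) (\<lambda>_. D)"
    using D by (intro distr_pair_PiM_eq_PiM[where M = "\<lambda>_. D"])
  have int: "integrable (D \<Otimes>\<^sub>M PiM I (\<lambda>_. D)) (\<lambda>(t, \<xi>). F (\<xi>(i := t)))"
    using F by (subst (asm) eq[symmetric]) (simp add: integrable_distr_eq split_beta')
  have "(\<integral>\<xi>. F \<xi> \<partial>PiM (insert i I) (\<lambda>_. D)) = (\<integral>z. F (?up z) \<partial>(D \<Otimes>\<^sub>M PiM I (\<lambda>_. D)))"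
    by (subst eq[symmetric]) (simp add: integral_distr)
  also have "\<dots> = (\<integral>\<xi>. (\<integral>t. F (\<xi>(i := t)) \<partial>D) \<partial>PiM I (\<lambda>_. D))"
    using integral_snd[OF int] by (simp add: split_beta')
  finally show "(\<integral>\<xi>. F \<xi> \<partial>PiM (insert i I) (\<lambda>_. D)) = (\<integral>\<xi>. (\<integral>t. F (\<xi>(i := t)) \<partial>D) \<partial>PiM I (\<lambda>_. D))" .
  show "(\<lambda>\<xi>. \<integral>t. F (\<xi>(i := t)) \<partial>D) \<in> borel_measurable (PiM I (\<lambda>_. D))"
    by (rule D.borel_measurable_lebesgue_integral) measurable
qed

lemma (in prob_space) variance_coordinate_sum:
  fixes F :: "'i \<Rightarrow> 'a \<Rightarrow> real"
  assumes I: "finite I" and meas: "\<And>i. i \<in> I \<Longrightarrow> F i \<in> borel_measurable M"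
    and bd: "\<And>i x. i \<in> I \<Longrightarrow> x \<in> space M \<Longrightarrow> \<bar>F i x\<bar> \<le> B"
  shows "prob_space.variance (PiM I (\<lambda>_. M)) (\<lambda>\<xi>. \<Sum>i\<in>I. F i (\<xi> i)) = (\<Sum>i\<in>I. variance (F i))"
proof (cases "I = {}")
  case False
  let ?P = "PiM I (\<lambda>_. M)"
  interpret P: prob_space ?P by (intro prob_space_PiM prob_space_axioms)
  have B: "0 \<le> B"
    using bd not_empty False by (meson abs_ge_zero all_not_in_conv order_trans)
  have iF: "integrable M (F i)" if "i \<in> I" for i by (rule integrable_bounded[OF meas bd]) (use that in auto)
  define U where "U i \<xi> = F i (\<xi> i) - expectation (F i)" for i \<xi>
  have coord: "(\<lambda>\<xi>. F i (\<xi> i)) \<in> borel_measurable ?P" if "i \<in> I" for i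
    by (rule measurable_compose[OF _ meas[OF that]]) (use that in simp)
  have U_meas: "U i \<in> borel_measurable ?P" if "i \<in> I" for i
    unfolding U_def using coord[OF that] by measurable
  have sp: "\<xi> i \<in> space M" if "\<xi> \<in> space ?P" "i \<in> I" for \<xi> i using that by (auto simp: space_PiM)
  have U_bd: "\<bar>U i \<xi>\<bar> \<le> 2 * B" if "i \<in> I" "\<xi> \<in> space ?P" for i \<xi>
    using bd[OF that(1) sp[OF that(2,1)]] abs_expectation_le[of "F i" B, OF bd[OF that(1)] B]
    unfolding U_def by linarith
  have orth: "P.expectation (\<lambda>\<xi>. U i \<xi> * U j \<xi>) = 0" if ij: "i \<in> I" "j \<in> I" "i \<noteq> j" for i j
  proof -
    have eq: "insert i I = I" using ij by auto
    have "integrable ?P (\<lambda>\<xi>. U i \<xi> * U j \<xi>)"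
    proof (rule P.integrable_bounded[where B = "(2 * B) * (2 * B)"])
      show "\<bar>U i \<xi> * U j \<xi>\<bar> \<le> (2 * B) * (2 * B)" if "\<xi> \<in> space ?P" for \<xi>
        unfolding abs_mult using U_bd[OF ij(1) that] U_bd[OF ij(2) that] B by (intro mult_mono) auto
    qed (use U_meas ij in simp)
    then have "P.expectation (\<lambda>\<xi>. U i \<xi> * U j \<xi>)
        = P.expectation (\<lambda>\<xi>. \<integral>t. U i (\<xi>(i := t)) * U j (\<xi>(i := t)) \<partial>M)"
      using integral_PiM_insert_resample(1)[OF prob_space_axioms, of i I "\<lambda>\<xi>. U i \<xi> * U j \<xi>"]
      unfolding eq by simp
    also have "\<dots> = P.expectation (\<lambda>\<xi>. 0)"
      using ij iF by (intro Bochner_Integration.integral_cong) (auto simp: U_def prob_space)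
    finally show ?thesis by simp
  qed
  have "P.expectation (\<lambda>\<xi>. \<Sum>i\<in>I. F i (\<xi> i)) = (\<Sum>i\<in>I. P.expectation (\<lambda>\<xi>. F i (\<xi> i)))"
    by (intro Bochner_Integration.integral_sum P.integrable_bounded[OF coord bd] sp)
  also have "\<dots> = (\<Sum>i\<in>I. expectation (F i))"
    by (intro sum.cong refl iid_coordinate_expectation I meas)
  finally have "P.variance (\<lambda>\<xi>. \<Sum>i\<in>I. F i (\<xi> i)) = P.expectation (\<lambda>\<xi>. (\<Sum>i\<in>I. U i \<xi>)\<^sup>2)"
    by (simp add: U_def sum_subtractf)
  also have "\<dots> = (\<Sum>i\<in>I. P.expectation (\<lambda>\<xi>. (U i \<xi>)\<^sup>2))"
    by (rule P.expectation_square_orthogonal_sum[OF I U_meas U_bd orth])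
  also have "\<dots> = (\<Sum>i\<in>I. variance (F i))"
    unfolding U_def by (intro sum.cong refl iid_coordinate_expectation[where F = "\<lambda>y. (F _ y - _)\<^sup>2", OF I])
      (use meas in auto)
  finally show ?thesis .
qed (simp add: PiM_empty lebesgue_integral_count_space_finite)

lemma space_PiM_fun_upd:
  assumes "\<xi> \<in> space (PiM I (\<lambda>_. D))" "t \<in> space D"
  shows "\<xi>(i := t) \<in> space (PiM (insert i I) (\<lambda>_. D))"
  using assms by (auto simp: space_PiM PiE_iff extensional_def)

text \<open>
  The leave-one-out form of the Efron-Stein inequality: \<open>Fi i\<close> may be any function that does not look
  at coordinate \<open>i\<close>. The induction adds a coordinate \<open>i\<close>. With \<open>m\<close> the conditional mean of \<open>F\<close> given the
  other coordinates, the variance of \<open>F\<close> is the mean conditional variance plus the variance of \<open>m\<close>.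
  The first is at most the mean square of \<open>F - Fi i\<close>, since a mean minimises the quadratic error among
  constants. The second is bounded by the induction hypothesis for \<open>m\<close> and the conditional means of
  the \<open>Fi j\<close>, and Jensen's inequality.
\<close>
lemma efron_stein:
  fixes F :: "('i \<Rightarrow> 'a) \<Rightarrow> real" and Fi :: "'i \<Rightarrow> ('i \<Rightarrow> 'a) \<Rightarrow> real"
  assumes D: "prob_space D" and "finite I"
    and "F \<in> borel_measurable (PiM I (\<lambda>_. D))"
    and "\<And>i. i \<in> I \<Longrightarrow> Fi i \<in> borel_measurable (PiM I (\<lambda>_. D))"
    and "\<And>\<xi>. \<xi> \<in> space (PiM I (\<lambda>_. D)) \<Longrightarrow> \<bar>F \<xi>\<bar> \<le> B"
    and "\<And>i \<xi>. i \<in> I \<Longrightarrow> \<xi> \<in> space (PiM I (\<lambda>_. D)) \<Longrightarrow> \<bar>Fi i \<xi>\<bar> \<le> B"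
    and "\<And>i \<xi> t. i \<in> I \<Longrightarrow> \<xi> \<in> space (PiM I (\<lambda>_. D)) \<Longrightarrow> t \<in> space D \<Longrightarrow> Fi i (\<xi>(i := t)) = Fi i \<xi>"
  shows "(\<integral>\<xi>. (F \<xi> - (\<integral>\<xi>. F \<xi> \<partial>PiM I (\<lambda>_. D)))\<^sup>2 \<partial>PiM I (\<lambda>_. D))
    \<le> (\<Sum>i\<in>I. \<integral>\<xi>. (F \<xi> - Fi i \<xi>)\<^sup>2 \<partial>PiM I (\<lambda>_. D))"
  using assms(2-)
proof (induction I arbitrary: F Fi)
  case empty
  show ?case by (simp add: PiM_empty lebesgue_integral_count_space_finite)
next
  case (insert i I)
  interpret D: prob_space D by fact
  let ?P = "PiM I (\<lambda>_. D)" and ?Q = "PiM (insert i I) (\<lambda>_. D)"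
  interpret P: prob_space ?P by (intro prob_space_PiM D)
  interpret Q: prob_space ?Q by (intro prob_space_PiM D)
  note [measurable] = insert.prems(1)
  have Fi_m [measurable]: "Fi j \<in> borel_measurable ?Q" if "j \<in> insert i I" for j
    using insert.prems(2) that .
  note FB = insert.prems(3) and FiB = insert.prems(4) and inv = insert.prems(5)
  have sp: "\<xi>(i := t) \<in> space ?Q" if "\<xi> \<in> space ?P" "t \<in> space D" for \<xi> t
    using space_PiM_fun_upd[OF that] .
  obtain t0 where "t0 \<in> space D" using D.not_empty by blast
  obtain \<xi>0 where "\<xi>0 \<in> space ?Q" using Q.not_empty by blast
  then have B0: "0 \<le> B" using FB[of \<xi>0] by auto
  have sq: "\<bar>(u - v)\<^sup>2\<bar> \<le> (2 * B)\<^sup>2" if "\<bar>u\<bar> \<le> B" "\<bar>v\<bar> \<le> B" for u v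
  proof -
    have "\<bar>u - v\<bar> \<le> \<bar>2 * B\<bar>" using that by linarith
    then show ?thesis by (simp only: abs_power2 abs_le_square_iff)
  qed
  have sq1: "\<bar>u\<^sup>2\<bar> \<le> B\<^sup>2" if "\<bar>u\<bar> \<le> B" for u
  proof -
    have "\<bar>u\<bar> \<le> \<bar>B\<bar>" using that by linarith
    then show ?thesis by (simp only: abs_power2 abs_le_square_iff)
  qed
  have FFiB: "\<bar>F \<xi> - Fi j \<xi>\<bar> \<le> 2 * B" if "j \<in> insert i I" "\<xi> \<in> space ?Q" for j \<xi>
    using FB[OF that(2)] FiB[OF that] by linarith
  have iQ: "integrable ?Q F" "integrable ?Q (\<lambda>\<xi>. (F \<xi>)\<^sup>2)"
    by (rule Q.integrable_bounded Q.integrable_square_bounded, measurable, erule FB)+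
  have iQi: "integrable ?Q (Fi j)" "integrable ?Q (\<lambda>\<xi>. (F \<xi> - Fi j \<xi>)\<^sup>2)" if "j \<in> insert i I" for j
    using that by (auto intro!: Q.integrable_bounded[OF Fi_m FiB] Q.integrable_square_bounded[OF _ FFiB])
  define m where "m \<xi> = (\<integral>t. F (\<xi>(i := t)) \<partial>D)" for \<xi>
  define mi where "mi j \<xi> = (\<integral>t. Fi j (\<xi>(i := t)) \<partial>D)" for j \<xi>
  have m_meas [measurable]: "m \<in> borel_measurable ?P"
    unfolding m_def[abs_def] by (rule integral_PiM_insert_resample[OF D iQ(1)])
  have mi_meas: "mi j \<in> borel_measurable ?P" if "j \<in> I" for j
    unfolding mi_def[abs_def] by (rule integral_PiM_insert_resample[OF D iQi(1)]) (use that in auto)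
  have mB: "\<bar>m \<xi>\<bar> \<le> B" if "\<xi> \<in> space ?P" for \<xi>
    unfolding m_def by (intro D.abs_expectation_le FB sp that B0)
  have miB: "\<bar>mi j \<xi>\<bar> \<le> B" if "j \<in> I" "\<xi> \<in> space ?P" for j \<xi>
    unfolding mi_def by (intro D.abs_expectation_le FiB sp that B0 insertI2)
  have sec: "(\<lambda>t. G (\<xi>(i := t))) \<in> borel_measurable D"
    if "G \<in> borel_measurable ?Q" "\<xi> \<in> space ?P" for G :: "('i \<Rightarrow> 'a) \<Rightarrow> real" and \<xi>
  proof -
    have *: "(\<lambda>t. (\<lambda>(t, \<xi>). \<xi>(i := t)) (t, \<xi>)) \<in> measurable D ?Q"
      by (rule measurable_compose[OF measurable_Pair2'[OF that(2)]]) measurable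
    show ?thesis using measurable_compose[OF * that(1)] by simp
  qed
  have mi_inv: "mi j (\<xi>(j := s)) = mi j \<xi>" if "j \<in> I" "\<xi> \<in> space ?P" "s \<in> space D" for j \<xi> s
  proof -
    have "j \<noteq> i" using that insert.hyps by auto
    have "Fi j (\<xi>(j := s, i := t)) = Fi j (\<xi>(i := t))" if "t \<in> space D" for t
      unfolding fun_upd_twist[OF \<open>j \<noteq> i\<close>]
      by (intro inv insertI2 \<open>j \<in> I\<close> sp \<open>\<xi> \<in> space ?P\<close> that \<open>s \<in> space D\<close>)
    then show ?thesis unfolding mi_def by (intro Bochner_Integration.integral_cong) auto
  qed
  have IH: "(\<integral>\<xi>. (m \<xi> - (\<integral>\<xi>. m \<xi> \<partial>?P))\<^sup>2 \<partial>?P) \<le> (\<Sum>j\<in>I. \<integral>\<xi>. (m \<xi> - mi j \<xi>)\<^sup>2 \<partial>?P)"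
    by (intro insert.IH m_meas mi_meas mB miB mi_inv)
  have iP: "integrable ?P m" "integrable ?P (\<lambda>\<xi>. (m \<xi>)\<^sup>2)"
    by (rule P.integrable_bounded P.integrable_square_bounded, measurable, erule mB)+
  have Em: "(\<integral>\<xi>. F \<xi> \<partial>?Q) = (\<integral>\<xi>. m \<xi> \<partial>?P)"
    unfolding m_def by (rule integral_PiM_insert_resample(1)[OF D iQ(1)])
  have split: "(\<integral>\<xi>. (F \<xi> - (\<integral>\<xi>. F \<xi> \<partial>?Q))\<^sup>2 \<partial>?Q)
      = ((\<integral>\<xi>. (F \<xi>)\<^sup>2 \<partial>?Q) - (\<integral>\<xi>. (m \<xi>)\<^sup>2 \<partial>?P)) + (\<integral>\<xi>. (m \<xi> - (\<integral>\<xi>. m \<xi> \<partial>?P))\<^sup>2 \<partial>?P)"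
    using Q.variance_eq[OF iQ] P.variance_eq[OF iP] Em by simp
  have first: "(\<integral>\<xi>. (F \<xi>)\<^sup>2 \<partial>?Q) - (\<integral>\<xi>. (m \<xi>)\<^sup>2 \<partial>?P) \<le> (\<integral>\<xi>. (F \<xi> - Fi i \<xi>)\<^sup>2 \<partial>?Q)"
  proof -
    have pt: "(\<integral>t. (F (\<xi>(i := t)))\<^sup>2 \<partial>D) - (m \<xi>)\<^sup>2 \<le> (\<integral>t. (F (\<xi>(i := t)) - Fi i (\<xi>(i := t)))\<^sup>2 \<partial>D)"
      if w: "\<xi> \<in> space ?P" for \<xi>
    proof -
      define c where "c = Fi i (\<xi>(i := t0))"
      have c: "Fi i (\<xi>(i := t)) = c" if "t \<in> space D" for t
        unfolding c_def using inv[OF insertI1 sp[OF w that] \<open>t0 \<in> space D\<close>] by (simp only: fun_upd_upd)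
      let ?G = "\<lambda>t. F (\<xi>(i := t))"
      have [measurable]: "?G \<in> borel_measurable D" by (rule sec[OF _ w]) measurable
      have i1: "integrable D ?G" "integrable D (\<lambda>t. (?G t)\<^sup>2)"
        by (rule D.integrable_bounded D.integrable_square_bounded, measurable, erule FB[OF sp[OF w]])+
      have "(\<integral>t. (F (\<xi>(i := t)) - Fi i (\<xi>(i := t)))\<^sup>2 \<partial>D) = (\<integral>t. (?G t)\<^sup>2 - 2 * c * ?G t + c\<^sup>2 \<partial>D)"
        by (intro Bochner_Integration.integral_cong) (auto simp: c power2_diff)
      also have "\<dots> = (\<integral>t. (?G t)\<^sup>2 \<partial>D) - 2 * c * m \<xi> + c\<^sup>2"
        using i1 by (simp add: m_def D.prob_space)
      finally show ?thesis using sum_squares_ge_zero[of "m \<xi> - c" 0] by (simp add: power2_eq_square algebra_simps)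
    qed
    have "(\<integral>\<xi>. (F \<xi>)\<^sup>2 \<partial>?Q) - (\<integral>\<xi>. (m \<xi>)\<^sup>2 \<partial>?P) = (\<integral>\<xi>. (\<integral>t. (F (\<xi>(i := t)))\<^sup>2 \<partial>D) - (m \<xi>)\<^sup>2 \<partial>?P)"
    proof (subst Bochner_Integration.integral_diff)
      show "integrable ?P (\<lambda>\<xi>. \<integral>t. (F (\<xi>(i := t)))\<^sup>2 \<partial>D)"
        by (intro P.integrable_bounded[of _ "B\<^sup>2"] D.abs_expectation_le sq1 FB sp zero_le_power2
            integral_PiM_insert_resample(2)[OF D iQ(2)])
    qed (use iP integral_PiM_insert_resample(1)[OF D iQ(2)] in auto)
    also have "\<dots> \<le> (\<integral>\<xi>. (\<integral>t. (F (\<xi>(i := t)) - Fi i (\<xi>(i := t)))\<^sup>2 \<partial>D) \<partial>?P)"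
    proof (intro integral_mono pt)
      show "integrable ?P (\<lambda>\<xi>. (\<integral>t. (F (\<xi>(i := t)))\<^sup>2 \<partial>D) - (m \<xi>)\<^sup>2)"
        by (intro Bochner_Integration.integrable_diff iP P.integrable_bounded[of _ "B\<^sup>2"]
            D.abs_expectation_le sq1 FB sp zero_le_power2 integral_PiM_insert_resample(2)[OF D iQ(2)])
      show "integrable ?P (\<lambda>\<xi>. \<integral>t. (F (\<xi>(i := t)) - Fi i (\<xi>(i := t)))\<^sup>2 \<partial>D)"
        by (intro P.integrable_bounded[of _ "(2*B)\<^sup>2"] D.abs_expectation_le sq FB FiB sp zero_le_power2
            insertI1 integral_PiM_insert_resample(2)[OF D iQi(2)])
    qed
    also have "\<dots> = (\<integral>\<xi>. (F \<xi> - Fi i \<xi>)\<^sup>2 \<partial>?Q)"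
      by (rule integral_PiM_insert_resample(1)[OF D iQi(2), symmetric]) simp
    finally show ?thesis .
  qed
  have second: "(\<integral>\<xi>. (m \<xi> - mi j \<xi>)\<^sup>2 \<partial>?P) \<le> (\<integral>\<xi>. (F \<xi> - Fi j \<xi>)\<^sup>2 \<partial>?Q)" if j: "j \<in> I" for j
  proof -
    have j': "j \<in> insert i I" using j by simp
    note [measurable] = mi_meas[OF j] Fi_m[OF j']
    have pt: "(m \<xi> - mi j \<xi>)\<^sup>2 \<le> (\<integral>t. (F (\<xi>(i := t)) - Fi j (\<xi>(i := t)))\<^sup>2 \<partial>D)"
      if w: "\<xi> \<in> space ?P" for \<xi>
    proof -
      have [measurable]: "(\<lambda>t. F (\<xi>(i := t))) \<in> borel_measurable D" "(\<lambda>t. Fi j (\<xi>(i := t))) \<in> borel_measurable D"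
        by (rule sec[OF _ w]; measurable)+
      have "m \<xi> - mi j \<xi> = (\<integral>t. F (\<xi>(i := t)) - Fi j (\<xi>(i := t)) \<partial>D)"
        unfolding m_def mi_def
      proof (rule Bochner_Integration.integral_diff[symmetric])
        show "integrable D (\<lambda>t. F (\<xi>(i := t)))"
          by (rule D.integrable_bounded, measurable, rule FB, rule sp[OF w])
        show "integrable D (\<lambda>t. Fi j (\<xi>(i := t)))"
          by (rule D.integrable_bounded, measurable, rule FiB[OF j'], rule sp[OF w])
      qed
      also have "\<dots>\<^sup>2 \<le> (\<integral>t. (F (\<xi>(i := t)) - Fi j (\<xi>(i := t)))\<^sup>2 \<partial>D)"
      proof (intro D.square_expectation_le[where B = "2 * B"])
        fix t assume "t \<in> space D"
        then show "\<bar>F (\<xi>(i := t)) - Fi j (\<xi>(i := t))\<bar> \<le> 2 * B"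
          by (intro FFiB j' sp w)
      qed measurable
      finally show ?thesis .
    qed
    have "(\<integral>\<xi>. (m \<xi> - mi j \<xi>)\<^sup>2 \<partial>?P) \<le> (\<integral>\<xi>. (\<integral>t. (F (\<xi>(i := t)) - Fi j (\<xi>(i := t)))\<^sup>2 \<partial>D) \<partial>?P)"
    proof (intro integral_mono pt)
      show "integrable ?P (\<lambda>\<xi>. (m \<xi> - mi j \<xi>)\<^sup>2)"
      proof (intro P.integrable_square_bounded[of _ "2 * B"])
        fix \<xi> assume "\<xi> \<in> space ?P"
        then show "\<bar>m \<xi> - mi j \<xi>\<bar> \<le> 2 * B" using mB miB[OF j] by (smt (verit))
      qed measurable
      show "integrable ?P (\<lambda>\<xi>. \<integral>t. (F (\<xi>(i := t)) - Fi j (\<xi>(i := t)))\<^sup>2 \<partial>D)"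
        by (intro P.integrable_bounded[of _ "(2*B)\<^sup>2"] D.abs_expectation_le sq FB FiB sp zero_le_power2
            j' integral_PiM_insert_resample(2)[OF D iQi(2)])
    qed
    also have "\<dots> = (\<integral>\<xi>. (F \<xi> - Fi j \<xi>)\<^sup>2 \<partial>?Q)"
      by (rule integral_PiM_insert_resample(1)[OF D iQi(2)[OF j'], symmetric])
    finally show ?thesis .
  qed
  have "(\<Sum>j\<in>I. \<integral>\<xi>. (m \<xi> - mi j \<xi>)\<^sup>2 \<partial>?P) \<le> (\<Sum>j\<in>I. \<integral>\<xi>. (F \<xi> - Fi j \<xi>)\<^sup>2 \<partial>?Q)"
    by (intro sum_mono second)
  then show ?case using split first IH insert.hyps by simp
qed

section \<open>Linearising a statistic built from neighbour counts\<close>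

definition count_in :: "('a \<times> 'a) set \<Rightarrow> 'i set \<Rightarrow> 'a \<Rightarrow> ('i \<Rightarrow> 'a) \<Rightarrow> nat" where
  "count_in R J x \<xi> = card {j \<in> J. (x, \<xi> j) \<in> R}"

lemma count_in_le: "finite J \<Longrightarrow> count_in R J x \<xi> \<le> card J"
  unfolding count_in_def by (intro card_mono) auto

lemma count_in_insert:
  assumes "finite J" "j \<notin> J"
  shows "count_in R (insert j J) x \<xi> = (if (x, \<xi> j) \<in> R then Suc (count_in R J x \<xi>) else count_in R J x \<xi>)"
proof -
  have "{i \<in> insert j J. (x, \<xi> i) \<in> R}
      = (if (x, \<xi> j) \<in> R then insert j {i \<in> J. (x, \<xi> i) \<in> R} else {i \<in> J. (x, \<xi> i) \<in> R})"
    by auto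
  then show ?thesis using assms by (simp add: count_in_def)
qed

lemma count_in_upd: "j \<notin> J \<Longrightarrow> count_in R J x (\<xi>(j := t)) = count_in R J x \<xi>"
  unfolding count_in_def by (rule arg_cong[where f = card]) auto

lemma measurable_count_in:
  assumes "R \<in> sets (D \<Otimes>\<^sub>M D)" and "finite J"
    and "f \<in> measurable N D" and "\<And>j. j \<in> J \<Longrightarrow> (\<lambda>z. g z j) \<in> measurable N D"
  shows "(\<lambda>z. count_in R J (f z) (g z)) \<in> measurable N (count_space UNIV)"
  using assms(2,4)
proof (induction J)
  case (insert j J)
  note [measurable] = assms(1,3)
  have [measurable]: "(\<lambda>z. g z j) \<in> measurable N D"
    "(\<lambda>z. count_in R J (f z) (g z)) \<in> measurable N (count_space UNIV)"
    using insert by auto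
  show ?case unfolding count_in_insert[OF insert.hyps] by measurable
qed (simp add: count_in_def)

text \<open>
  The points with index in \<open>A\<close> are those at which the functional is evaluated, the points with index
  in \<open>J\<close> are counted, and \<open>(x, y) \<in> R\<close> says that \<open>y\<close> is a neighbour of \<open>x\<close>. The value of the functional at
  \<open>x\<close> is \<open>h n x\<close> when \<open>n\<close> neighbours are found. The function \<open>w\<close> stands for the derivative of the
  functional with respect to the estimated density, \<open>\<psi>\<close> for its value at the true density. The bound
  \<open>B\<close> only serves integrability, and \<open>a\<close>, \<open>b\<close>, \<open>c\<close> are the errors that decide the result.
\<close>
locale kernel_statistic = prob_space D for D :: "'a measure" +
  fixes R :: "('a \<times> 'a) set" and q w \<psi> \<Phi> :: "'a \<Rightarrow> real" and h :: "nat \<Rightarrow> 'a \<Rightarrow> real"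
    and A J :: "'i set" and B K a b c :: real
  assumes R [measurable]: "R \<in> sets (D \<Otimes>\<^sub>M D)"
    and q_measurable [measurable]: "q \<in> borel_measurable D"
    and w_measurable [measurable]: "w \<in> borel_measurable D"
    and psi_measurable [measurable]: "\<psi> \<in> borel_measurable D"
    and Phi_measurable [measurable]: "\<Phi> \<in> borel_measurable D"
    and h_measurable [measurable]: "\<And>n. h n \<in> borel_measurable D"
    and fin: "finite A" "finite J" and disj: "A \<inter> J = {}" and ne: "A \<noteq> {}" "J \<noteq> {}"
    and q_pos: "\<And>x. x \<in> space D \<Longrightarrow> 0 < q x"
    and q_bounded: "\<And>x. x \<in> space D \<Longrightarrow> q x \<le> B" "\<And>x. x \<in> space D \<Longrightarrow> 1 / q x \<le> B"
    and w_bounded: "\<And>x. x \<in> space D \<Longrightarrow> \<bar>w x\<bar> \<le> B"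
    and psi_bounded: "\<And>x. x \<in> space D \<Longrightarrow> \<bar>\<psi> x\<bar> \<le> B"
    and Phi_bounded: "\<And>x. x \<in> space D \<Longrightarrow> \<bar>\<Phi> x\<bar> \<le> B"
    and h_bounded: "\<And>n x. x \<in> space D \<Longrightarrow> n \<le> card J \<Longrightarrow> \<bar>h n x\<bar> \<le> B"
    and K_pos: "0 < K"
    and kernel_mass_source: "\<And>y. y \<in> space D \<Longrightarrow> (\<integral>x. indicator R (x, y) / q x \<partial>D) \<le> K"
    and kernel_mass_target: "\<And>x. x \<in> space D \<Longrightarrow> (\<integral>y. indicator R (x, y) / q x \<partial>D) \<le> K"
    and plug_in_error:
      "(\<integral>x. (\<integral>\<xi>. (h (count_in R J x \<xi>) x - \<psi> x)\<^sup>2 \<partial>PiM (A \<union> J) (\<lambda>_. D)) \<partial>D) \<le> a"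
    and slope_error: "\<And>j. j \<in> J \<Longrightarrow>
      (\<integral>x. (\<integral>\<xi>. (real (card J) * q x * (h (Suc (count_in R (J - {j}) x \<xi>)) x - h (count_in R (J - {j}) x \<xi>) x)
         - w x)\<^sup>2 \<partial>PiM (A \<union> J) (\<lambda>_. D)) \<partial>D) \<le> b"
    and smoothing_error: "(\<integral>y. ((\<integral>x. indicator R (x, y) / q x * w x \<partial>D) - \<Phi> y)\<^sup>2 \<partial>D) \<le> c"
begin

abbreviation "joint \<equiv> PiM (A \<union> J) (\<lambda>_. D)"

text \<open>
  One more neighbour raises the density estimate by \<open>1 / (card J * q x)\<close>. Hence \<open>slope\<close> is the error of a
  difference quotient of the functional, and \<open>kern x y / card J\<close> the change of the estimate at \<open>x\<close> caused
  by a point at \<open>y\<close>. The function \<open>H\<close> is the mean of \<open>u\<close> over a new evaluation point, the counted points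
  being held fixed.
\<close>
definition "kern x y = indicator R (x, y) / q x"
definition "u x \<xi> = h (count_in R J x \<xi>) x - \<psi> x"
definition "H \<xi> = (\<integral>x. u x \<xi> \<partial>D)"
definition "slope j x \<xi> = real (card J) * q x *
   (h (Suc (count_in R (J - {j}) x \<xi>)) x - h (count_in R (J - {j}) x \<xi>) x) - w x"

sublocale Pi: prob_space joint
  by (intro prob_space_PiM prob_space_axioms)

sublocale DP: pair_prob_space D joint ..

lemma B_nonneg: "0 \<le> B"
proof -
  obtain x where "x \<in> space D" using not_empty by blast
  then show ?thesis using w_bounded[of x] by linarith
qed

lemma component [measurable]: "j \<in> A \<union> J \<Longrightarrow> (\<lambda>\<xi>. \<xi> j) \<in> measurable joint D"
  by simp

lemma count_measurable:
  assumes "J' \<subseteq> J" "f \<in> measurable N D" "g \<in> measurable N joint"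
  shows "(\<lambda>z. count_in R J' (f z) (g z)) \<in> measurable N (count_space UNIV)"
proof (rule measurable_count_in[OF R])
  fix j assume "j \<in> J'"
  then have [measurable]: "(\<lambda>\<xi>. \<xi> j) \<in> measurable joint D" using assms(1) by auto
  show "(\<lambda>z. g z j) \<in> measurable N D" using assms(3) by measurable
qed (use assms fin in \<open>auto intro: finite_subset\<close>)

lemma u_measurable [measurable]:
  assumes [measurable]: "f \<in> measurable N D" "g \<in> measurable N joint"
  shows "(\<lambda>z. u (f z) (g z)) \<in> borel_measurable N"
proof -
  note [measurable] = count_measurable[OF order_refl assms]
  have "(\<lambda>z. h (count_in R J (f z) (g z)) (f z)) \<in> borel_measurable N"
    by (rule measurable_compose_countable) measurable
  then show ?thesis unfolding u_def by measurable
qed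

lemma slope_measurable [measurable]:
  assumes [measurable]: "f \<in> measurable N D" "g \<in> measurable N joint"
  shows "(\<lambda>z. slope j (f z) (g z)) \<in> borel_measurable N"
proof -
  note [measurable] = count_measurable[OF Diff_subset assms, of "{j}"]
  have "(\<lambda>z. h (count_in R (J - {j}) (f z) (g z)) (f z)) \<in> borel_measurable N"
    by (rule measurable_compose_countable) measurable
  moreover have "(\<lambda>z. h (Suc (count_in R (J - {j}) (f z) (g z))) (f z)) \<in> borel_measurable N"
    by (rule measurable_compose_countable[where f = "\<lambda>n z. h (Suc n) (f z)"]) measurable
  ultimately show ?thesis unfolding slope_def by measurable
qed

lemma kern_measurable [measurable]:
  assumes [measurable]: "f \<in> measurable N D" "g \<in> measurable N D"
  shows "(\<lambda>z. kern (f z) (g z)) \<in> borel_measurable N"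
  unfolding kern_def by measurable

lemma u_bounded: "x \<in> space D \<Longrightarrow> \<bar>u x \<xi>\<bar> \<le> 2 * B"
  using h_bounded[OF _ count_in_le[OF fin(2)], of x R x \<xi>] psi_bounded[of x] unfolding u_def by linarith

lemma H_bounded: "\<bar>H \<xi>\<bar> \<le> 2 * B"
  unfolding H_def using u_bounded B_nonneg by (intro abs_expectation_le) auto

lemma H_measurable [measurable]:
  assumes [measurable]: "g \<in> measurable N joint"
  shows "(\<lambda>z. H (g z)) \<in> borel_measurable N"
proof -
  have "H \<in> borel_measurable joint"
    unfolding H_def[abs_def] by (rule borel_measurable_lebesgue_integral) measurable
  then show ?thesis by measurable
qed

lemma kern_nonneg: "x \<in> space D \<Longrightarrow> 0 \<le> kern x y"
  using q_pos[of x] by (simp add: kern_def)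

lemma kern_bounded: "x \<in> space D \<Longrightarrow> \<bar>kern x y\<bar> \<le> B"
  using q_pos[of x] q_bounded(2)[of x] B_nonneg by (auto simp: kern_def indicator_def)

lemma Suc_count_le: "j \<in> J \<Longrightarrow> Suc (count_in R (J - {j}) x \<xi>) \<le> card J"
  using count_in_le[of "J - {j}" R x \<xi>] fin
  by (metis Suc_le_mono card.remove finite_Diff)

definition "slope_bound = real (card J) * B * (2 * B) + B"

lemma slope_bounded:
  assumes "j \<in> J" "x \<in> space D"
  shows "\<bar>slope j x \<xi>\<bar> \<le> slope_bound"
proof -
  let ?n = "count_in R (J - {j}) x \<xi>"
  have "\<bar>h (Suc ?n) x - h ?n x\<bar> \<le> 2 * B"
    using h_bounded[OF assms(2) Suc_count_le[OF assms(1)], of x \<xi>]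
      h_bounded[OF assms(2), of ?n] Suc_count_le[OF assms(1), of x \<xi>] by (smt (verit) Suc_leD)
  then have "\<bar>real (card J) * q x * (h (Suc ?n) x - h ?n x)\<bar> \<le> real (card J) * B * (2 * B)"
    unfolding abs_mult using q_pos[OF assms(2)] q_bounded(1)[OF assms(2)] B_nonneg
    by (intro mult_mono) auto
  then show ?thesis using w_bounded[OF assms(2)] unfolding slope_def slope_bound_def by linarith
qed

lemma resample:
  fixes F :: "('i \<Rightarrow> 'a) \<Rightarrow> real"
  assumes "i \<in> A \<union> J" "F \<in> borel_measurable joint" "\<And>\<xi>. \<xi> \<in> space joint \<Longrightarrow> \<bar>F \<xi>\<bar> \<le> C"
  shows "(\<integral>\<xi>. F \<xi> \<partial>joint) = (\<integral>\<xi>. (\<integral>t. F (\<xi>(i := t)) \<partial>D) \<partial>joint)"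
proof -
  have eq: "insert i (A \<union> J) = A \<union> J" using assms(1) by auto
  show ?thesis
    using integral_PiM_insert_resample(1)[of D i "A \<union> J" F] Pi.integrable_bounded[OF assms(2,3)]
      prob_space_axioms unfolding eq by simp
qed

lemma u_upd: "i \<in> A \<Longrightarrow> u x (\<xi>(i := t)) = u x \<xi>"
  using disj unfolding u_def by (subst count_in_upd) auto

lemma H_upd: "i \<in> A \<Longrightarrow> H (\<xi>(i := t)) = H \<xi>"
  unfolding H_def by (simp only: u_upd)

lemma expectation_u: "(\<integral>\<xi>. (\<integral>x. (u x \<xi>)\<^sup>2 \<partial>D) \<partial>joint) \<le> a"
proof -
  have "integrable (D \<Otimes>\<^sub>M joint) (\<lambda>(x, \<xi>). (u x \<xi>)\<^sup>2)"
    unfolding split_beta'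
    by (rule DP.P.integrable_square_bounded[of _ "2 * B"]) (auto simp: space_pair_measure u_bounded)
  then show ?thesis using DP.Fubini_integral[of "\<lambda>x \<xi>. (u x \<xi>)\<^sup>2"] plug_in_error
    by (simp add: u_def)
qed

text \<open>
  The summands are conditionally independent and centred given the counted points, hence
  orthogonal.
\<close>
lemma evaluation_part:
  "(\<integral>\<xi>. ((\<Sum>i\<in>A. u (\<xi> i) \<xi> - H \<xi>) / real (card A))\<^sup>2 \<partial>joint) \<le> a / real (card A)"
proof -
  define U where "U i \<xi> = u (\<xi> i) \<xi> - H \<xi>" for i \<xi>
  have U_m: "U i \<in> borel_measurable joint" if "i \<in> A" for i
  proof -
    have [measurable]: "(\<lambda>\<xi>. \<xi> i) \<in> measurable joint D" using that by simp
    show ?thesis unfolding U_def by measurable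
  qed
  have UB: "\<bar>U i \<xi>\<bar> \<le> 4 * B" if "i \<in> A" "\<xi> \<in> space joint" for i \<xi>
  proof -
    have "\<xi> i \<in> space D" using that by (auto simp: space_PiM)
    from u_bounded[OF this, of \<xi>] H_bounded[of \<xi>] show ?thesis unfolding U_def by linarith
  qed
  have UUB: "\<bar>U i \<xi> * U j \<xi>\<bar> \<le> (4 * B) * (4 * B)" if "i \<in> A" "j \<in> A" "\<xi> \<in> space joint" for i j \<xi>
    unfolding abs_mult using UB that by (intro mult_mono) (auto simp: B_nonneg)
  have U_upd: "U i (\<xi>(i := t)) = u t \<xi> - H \<xi>" if "i \<in> A" for i \<xi> t
    using that by (simp only: U_def u_upd H_upd fun_upd_same)
  have iu: "integrable D (\<lambda>t. u t \<xi>)" "integrable D (\<lambda>t. (u t \<xi>)\<^sup>2)" if "\<xi> \<in> space joint" for \<xi>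
    using that by (auto intro!: integrable_bounded[OF _ u_bounded] integrable_square_bounded[OF _ u_bounded])
  have orth: "(\<integral>\<xi>. U i \<xi> * U j \<xi> \<partial>joint) = 0" if "i \<in> A" "j \<in> A" "i \<noteq> j" for i j
  proof -
    note [measurable] = U_m[OF that(1)] U_m[OF that(2)]
    have j: "U j (\<xi>(i := t)) = U j \<xi>" for \<xi> t
      unfolding U_def u_upd[OF that(1)] H_upd[OF that(1)] using that(3) by simp
    have "(\<integral>\<xi>. U i \<xi> * U j \<xi> \<partial>joint) = (\<integral>\<xi>. (\<integral>t. U i (\<xi>(i := t)) * U j (\<xi>(i := t)) \<partial>D) \<partial>joint)"
      using that by (intro resample[where C = "(4 * B) * (4 * B)"] UUB) auto
    also have "\<dots> = (\<integral>\<xi>. 0 \<partial>joint)"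
    proof (intro Bochner_Integration.integral_cong refl)
      fix \<xi> assume "\<xi> \<in> space joint"
      from iu(1)[OF this] show "(\<integral>t. U i (\<xi>(i := t)) * U j (\<xi>(i := t)) \<partial>D) = 0"
        by (simp add: U_upd[OF that(1)] j H_def prob_space)
    qed
    finally show ?thesis by simp
  qed
  have diag: "(\<integral>\<xi>. U i \<xi> * U i \<xi> \<partial>joint) \<le> a" if "i \<in> A" for i
  proof -
    note [measurable] = U_m[OF that]
    have "(\<integral>\<xi>. U i \<xi> * U i \<xi> \<partial>joint) = (\<integral>\<xi>. (\<integral>t. U i (\<xi>(i := t)) * U i (\<xi>(i := t)) \<partial>D) \<partial>joint)"
      using that by (intro resample[where C = "(4 * B) * (4 * B)"] UUB) auto
    also have "\<dots> = (\<integral>\<xi>. (\<integral>t. (u t \<xi> - H \<xi>)\<^sup>2 \<partial>D) \<partial>joint)"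
      unfolding U_upd[OF that] power2_eq_square ..
    also have "\<dots> \<le> (\<integral>\<xi>. (\<integral>t. (u t \<xi>)\<^sup>2 \<partial>D) \<partial>joint)"
    proof (rule integral_mono)
      have "\<bar>u t \<xi>\<bar> \<le> 4 * B" "\<bar>u t \<xi> - H \<xi>\<bar> \<le> 4 * B" if "t \<in> space D" for t \<xi>
        using u_bounded[OF that, of \<xi>] H_bounded[of \<xi>] B_nonneg by linarith+
      then have sq: "\<bar>(u t \<xi>)\<^sup>2\<bar> \<le> (4 * B)\<^sup>2" "\<bar>(u t \<xi> - H \<xi>)\<^sup>2\<bar> \<le> (4 * B)\<^sup>2" if "t \<in> space D" for t \<xi>
        using that unfolding abs_power2 abs_le_square_iff[symmetric]
        by (meson abs_ge_self order_trans)+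
      show "integrable joint (\<lambda>\<xi>. \<integral>t. (u t \<xi> - H \<xi>)\<^sup>2 \<partial>D)"
        by (rule Pi.integrable_bounded[where B = "(4 * B)\<^sup>2"], rule borel_measurable_lebesgue_integral,
            measurable, intro abs_expectation_le sq zero_le_power2)
      show "integrable joint (\<lambda>\<xi>. \<integral>t. (u t \<xi>)\<^sup>2 \<partial>D)"
        by (rule Pi.integrable_bounded[where B = "(4 * B)\<^sup>2"], rule borel_measurable_lebesgue_integral,
            measurable, intro abs_expectation_le sq zero_le_power2)
    next
      fix \<xi> assume "\<xi> \<in> space joint"
      from variance_eq[OF iu[OF this]] show "(\<integral>t. (u t \<xi> - H \<xi>)\<^sup>2 \<partial>D) \<le> (\<integral>t. (u t \<xi>)\<^sup>2 \<partial>D)"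
        by (simp add: H_def)
    qed
    also note expectation_u
    finally show ?thesis .
  qed
  have "(\<integral>\<xi>. ((\<Sum>i\<in>A. U i \<xi>) / real (card A))\<^sup>2 \<partial>joint)
      = (\<integral>\<xi>. (\<Sum>i\<in>A. U i \<xi>)\<^sup>2 \<partial>joint) / (real (card A))\<^sup>2"
    by (simp add: power_divide)
  also have "(\<integral>\<xi>. (\<Sum>i\<in>A. U i \<xi>)\<^sup>2 \<partial>joint) = (\<Sum>i\<in>A. \<integral>\<xi>. (U i \<xi>)\<^sup>2 \<partial>joint)"
    by (rule Pi.expectation_square_orthogonal_sum[OF fin(1) U_m UB orth])
  also have "\<dots> / (real (card A))\<^sup>2 \<le> (\<Sum>i\<in>A. a) / (real (card A))\<^sup>2"
    unfolding power2_eq_square by (intro divide_right_mono sum_mono diag) auto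
  also have "\<dots> = a / real (card A)"
    using fin ne by (simp add: power2_eq_square)
  finally show ?thesis unfolding U_def .
qed

text \<open>
  The Cauchy-Schwarz inequality for the measure with density \<open>\<lambda>x. kern x y\<close>, whose mass is at most
  \<open>K\<close>.
\<close>
lemma kern_integral_le:
  assumes "y \<in> space D" "e \<in> borel_measurable D" "\<And>x. x \<in> space D \<Longrightarrow> \<bar>e x\<bar> \<le> C"
  shows "(\<integral>x. kern x y * e x \<partial>D)\<^sup>2 \<le> K * (\<integral>x. kern x y * (e x)\<^sup>2 \<partial>D)"
proof -
  note [measurable] = assms(1,2)
  have ik: "integrable D (\<lambda>x. kern x y)"
    using kern_bounded by (intro integrable_bounded[of _ B]) auto
  have e2: "\<bar>(e x)\<^sup>2\<bar> \<le> C\<^sup>2" if "x \<in> space D" for x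
    using assms(3)[OF that] by (simp only: abs_power2 abs_le_square_iff[symmetric])
  have C: "0 \<le> C" using assms(3)[OF assms(1)] by linarith
  have ie: "integrable D (\<lambda>x. kern x y * e x)"
    by (rule integrable_bounded[where B = "B * C"])
       (auto simp: abs_mult intro!: mult_mono kern_bounded assms(3) B_nonneg)
  have ie2: "integrable D (\<lambda>x. kern x y * (e x)\<^sup>2)"
    by (rule integrable_bounded[where B = "B * C\<^sup>2"])
       (use e2 in \<open>auto simp: abs_mult intro!: mult_mono kern_bounded B_nonneg\<close>)
  define Q where "Q = (\<integral>x. kern x y * e x \<partial>D)"
  define s where "s = Q / K"
  \<comment> \<open>with \<open>K\<close> in place of the mass, \<open>s\<close> is the minimiser of the quadratic polynomial below\<close>
  have "0 \<le> (\<integral>x. kern x y * (s - e x)\<^sup>2 \<partial>D)"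
    by (intro Bochner_Integration.integral_nonneg_AE AE_I2 mult_nonneg_nonneg kern_nonneg) auto
  also have "\<dots> = (\<integral>x. s\<^sup>2 * kern x y - 2 * s * (kern x y * e x) + kern x y * (e x)\<^sup>2 \<partial>D)"
    by (intro Bochner_Integration.integral_cong) (auto simp: power2_eq_square algebra_simps)
  also have "\<dots> = s\<^sup>2 * (\<integral>x. kern x y \<partial>D) - 2 * s * Q + (\<integral>x. kern x y * (e x)\<^sup>2 \<partial>D)"
    using ik ie ie2 by (simp add: Q_def)
  also have "\<dots> \<le> s\<^sup>2 * K - 2 * s * Q + (\<integral>x. kern x y * (e x)\<^sup>2 \<partial>D)"
    using kernel_mass_source[OF assms(1)]
    by (intro add_right_mono diff_right_mono mult_left_mono) (auto simp: kern_def)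
  finally have "Q\<^sup>2 / K \<le> (\<integral>x. kern x y * (e x)\<^sup>2 \<partial>D)"
    using K_pos by (simp add: s_def power2_eq_square)
  then show ?thesis using K_pos by (simp add: Q_def divide_simps mult.commute)
qed

definition "residual \<xi> = H \<xi> - (\<Sum>j\<in>J. \<Phi> (\<xi> j)) / real (card J)"

definition "residual_without i \<xi> = (if i \<in> J
   then (\<integral>x. h (count_in R (J - {i}) x \<xi>) x - \<psi> x \<partial>D) - (\<Sum>j\<in>J - {i}. \<Phi> (\<xi> j)) / real (card J)
   else residual \<xi>)"

definition "smoothing y = (\<integral>x. kern x y * w x \<partial>D) - \<Phi> y"

lemma smoothing_measurable [measurable]: "smoothing \<in> borel_measurable D"
  unfolding smoothing_def[abs_def] by (intro borel_measurable_diff borel_measurable_lebesgue_integral) measurable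

lemma smoothing_bounded: "y \<in> space D \<Longrightarrow> \<bar>smoothing y\<bar> \<le> B * B + B"
proof -
  assume y: "y \<in> space D"
  have "\<bar>\<integral>x. kern x y * w x \<partial>D\<bar> \<le> B * B"
    by (intro abs_expectation_le)
       (auto simp: abs_mult B_nonneg intro!: mult_mono kern_bounded w_bounded)
  then show ?thesis using Phi_bounded[OF y] unfolding smoothing_def by linarith
qed

text \<open>
  Deleting the point with index \<open>j\<close> lowers the count by one at its neighbours and changes nothing
  elsewhere. So the difference is an integral of difference quotients over these neighbours;
  replacing each quotient by \<open>w\<close> produces \<open>slope\<close>, and comparing the remaining average of \<open>w\<close> with
  \<open>\<Phi>\<close> produces \<open>smoothing\<close>.
\<close>
lemma leave_one_out_difference:
  assumes "j \<in> J" "\<xi> \<in> space joint"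
  shows "real (card J) * (residual \<xi> - residual_without j \<xi>)
    = (\<integral>x. kern x (\<xi> j) * slope j x \<xi> \<partial>D) + smoothing (\<xi> j)"
proof -
  have M: "0 < real (card J)" using fin ne by (simp add: card_gt_0_iff)
  have y: "\<xi> j \<in> space D" using assms by (auto simp: space_PiM)
  note [measurable] = assms(2) y
  define v where "v x = h (count_in R (J - {j}) x \<xi>) x - \<psi> x" for x
  have [measurable]: "v \<in> borel_measurable D"
  proof -
    have [measurable]: "(\<lambda>x. count_in R (J - {j}) x \<xi>) \<in> measurable D (count_space UNIV)"
      by (rule count_measurable[of _ "\<lambda>x. x"]) (use assms in auto)
    have "(\<lambda>x. h (count_in R (J - {j}) x \<xi>) x) \<in> borel_measurable D"
      by (rule measurable_compose_countable) measurable
    then show ?thesis unfolding v_def[abs_def] by measurable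
  qed
  have vB: "\<bar>v x\<bar> \<le> 2 * B" if "x \<in> space D" for x
    using h_bounded[OF that, of "count_in R (J - {j}) x \<xi>"] Suc_count_le[OF assms(1), of x \<xi>]
      psi_bounded[OF that] unfolding v_def by (smt (verit) Suc_leD)
  have iu: "integrable D (\<lambda>x. u x \<xi>)" by (rule integrable_bounded[OF _ u_bounded]) auto
  have iv: "integrable D v" by (rule integrable_bounded[OF _ vB]) auto
  have isl: "integrable D (\<lambda>x. kern x (\<xi> j) * slope j x \<xi>)"
    by (rule integrable_bounded[where B = "B * slope_bound"])
       (auto simp: abs_mult B_nonneg intro!: mult_mono kern_bounded slope_bounded[OF assms(1)])
  have iw: "integrable D (\<lambda>x. kern x (\<xi> j) * w x)"
    by (rule integrable_bounded[where B = "B * B"])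
       (auto simp: abs_mult B_nonneg intro!: mult_mono kern_bounded w_bounded)
  have J: "J = insert j (J - {j})" "finite (J - {j})" "j \<notin> J - {j}" using assms fin by auto
  have pt: "real (card J) * (u x \<xi> - v x) = kern x (\<xi> j) * slope j x \<xi> + kern x (\<xi> j) * w x"
    if "x \<in> space D" for x
  proof -
    have "count_in R J x \<xi> = (if (x, \<xi> j) \<in> R then Suc (count_in R (J - {j}) x \<xi>) else count_in R (J - {j}) x \<xi>)"
      using count_in_insert[OF J(2,3), of R x \<xi>] J(1) by simp
    then show ?thesis using q_pos[OF that]
      by (simp add: u_def v_def kern_def slope_def field_simps)
  qed
  have "real (card J) * (residual \<xi> - residual_without j \<xi>)
      = real (card J) * (\<integral>x. u x \<xi> - v x \<partial>D) - \<Phi> (\<xi> j)"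
    using iu iv assms(1) M sum.remove[OF fin(2) assms(1), of "\<lambda>i. \<Phi> (\<xi> i)"]
    by (simp add: residual_def residual_without_def H_def v_def[symmetric] field_simps)
  also have "real (card J) * (\<integral>x. u x \<xi> - v x \<partial>D) = (\<integral>x. real (card J) * (u x \<xi> - v x) \<partial>D)"
    by simp
  also have "\<dots> = (\<integral>x. kern x (\<xi> j) * slope j x \<xi> + kern x (\<xi> j) * w x \<partial>D)"
    by (intro Bochner_Integration.integral_cong refl pt)
  also have "\<dots> = (\<integral>x. kern x (\<xi> j) * slope j x \<xi> \<partial>D) + (\<integral>x. kern x (\<xi> j) * w x \<partial>D)"
    using isl iw by simp
  finally show ?thesis by (simp add: smoothing_def)
qed

lemma slope_upd: "slope j x (\<xi>(j := t)) = slope j x \<xi>"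
  unfolding slope_def by (simp only: count_in_upd Diff_iff singleton_iff simp_thms)

lemma slope_square_bounded: "j \<in> J \<Longrightarrow> x \<in> space D \<Longrightarrow> \<bar>(slope j x \<xi>)\<^sup>2\<bar> \<le> slope_bound\<^sup>2"
  using slope_bounded[of j x \<xi>] unfolding abs_power2 abs_le_square_iff[symmetric]
  by (meson abs_ge_self order_trans)

text \<open>
  The count without the point \<open>j\<close> is independent of that point, so that the kernel can be integrated
  out first.
\<close>
lemma localised_slope_error:
  assumes "j \<in> J"
  shows "(\<integral>\<xi>. (\<integral>x. kern x (\<xi> j) * (slope j x \<xi>)\<^sup>2 \<partial>D) \<partial>joint) \<le> K * b"
proof -
  have j: "j \<in> A \<union> J" using assms by simp
  note [measurable] = component[OF j]
  have bd: "\<bar>kern x y * (slope j x \<xi>)\<^sup>2\<bar> \<le> B * slope_bound\<^sup>2" if "x \<in> space D" for x y \<xi>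
    unfolding abs_mult using that assms by (intro mult_mono kern_bounded slope_square_bounded B_nonneg) auto
  have "integrable (D \<Otimes>\<^sub>M joint) (\<lambda>(x, \<xi>). kern x (\<xi> j) * (slope j x \<xi>)\<^sup>2)"
    unfolding split_beta'
    by (rule DP.P.integrable_bounded[of _ "B * slope_bound\<^sup>2"]) (auto simp: space_pair_measure intro!: bd)
  then have "(\<integral>\<xi>. (\<integral>x. kern x (\<xi> j) * (slope j x \<xi>)\<^sup>2 \<partial>D) \<partial>joint)
      = (\<integral>x. (\<integral>\<xi>. kern x (\<xi> j) * (slope j x \<xi>)\<^sup>2 \<partial>joint) \<partial>D)"
    by (rule DP.Fubini_integral)
  also have "\<dots> \<le> (\<integral>x. K * (\<integral>\<xi>. (slope j x \<xi>)\<^sup>2 \<partial>joint) \<partial>D)"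
  proof (rule integral_mono)
    show "integrable D (\<lambda>x. \<integral>\<xi>. kern x (\<xi> j) * (slope j x \<xi>)\<^sup>2 \<partial>joint)"
      by (rule integrable_bounded[where B = "B * slope_bound\<^sup>2"])
         (auto intro!: Pi.abs_expectation_le bd Pi.borel_measurable_lebesgue_integral B_nonneg mult_nonneg_nonneg)
    show "integrable D (\<lambda>x. K * (\<integral>\<xi>. (slope j x \<xi>)\<^sup>2 \<partial>joint))"
      by (intro integrable_mult_right integrable_bounded[where B = "slope_bound\<^sup>2"])
         (auto intro!: Pi.expectation_le_bound Pi.borel_measurable_lebesgue_integral
               slope_square_bounded[OF assms, unfolded abs_power2])
  next
    fix x assume x: "x \<in> space D"
    note [measurable] = x
    have "(\<integral>\<xi>. kern x (\<xi> j) * (slope j x \<xi>)\<^sup>2 \<partial>joint)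
        = (\<integral>\<xi>. (\<integral>t. kern x ((\<xi>(j := t)) j) * (slope j x (\<xi>(j := t)))\<^sup>2 \<partial>D) \<partial>joint)"
      by (rule resample[OF j _ bd[OF x]]) measurable
    also have "\<dots> = (\<integral>\<xi>. (\<integral>t. kern x t \<partial>D) * (slope j x \<xi>)\<^sup>2 \<partial>joint)"
      by (simp only: slope_upd fun_upd_same) simp
    also have "\<dots> \<le> (\<integral>\<xi>. K * (slope j x \<xi>)\<^sup>2 \<partial>joint)"
    proof (rule integral_mono)
      have i: "integrable joint (\<lambda>\<xi>. (slope j x \<xi>)\<^sup>2)"
        by (rule Pi.integrable_square_bounded[OF _ slope_bounded[OF assms x]]) measurable
      then show "integrable joint (\<lambda>\<xi>. (\<integral>t. kern x t \<partial>D) * (slope j x \<xi>)\<^sup>2)"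
        "integrable joint (\<lambda>\<xi>. K * (slope j x \<xi>)\<^sup>2)" by auto
      show "(\<integral>t. kern x t \<partial>D) * (slope j x \<xi>)\<^sup>2 \<le> K * (slope j x \<xi>)\<^sup>2" for \<xi>
        using kernel_mass_target[OF x] by (intro mult_right_mono) (auto simp: kern_def)
    qed
    finally show "(\<integral>\<xi>. kern x (\<xi> j) * (slope j x \<xi>)\<^sup>2 \<partial>joint) \<le> K * (\<integral>\<xi>. (slope j x \<xi>)\<^sup>2 \<partial>joint)"
      by simp
  qed
  also have "\<dots> = K * (\<integral>x. (\<integral>\<xi>. (slope j x \<xi>)\<^sup>2 \<partial>joint) \<partial>D)" by simp
  also have "\<dots> \<le> K * b"
    using slope_error[OF assms] K_pos by (intro mult_left_mono) (auto simp: slope_def)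
  finally show ?thesis .
qed

lemma residual_measurable: "residual \<in> borel_measurable joint"
  unfolding residual_def[abs_def] by (intro borel_measurable_diff borel_measurable_divide borel_measurable_sum) auto

lemma residual_without_measurable: "i \<in> A \<union> J \<Longrightarrow> residual_without i \<in> borel_measurable joint"
proof (cases "i \<in> J")
  case True
  have [measurable]: "(\<lambda>z. count_in R (J - {i}) (snd z) (fst z)) \<in> measurable (joint \<Otimes>\<^sub>M D) (count_space UNIV)"
    by (rule count_measurable) auto
  have "(\<lambda>z. h (count_in R (J - {i}) (snd z) (fst z)) (snd z)) \<in> borel_measurable (joint \<Otimes>\<^sub>M D)"
    by (rule measurable_compose_countable) measurable
  then have [measurable]: "(\<lambda>(\<xi>, x). h (count_in R (J - {i}) x \<xi>) x - \<psi> x) \<in> borel_measurable (joint \<Otimes>\<^sub>M D)"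
    unfolding split_beta' by measurable
  have "(\<lambda>\<xi>. \<integral>x. h (count_in R (J - {i}) x \<xi>) x - \<psi> x \<partial>D) \<in> borel_measurable joint"
    by (rule borel_measurable_lebesgue_integral) measurable
  then show ?thesis using True unfolding residual_without_def[abs_def] if_P[OF True]
    by (intro borel_measurable_diff borel_measurable_divide borel_measurable_sum) auto
qed (use residual_measurable in \<open>simp add: residual_without_def[abs_def]\<close>)

lemma sum_Phi_bounded:
  assumes "\<xi> \<in> space joint" "J' \<subseteq> J"
  shows "\<bar>(\<Sum>j\<in>J'. \<Phi> (\<xi> j)) / real (card J)\<bar> \<le> B"
proof -
  have "\<bar>\<Sum>j\<in>J'. \<Phi> (\<xi> j)\<bar> \<le> (\<Sum>j\<in>J'. B)"
    using assms by (intro order_trans[OF sum_abs] sum_mono Phi_bounded) (auto simp: space_PiM)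
  also have "\<dots> \<le> real (card J) * B"
    using card_mono[OF fin(2) assms(2)] B_nonneg by (simp add: mult_right_mono)
  finally show ?thesis using fin ne by (simp add: card_gt_0_iff divide_simps mult.commute)
qed

lemma residual_bounded:
  assumes "\<xi> \<in> space joint"
  shows "\<bar>residual \<xi>\<bar> \<le> 3 * B"
  using H_bounded[of \<xi>] sum_Phi_bounded[OF assms order_refl] unfolding residual_def by linarith

lemma residual_without_bounded: "\<xi> \<in> space joint \<Longrightarrow> \<bar>residual_without i \<xi>\<bar> \<le> 3 * B"
proof (cases "i \<in> J")
  case True
  assume x: "\<xi> \<in> space joint"
  have "\<bar>\<integral>x. h (count_in R (J - {i}) x \<xi>) x - \<psi> x \<partial>D\<bar> \<le> 2 * B"
  proof (rule abs_expectation_le)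
    fix x assume "x \<in> space D"
    then show "\<bar>h (count_in R (J - {i}) x \<xi>) x - \<psi> x\<bar> \<le> 2 * B"
      using h_bounded[of x "count_in R (J - {i}) x \<xi>"] Suc_count_le[OF True, of x \<xi>]
        psi_bounded[of x] by (smt (verit) Suc_leD)
  qed (use B_nonneg in simp)
  then show ?thesis using sum_Phi_bounded[OF x Diff_subset, of "{i}"] True
    unfolding residual_without_def if_P[OF True] by linarith
qed (use residual_bounded in \<open>simp add: residual_without_def\<close>)

lemma residual_without_upd: "i \<in> A \<union> J \<Longrightarrow> residual_without i (\<xi>(i := t)) = residual_without i \<xi>"
proof (cases "i \<in> J")
  case True
  have "(\<Sum>j\<in>J - {i}. \<Phi> ((\<xi>(i := t)) j)) = (\<Sum>j\<in>J - {i}. \<Phi> (\<xi> j))"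
    by (intro sum.cong) auto
  then show ?thesis using True
    by (simp only: residual_without_def if_P count_in_upd Diff_iff singleton_iff simp_thms)
next
  case False
  assume "i \<in> A \<union> J"
  then have i: "i \<in> A" using False by simp
  have "(\<Sum>j\<in>J. \<Phi> ((\<xi>(i := t)) j)) = (\<Sum>j\<in>J. \<Phi> (\<xi> j))"
    using False by (intro sum.cong) auto
  then show ?thesis
    by (simp only: residual_without_def if_not_P[OF False] residual_def H_upd[OF i])
qed

lemma leave_one_out_error:
  assumes "j \<in> J"
  shows "(\<integral>\<xi>. (residual \<xi> - residual_without j \<xi>)\<^sup>2 \<partial>joint) \<le> (2 * K\<^sup>2 * b + 2 * c) / (real (card J))\<^sup>2"
proof -
  have M: "0 < real (card J)" using fin ne by (simp add: card_gt_0_iff)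
  have j: "j \<in> A \<union> J" using assms by simp
  note [measurable] = component[OF j] residual_measurable residual_without_measurable[OF j]
  define I1 where "I1 \<xi> = (\<integral>x. kern x (\<xi> j) * (slope j x \<xi>)\<^sup>2 \<partial>D)" for \<xi>
  have bd: "\<bar>kern x y * (slope j x \<xi>)\<^sup>2\<bar> \<le> B * slope_bound\<^sup>2" if "x \<in> space D" for x y \<xi>
    unfolding abs_mult using that assms by (intro mult_mono kern_bounded slope_square_bounded B_nonneg) auto
  have i1: "integrable joint I1"
    unfolding I1_def
    by (rule Pi.integrable_bounded[where B = "B * slope_bound\<^sup>2"])
       (auto intro!: abs_expectation_le bd borel_measurable_lebesgue_integral B_nonneg mult_nonneg_nonneg)
  have sp: "\<xi> j \<in> space D" if "\<xi> \<in> space joint" for \<xi> using that assms by (auto simp: space_PiM)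
  have i2: "integrable joint (\<lambda>\<xi>. (smoothing (\<xi> j))\<^sup>2)"
    by (rule Pi.integrable_square_bounded[where B = "B * B + B"]) (auto intro!: smoothing_bounded sp)
  have "(\<integral>\<xi>. (real (card J) * (residual \<xi> - residual_without j \<xi>))\<^sup>2 \<partial>joint)
      \<le> (\<integral>\<xi>. 2 * K * I1 \<xi> + 2 * (smoothing (\<xi> j))\<^sup>2 \<partial>joint)"
  proof (rule integral_mono)
    have "\<bar>residual \<xi> - residual_without j \<xi>\<bar> \<le> 6 * B" if "\<xi> \<in> space joint" for \<xi>
      using residual_bounded[OF that] residual_without_bounded[OF that, of j] by linarith
    then have "integrable joint (\<lambda>\<xi>. (residual \<xi> - residual_without j \<xi>)\<^sup>2)"
      by (intro Pi.integrable_square_bounded[where B = "6 * B"]) auto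
    then show "integrable joint (\<lambda>\<xi>. (real (card J) * (residual \<xi> - residual_without j \<xi>))\<^sup>2)"
      by (simp add: power_mult_distrib)
    show "integrable joint (\<lambda>\<xi>. 2 * K * I1 \<xi> + 2 * (smoothing (\<xi> j))\<^sup>2)"
      using i1 i2 by auto
  next
    fix \<xi> assume x: "\<xi> \<in> space joint"
    note [measurable] = x
    define I0 where "I0 = (\<integral>x. kern x (\<xi> j) * slope j x \<xi> \<partial>D)"
    have "I0\<^sup>2 \<le> K * I1 \<xi>"
      unfolding I0_def I1_def
      by (rule kern_integral_le[OF sp[OF x] _ slope_bounded[OF assms]]) measurable
    moreover have "(I0 + smoothing (\<xi> j))\<^sup>2 \<le> 2 * I0\<^sup>2 + 2 * (smoothing (\<xi> j))\<^sup>2"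
      by (rule power2_sum_le)
    ultimately show "(real (card J) * (residual \<xi> - residual_without j \<xi>))\<^sup>2
        \<le> 2 * K * I1 \<xi> + 2 * (smoothing (\<xi> j))\<^sup>2"
      unfolding leave_one_out_difference[OF assms x] I0_def[symmetric] by linarith
  qed
  also have "\<dots> = 2 * K * (\<integral>\<xi>. I1 \<xi> \<partial>joint) + 2 * (\<integral>\<xi>. (smoothing (\<xi> j))\<^sup>2 \<partial>joint)"
    using i1 i2 by simp
  also have "(\<integral>\<xi>. (smoothing (\<xi> j))\<^sup>2 \<partial>joint) = (\<integral>y. (smoothing y)\<^sup>2 \<partial>D)"
    by (rule iid_coordinate_expectation) (use fin j in auto)
  also have "\<dots> \<le> c" using smoothing_error by (simp add: smoothing_def[abs_def] kern_def)
  also have "2 * K * (\<integral>\<xi>. I1 \<xi> \<partial>joint) \<le> 2 * K * (K * b)"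
    using localised_slope_error[OF assms] K_pos unfolding I1_def by (intro mult_left_mono) auto
  finally have "(real (card J))\<^sup>2 * (\<integral>\<xi>. (residual \<xi> - residual_without j \<xi>)\<^sup>2 \<partial>joint) \<le> 2 * K\<^sup>2 * b + 2 * c"
    by (simp add: power_mult_distrib power2_eq_square[of K])
  then show ?thesis using M by (simp add: divide_simps mult.commute)
qed

lemma variance_residual: "Pi.variance residual \<le> (2 * K\<^sup>2 * b + 2 * c) / real (card J)"
proof -
  have "Pi.variance residual \<le> (\<Sum>i\<in>A \<union> J. \<integral>\<xi>. (residual \<xi> - residual_without i \<xi>)\<^sup>2 \<partial>joint)"
    by (rule efron_stein[where B = "3 * B"])
       (use fin in \<open>auto intro: residual_measurable residual_without_measurable residual_bounded
          residual_without_bounded residual_without_upd prob_space_axioms\<close>)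
  also have "\<dots> = (\<Sum>j\<in>J. \<integral>\<xi>. (residual \<xi> - residual_without j \<xi>)\<^sup>2 \<partial>joint)"
    using fin disj by (intro sum.mono_neutral_right) (auto simp: residual_without_def)
  also have "\<dots> \<le> (\<Sum>j\<in>J. (2 * K\<^sup>2 * b + 2 * c) / (real (card J))\<^sup>2)"
    by (intro sum_mono leave_one_out_error)
  also have "\<dots> = (2 * K\<^sup>2 * b + 2 * c) / real (card J)"
    using fin ne by (simp add: power2_eq_square)
  finally show ?thesis .
qed

text \<open>
  The statistic minus its linearisation is the sum of two parts: the fluctuation caused by the
  evaluation points, bounded in \<open>evaluation_part\<close>, and \<open>residual\<close>, a function of the counted points
  alone, to which the Efron-Stein inequality applies.
\<close>
theorem variance_linearisation_error:
  "Pi.variance (\<lambda>\<xi>. (\<Sum>i\<in>A. h (count_in R J (\<xi> i) \<xi>) (\<xi> i)) / real (card A)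
      - ((\<Sum>i\<in>A. \<psi> (\<xi> i)) / real (card A) + (\<Sum>j\<in>J. \<Phi> (\<xi> j)) / real (card J)))
    \<le> 2 * a / real (card A) + (4 * K\<^sup>2 * b + 4 * c) / real (card J)"
proof -
  have N: "0 < real (card A)" using fin ne by (simp add: card_gt_0_iff)
  define E where "E \<xi> = (\<Sum>i\<in>A. u (\<xi> i) \<xi> - H \<xi>) / real (card A)" for \<xi>
  have eq: "(\<Sum>i\<in>A. h (count_in R J (\<xi> i) \<xi>) (\<xi> i)) / real (card A)
      - ((\<Sum>i\<in>A. \<psi> (\<xi> i)) / real (card A) + (\<Sum>j\<in>J. \<Phi> (\<xi> j)) / real (card J)) = E \<xi> + residual \<xi>" for \<xi>
    using N by (simp add: E_def residual_def u_def sum_subtractf diff_divide_distrib)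
  have E_meas: "E \<in> borel_measurable joint"
    unfolding E_def[abs_def] by (intro borel_measurable_diff borel_measurable_divide borel_measurable_sum) auto
  have EB: "\<bar>E \<xi>\<bar> \<le> 4 * B" if "\<xi> \<in> space joint" for \<xi>
  proof -
    have "\<bar>u (\<xi> i) \<xi> - H \<xi>\<bar> \<le> 4 * B" if "i \<in> A" for i
    proof -
      have "\<xi> i \<in> space D" using that \<open>\<xi> \<in> space joint\<close> by (auto simp: space_PiM)
      from u_bounded[OF this, of \<xi>] H_bounded[of \<xi>] show ?thesis by linarith
    qed
    then have "\<bar>\<Sum>i\<in>A. u (\<xi> i) \<xi> - H \<xi>\<bar> \<le> (\<Sum>i\<in>A. 4 * B)"
      by (intro order_trans[OF sum_abs] sum_mono)
    then show ?thesis using N by (simp add: E_def divide_simps mult.commute)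
  qed
  have rB: "\<bar>residual \<xi>\<bar> \<le> 4 * B" if "\<xi> \<in> space joint" for \<xi>
    using residual_bounded[OF that] B_nonneg by linarith
  have "Pi.variance (\<lambda>\<xi>. E \<xi> + residual \<xi>) \<le> 2 * (\<integral>\<xi>. (E \<xi>)\<^sup>2 \<partial>joint) + 2 * Pi.variance residual"
    by (rule Pi.variance_add_le[OF E_meas residual_measurable EB rB])
  also have "\<dots> \<le> 2 * (a / real (card A)) + 2 * ((2 * K\<^sup>2 * b + 2 * c) / real (card J))"
    using evaluation_part variance_residual unfolding E_def by linarith
  finally show ?thesis unfolding eq by (simp add: field_simps)
qed

end

section \<open>Moments and tails of a neighbour count\<close>

context prob_space
begin

context
  fixes S :: "'a set" and I J :: "'i set"
  assumes S [measurable]: "S \<in> sets M" and I: "finite I" and J: "J \<subseteq> I"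
begin

abbreviation (input) "hits \<xi> \<equiv> real (card {j \<in> J. \<xi> j \<in> S})"

lemma finite_J: "finite J" using I J finite_subset by blast

lemma hits_eq_sum: "hits \<xi> = (\<Sum>j\<in>J. indicator S (\<xi> j))"
proof -
  have "(\<Sum>j\<in>J. indicator S (\<xi> j) :: real) = (\<Sum>j\<in>{j \<in> J. \<xi> j \<in> S}. 1)"
    using finite_J by (intro sum.mono_neutral_cong_right) (auto simp: indicator_def)
  then show ?thesis by simp
qed

lemma hits_measurable [measurable]: "hits \<in> borel_measurable (PiM I (\<lambda>_. M))"
  unfolding hits_eq_sum using J by (intro borel_measurable_sum) auto

lemma hits_le: "hits \<xi> \<le> real (card J)"
  using finite_J by (simp add: card_mono)

lemma prob_space_iid: "prob_space (PiM I (\<lambda>_. M))"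
  by (intro prob_space_PiM prob_space_axioms)

lemma hits_mgf: "(\<integral>\<xi>. exp (s * hits \<xi>) \<partial>PiM I (\<lambda>_. M)) = (1 + prob S * (exp s - 1)) ^ card J"
proof -
  interpret product_sigma_finite "\<lambda>_::'i. M"
    using prob_space_axioms by (simp add: product_sigma_finite_def prob_space_imp_sigma_finite)
  let ?f = "\<lambda>i y. if i \<in> J then 1 + (exp s - 1) * indicator S y else (1::real)"
  have "exp (s * hits \<xi>) = (\<Prod>i\<in>I. ?f i (\<xi> i))" for \<xi>
  proof -
    have "(\<Prod>i\<in>I. ?f i (\<xi> i)) = (\<Prod>i\<in>J. 1 + (exp s - 1) * indicator S (\<xi> i))"
      using I J by (intro prod.mono_neutral_cong_right) auto
    also have "\<dots> = (\<Prod>i\<in>J. exp (s * indicator S (\<xi> i)))"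
      by (intro prod.cong) (auto simp: indicator_def)
    also have "\<dots> = exp (s * hits \<xi>)"
      by (simp add: hits_eq_sum exp_sum[OF finite_J] sum_distrib_left)
    finally show ?thesis by simp
  qed
  then have "(\<integral>\<xi>. exp (s * hits \<xi>) \<partial>PiM I (\<lambda>_. M)) = (\<integral>\<xi>. (\<Prod>i\<in>I. ?f i (\<xi> i)) \<partial>PiM I (\<lambda>_. M))"
    by presburger
  also have "\<dots> = (\<Prod>i\<in>I. \<integral>y. ?f i y \<partial>M)"
  proof (rule product_integral_prod[OF I, of ?f])
    fix i
    show "integrable M (?f i)" by (cases "i \<in> J") (auto simp: emeasure_eq_measure)
  qed
  also have "\<dots> = (\<Prod>i\<in>J. 1 + prob S * (exp s - 1))"
    using I J S
    by (intro prod.mono_neutral_cong_right) (auto simp: prob_space emeasure_eq_measure algebra_simps)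
  finally show ?thesis by simp
qed

lemma hits_mgf_le: "(\<integral>\<xi>. exp (s * hits \<xi>) \<partial>PiM I (\<lambda>_. M)) \<le> exp (real (card J) * (prob S * (exp s - 1)))"
proof -
  have "-1 \<le> prob S * (exp s - 1)"
  proof -
    have "prob S * (exp s - 1) \<ge> prob S * (-1)" by (intro mult_left_mono) auto
    then show ?thesis using prob_le_1[of S] by linarith
  qed
  then show ?thesis
    unfolding hits_mgf exp_of_nat_mult by (intro power_mono exp_ge_add_one_self) auto
qed

text \<open>
  Markov's inequality for \<open>exp (s * hits \<xi>)\<close>. The upper tail is the case \<open>s = 1\<close>, the lower tail the case
  \<open>s = -1\<close>. The exponent is proportional to the expected count, unlike in Hoeffding's inequality, whose
  exponent is too weak when that expectation is of lower order than \<open>card J\<close>, as it is for shrinking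
  cells.
\<close>
lemma hits_tail:
  "measure (PiM I (\<lambda>_. M)) {\<xi> \<in> space (PiM I (\<lambda>_. M)). 0 \<le> s * hits \<xi> - r}
    \<le> exp (real (card J) * (prob S * (exp s - 1)) - r)"
proof -
  interpret P: prob_space "PiM I (\<lambda>_. M)" by (rule prob_space_iid)
  let ?E = "{\<xi> \<in> space (PiM I (\<lambda>_. M)). 0 \<le> s * hits \<xi> - r}"
  have i: "integrable (PiM I (\<lambda>_. M)) (\<lambda>\<xi>. exp (s * hits \<xi>))"
  proof (rule P.integrable_bounded)
    fix \<xi>
    have "s * hits \<xi> \<le> \<bar>s\<bar> * real (card J)"
      using hits_le[of \<xi>] by (intro mult_mono) auto
    then show "\<bar>exp (s * hits \<xi>)\<bar> \<le> exp (\<bar>s\<bar> * real (card J))" by simp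
  qed measurable
  have "P.prob ?E = (\<integral>\<xi>. indicator ?E \<xi> \<partial>PiM I (\<lambda>_. M))" by simp
  also have "\<dots> \<le> (\<integral>\<xi>. exp (s * hits \<xi>) * exp (- r) \<partial>PiM I (\<lambda>_. M))"
  proof (rule integral_mono')
    show "integrable (PiM I (\<lambda>_. M)) (\<lambda>\<xi>. exp (s * hits \<xi>) * exp (- r))"
      using i by (rule integrable_mult_left)
  next
    fix \<xi>
    show "indicator ?E \<xi> \<le> exp (s * hits \<xi>) * exp (- r)"
      unfolding mult_exp_exp by (cases "\<xi> \<in> ?E") auto
  qed auto
  also have "\<dots> \<le> exp (real (card J) * (prob S * (exp s - 1))) * exp (- r)"
    using hits_mgf_le[of s] by simp
  finally show ?thesis by (simp add: exp_add[symmetric])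
qed

lemma hits_expectation: "(\<integral>\<xi>. hits \<xi> \<partial>PiM I (\<lambda>_. M)) = real (card J) * prob S"
proof -
  interpret P: prob_space "PiM I (\<lambda>_. M)" by (rule prob_space_iid)
  have i: "integrable (PiM I (\<lambda>_. M)) (\<lambda>\<xi>. indicator S (\<xi> j) :: real)" if "j \<in> J" for j
    using that J by (intro P.integrable_bounded[where B = 1]) auto
  have "(\<integral>\<xi>. hits \<xi> \<partial>PiM I (\<lambda>_. M)) = (\<Sum>j\<in>J. \<integral>\<xi>. indicator S (\<xi> j) \<partial>PiM I (\<lambda>_. M))"
    unfolding hits_eq_sum using i by (rule Bochner_Integration.integral_sum)
  also have "\<dots> = (\<Sum>j\<in>J. prob S)"
    using J by (intro sum.cong refl) (subst iid_coordinate_expectation[OF I], auto)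
  finally show ?thesis by simp
qed

text \<open>
  An instance of \<open>efron_stein\<close>: leaving out an index changes the count by an indicator.
\<close>
lemma hits_variance:
  "(\<integral>\<xi>. (hits \<xi> - real (card J) * prob S)\<^sup>2 \<partial>PiM I (\<lambda>_. M)) \<le> real (card J) * prob S"
proof -
  interpret P: prob_space "PiM I (\<lambda>_. M)" by (rule prob_space_iid)
  let ?Fi = "\<lambda>i \<xi>. (\<Sum>j\<in>J - {i}. indicator S (\<xi> j)) :: real"
  have bd: "\<bar>\<Sum>j\<in>J'. indicator S (\<xi> j) :: real\<bar> \<le> real (card J)" if "J' \<subseteq> J" for J' \<xi>
  proof -
    have "\<bar>\<Sum>j\<in>J'. indicator S (\<xi> j) :: real\<bar> \<le> (\<Sum>j\<in>J'. 1)"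
      by (intro order_trans[OF sum_abs] sum_mono) auto
    also have "\<dots> \<le> real (card J)" using card_mono[OF finite_J that] by simp
    finally show ?thesis .
  qed
  have diff: "(hits \<xi> - ?Fi i \<xi>)\<^sup>2 = (if i \<in> J then indicator S (\<xi> i) else 0)" for i \<xi>
    using sum.remove[OF finite_J, of i "\<lambda>j. indicator S (\<xi> j) :: real"]
    by (auto simp: hits_eq_sum indicator_def)
  have "(\<integral>\<xi>. (hits \<xi> - (\<integral>\<xi>. hits \<xi> \<partial>PiM I (\<lambda>_. M)))\<^sup>2 \<partial>PiM I (\<lambda>_. M))
      \<le> (\<Sum>i\<in>I. \<integral>\<xi>. (hits \<xi> - ?Fi i \<xi>)\<^sup>2 \<partial>PiM I (\<lambda>_. M))"
  proof (rule efron_stein[OF prob_space_axioms I, where B = "real (card J)"])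
    show "?Fi i \<in> borel_measurable (PiM I (\<lambda>_. M))" for i
      using J by (intro borel_measurable_sum) auto
    show "?Fi i (\<xi>(i := t)) = ?Fi i \<xi>" for i \<xi> t by (intro sum.cong) auto
  qed (use bd hits_le in auto)
  also have "\<dots> = (\<Sum>i\<in>I. if i \<in> J then prob S else 0)"
  proof (intro sum.cong refl)
    fix i assume "i \<in> I"
    then show "(\<integral>\<xi>. (hits \<xi> - ?Fi i \<xi>)\<^sup>2 \<partial>PiM I (\<lambda>_. M)) = (if i \<in> J then prob S else 0)"
      unfolding diff using iid_coordinate_expectation[OF I, of i "indicator S"] by simp
  qed
  also have "\<dots> = real (card J) * prob S"
    using I J by (simp add: sum.If_cases Int_absorb1)
  finally show ?thesis by (simp add: hits_expectation)
qed

text \<open>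
  For counts between \<open>lo\<close> and \<open>hi\<close> the error is controlled by the deviation of the estimate \<open>n / s\<close> from
  \<open>t\<close>, whose second moment is that of a binomial variable. For the other counts only the crude bound
  \<open>B\<close> is at hand, and it is multiplied by the exponentially small tail probabilities.
\<close>
theorem hits_functional_error:
  assumes bd: "\<And>n. n \<le> card J \<Longrightarrow> \<bar>\<phi> n\<bar> \<le> B"
    and good: "\<And>n. n \<le> card J \<Longrightarrow> lo < real n \<Longrightarrow> real n < hi \<Longrightarrow> (\<phi> n)\<^sup>2 \<le> \<kappa> * (real n / s - t)\<^sup>2 + \<eta>"
    and nn: "0 \<le> \<kappa>" "0 \<le> \<eta>" and s: "0 < s"
  shows "(\<integral>\<xi>. (\<phi> (card {j \<in> J. \<xi> j \<in> S}))\<^sup>2 \<partial>PiM I (\<lambda>_. M))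
    \<le> B\<^sup>2 * (exp (lo - real (card J) * prob S * (1 - exp (-1))) + exp (real (card J) * prob S * (exp 1 - 1) - hi))
      + \<kappa> * (real (card J) * prob S / s\<^sup>2 + (real (card J) * prob S / s - t)\<^sup>2) + \<eta>"
proof -
  let ?P = "PiM I (\<lambda>_. M)"
  interpret P: prob_space ?P by (rule prob_space_iid)
  let ?n = "\<lambda>\<xi>. card {j \<in> J. \<xi> j \<in> S}"
  let ?m = "real (card J) * prob S"
  let ?L = "{\<xi> \<in> space ?P. 0 \<le> (-1) * hits \<xi> - (- lo)}" and ?U = "{\<xi> \<in> space ?P. 0 \<le> 1 * hits \<xi> - hi}"
  have LU [measurable]: "?L \<in> sets ?P" "?U \<in> sets ?P" by measurable
  have n_le: "?n \<xi> \<le> card J" for \<xi> using finite_J by (intro card_mono) auto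
  have i1: "integrable ?P (\<lambda>\<xi>. (hits \<xi> - ?m)\<^sup>2)"
  proof (rule P.integrable_square_bounded[where B = "real (card J) + ?m"])
    fix \<xi> show "\<bar>hits \<xi> - ?m\<bar> \<le> real (card J) + ?m"
      using hits_le[of \<xi>] mult_nonneg_nonneg[of "real (card J)" "prob S"] of_nat_0_le_iff[of "?n \<xi>"]
        measure_nonneg[of M S] by (intro abs_leI; linarith)
  qed measurable
  have i0: "integrable ?P hits" using hits_le by (intro P.integrable_bounded[where B = "real (card J)"]) auto
  have quad: "(real n / s - t)\<^sup>2 = (real n - ?m)\<^sup>2 / s\<^sup>2 + 2 * ((?m / s - t) / s) * (real n - ?m) + (?m / s - t)\<^sup>2" for n
    using s by (simp add: power2_eq_square field_simps)
  have i2: "integrable ?P (\<lambda>\<xi>. (hits \<xi> / s - t)\<^sup>2)"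
    unfolding quad using i0 i1 by auto
  have E2: "(\<integral>\<xi>. (hits \<xi> / s - t)\<^sup>2 \<partial>?P) \<le> ?m / s\<^sup>2 + (?m / s - t)\<^sup>2"
  proof -
    have "(\<integral>\<xi>. (hits \<xi> / s - t)\<^sup>2 \<partial>?P) = (\<integral>\<xi>. (hits \<xi> - ?m)\<^sup>2 \<partial>?P) / s\<^sup>2 + (?m / s - t)\<^sup>2"
      unfolding quad using i0 i1 by (simp add: hits_expectation P.prob_space)
    then show ?thesis using hits_variance by (simp add: divide_right_mono)
  qed
  have "(\<integral>\<xi>. (\<phi> (?n \<xi>))\<^sup>2 \<partial>?P)
      \<le> (\<integral>\<xi>. B\<^sup>2 * indicator ?L \<xi> + B\<^sup>2 * indicator ?U \<xi> + (\<kappa> * (hits \<xi> / s - t)\<^sup>2 + \<eta>) \<partial>?P)"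
  proof (rule integral_mono')
    fix \<xi> assume x: "\<xi> \<in> space ?P"
    show "(\<phi> (?n \<xi>))\<^sup>2 \<le> B\<^sup>2 * indicator ?L \<xi> + B\<^sup>2 * indicator ?U \<xi> + (\<kappa> * (hits \<xi> / s - t)\<^sup>2 + \<eta>)"
    proof (cases "lo < hits \<xi> \<and> hits \<xi> < hi")
      case True
      then show ?thesis using good[OF n_le] by (intro order_trans[OF good[OF n_le]]) auto
    next
      case False
      have "(\<phi> (?n \<xi>))\<^sup>2 \<le> B\<^sup>2"
        unfolding abs_le_square_iff[symmetric] using bd[OF n_le[of \<xi>]] by linarith
      moreover have "B\<^sup>2 \<le> B\<^sup>2 * indicator ?L \<xi> + B\<^sup>2 * indicator ?U \<xi>"
      proof -
        have "\<xi> \<in> ?L \<or> \<xi> \<in> ?U" using False x by auto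
        then show ?thesis by (auto simp: indicator_def simp del: mem_Collect_eq)
      qed
      moreover have "0 \<le> \<kappa> * (hits \<xi> / s - t)\<^sup>2 + \<eta>" using nn by auto
      ultimately show ?thesis by linarith
    qed
  next
    show "integrable ?P (\<lambda>\<xi>. B\<^sup>2 * indicator ?L \<xi> + B\<^sup>2 * indicator ?U \<xi> + (\<kappa> * (hits \<xi> / s - t)\<^sup>2 + \<eta>))"
      using i2 by (intro Bochner_Integration.integrable_add integrable_mult_right integrable_real_indicator)
        (auto simp: P.emeasure_eq_measure)
  qed (use nn in auto)
  also have "\<dots> = B\<^sup>2 * P.prob ?L + B\<^sup>2 * P.prob ?U + (\<kappa> * (\<integral>\<xi>. (hits \<xi> / s - t)\<^sup>2 \<partial>?P) + \<eta>)"
  proof -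
    have "integrable ?P (indicator ?L :: _ \<Rightarrow> real)" "integrable ?P (indicator ?U :: _ \<Rightarrow> real)"
      by (auto intro!: integrable_real_indicator simp: P.emeasure_eq_measure)
    then show ?thesis using i2 by (simp add: P.prob_space)
  qed
  also have "\<dots> \<le> B\<^sup>2 * exp (?m * (exp (-1) - 1) + lo) + B\<^sup>2 * exp (?m * (exp 1 - 1) - hi)
      + (\<kappa> * (?m / s\<^sup>2 + (?m / s - t)\<^sup>2) + \<eta>)"
    using hits_tail[of "-1" "- lo"] hits_tail[of 1 hi]
    by (intro add_mono mult_left_mono E2 nn order_refl) (auto simp: mult.assoc)
  finally show ?thesis by (simp add: algebra_simps)
qed

end
end

section \<open>Averages over shrinking cubes\<close>

definition cube_lborel :: "real \<Rightarrow> real \<Rightarrow> (real ^ 'n) measure" where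
  "cube_lborel a b = density lborel (indicator (cube a b))"

lemma sets_cube_lborel [simp, measurable_cong]: "sets (cube_lborel a b) = sets borel"
  and space_cube_lborel [simp]: "space (cube_lborel a b) = UNIV"
  by (auto simp: cube_lborel_def)

lemma mem_cube: "x \<in> cube a b \<longleftrightarrow> (\<forall>i. a \<le> x $ i \<and> x $ i \<le> b)"
  by (simp add: cube_def mem_box_cart)

lemma cube_mono: "a \<le> a' \<Longrightarrow> b' \<le> b \<Longrightarrow> cube a' b' \<subseteq> cube a b"
  unfolding subset_iff mem_cube by (meson order_trans)

lemma cube_borel [measurable]: "cube a b \<in> sets borel"
  by (simp add: cube_def)

lemma measure_cube:
  "measure lborel (cube a b :: (real ^ 'n) set) = (if a \<le> b then (b - a) ^ CARD('n) else 0)"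
proof (cases "a \<le> b")
  case True
  then have "(cube a b :: (real ^ 'n) set) \<noteq> {}" by (auto simp: cube_def interval_ne_empty_cart)
  then show ?thesis using True content_cbox_cart[of "\<chi> i. a" "\<chi> i::'n. b"] by (simp add: cube_def)
next
  case False
  then have "cube a b = ({} :: (real ^ 'n) set)" by (auto simp: cube_def interval_eq_empty_cart)
  then show ?thesis using False by simp
qed

lemma emeasure_cube_finite: "emeasure lborel (cube a b) < \<infinity>"
  unfolding cube_def by (rule emeasure_lborel_cbox_finite)

lemma finite_measure_cube_lborel: "finite_measure (cube_lborel a b)"
  by (rule finite_measureI)
     (simp add: cube_lborel_def emeasure_density emeasure_cube_finite[THEN less_imp_neq, simplified])

lemma integral_cube_lborel:
  fixes F :: "real ^ 'n \<Rightarrow> real"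
  assumes "F \<in> borel_measurable borel"
  shows "(\<integral>x. F x \<partial>cube_lborel a b) = (\<integral>x. indicator (cube a b) x * F x \<partial>lborel)"
proof -
  have "(cube_lborel a b :: (real ^ 'n) measure) = density lborel (\<lambda>x. ennreal (indicator (cube a b) x))"
    by (simp add: cube_lborel_def ennreal_indicator)
  then show ?thesis using assms by (simp add: integral_density)
qed

lemma measure_cube_lborel: "A \<in> sets borel \<Longrightarrow> measure (cube_lborel a b) A = measure lborel (A \<inter> cube a b)"
  by (simp add: cube_lborel_def measure_def emeasure_density Int_commute flip: indicator_inter_arith)

lemma AE_cube_lborel: "AE x in cube_lborel a b. x \<in> cube a b"
  unfolding cube_lborel_def by (subst AE_density) (auto simp: indicator_def)

lemma infnorm_le_iff: "infnorm (x :: real ^ 'n) \<le> r \<longleftrightarrow> (\<forall>i. \<bar>x $ i\<bar> \<le> r)"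
proof -
  have "infnorm x = Max ((\<lambda>i. \<bar>x $ i\<bar>) ` UNIV)"
  proof -
    have "(\<lambda>i. \<bar>x \<bullet> i\<bar>) ` Basis = (\<lambda>i. \<bar>x $ i\<bar>) ` UNIV"
      unfolding Basis_vec_def by (auto simp: inner_axis image_iff intro!: exI[of _ "axis _ 1"])
    then show ?thesis by (simp add: infnorm_Max)
  qed
  then show ?thesis by simp
qed

lemma infnorm_measurable [measurable]: "infnorm \<in> borel_measurable borel"
  by (intro borel_measurable_continuous_onI continuous_on_infnorm continuous_on_id)

lemma infnorm_ball_eq: "{y. infnorm (x - y) \<le> r} = cbox (\<chi> i. x $ i - r) (\<chi> i. x $ i + r)"
  by (auto simp: infnorm_le_iff mem_box_cart abs_le_iff algebra_simps)

lemma measure_infnorm_ball: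
  fixes x :: "real ^ 'n"
  assumes "0 \<le> r"
  shows "measure lborel {y. infnorm (x - y) \<le> r} = (2 * r) ^ CARD('n)"
  unfolding infnorm_ball_eq using assms
  by (subst content_cbox_cart) (auto simp: interval_ne_empty_cart)

lemma emeasure_infnorm_ball:
  fixes x :: "real ^ 'n"
  shows "emeasure lborel {y. infnorm (x - y) \<le> r} < \<infinity>"
  unfolding infnorm_ball_eq by (rule emeasure_lborel_cbox_finite)

text \<open>
  A measurable function is an almost everywhere limit of continuous functions. Clamping these to
  \<open>[-W, W]\<close> does not change the limit and makes dominated convergence applicable.
\<close>
lemma continuous_approx_L1:
  fixes w :: "real ^ 'n \<Rightarrow> real"
  assumes w [measurable]: "w \<in> borel_measurable borel" and W: "\<And>x. \<bar>w x\<bar> \<le> W" and "0 < e"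
  obtains u where "continuous_on UNIV u" "\<And>x. \<bar>u x\<bar> \<le> W" "(\<integral>x. \<bar>w x - u x\<bar> \<partial>cube_lborel a b) < e"
proof -
  interpret finite_measure "cube_lborel a b :: (real ^ 'n) measure" by (rule finite_measure_cube_lborel)
  have "w measurable_on UNIV"
    by (rule lebesgue_measurable_imp_measurable_on) (auto intro: measurable_completion)
  then obtain N g where N: "negligible N" and g: "\<And>n. continuous_on UNIV (g n)"
    and lim: "\<And>x. x \<notin> N \<Longrightarrow> (\<lambda>n. g n x) \<longlonglongrightarrow> w x"
    unfolding measurable_on_def by auto
  have W0: "0 \<le> W" using W[of 0] by linarith
  define u where "u n x = max (- W) (min W (g n x))" for n x
  have u: "continuous_on UNIV (u n)" "\<bar>u n x\<bar> \<le> W" for n x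
    using W0 unfolding u_def by (auto intro!: continuous_intros g)
  have [measurable]: "u n \<in> borel_measurable borel" for n
    by (rule borel_measurable_continuous_onI[OF u(1)])
  have "AE x in lebesgue. x \<notin> N"
    using N by (intro AE_not_in) (simp add: negligible_iff_null_sets)
  then have "AE x in lborel. x \<notin> N" by (simp add: AE_completion_iff)
  then have AE: "AE x in cube_lborel a b. x \<notin> N"
    unfolding cube_lborel_def by (subst AE_density) auto
  have "(\<lambda>n. \<integral>x. \<bar>w x - u n x\<bar> \<partial>cube_lborel a b) \<longlonglongrightarrow> integral\<^sup>L (cube_lborel a b :: (real ^ 'n) measure) (\<lambda>_. 0)"
  proof (rule integral_dominated_convergence[where w = "\<lambda>_. 2 * W"])
    show "AE x in cube_lborel a b. (\<lambda>n. \<bar>w x - u n x\<bar>) \<longlonglongrightarrow> 0"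
      using AE
    proof eventually_elim
      fix x assume "x \<notin> N"
      have "(\<lambda>n. u n x) \<longlonglongrightarrow> max (- W) (min W (w x))"
        unfolding u_def by (intro tendsto_intros lim \<open>x \<notin> N\<close>)
      also have "max (- W) (min W (w x)) = w x" using W[of x] by linarith
      finally have "(\<lambda>n. \<bar>w x - u n x\<bar>) \<longlonglongrightarrow> \<bar>w x - w x\<bar>" by (intro tendsto_intros)
      then show "(\<lambda>n. \<bar>w x - u n x\<bar>) \<longlonglongrightarrow> 0" by simp
    qed
    show "AE x in cube_lborel a b. norm \<bar>w x - u n x\<bar> \<le> 2 * W" for n
    proof (rule AE_I2)
      fix x show "norm \<bar>w x - u n x\<bar> \<le> 2 * W" using W[of x] u(2)[of n x] by simp
    qed
  qed auto
  then have "\<forall>\<^sub>F n in sequentially. (\<integral>x. \<bar>w x - u n x\<bar> \<partial>cube_lborel a b) < e"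
    using \<open>0 < e\<close> by (intro order_tendstoD(2)) auto
  then obtain n where "(\<integral>x. \<bar>w x - u n x\<bar> \<partial>cube_lborel a b) < e"
    by (auto simp: eventually_sequentially)
  then show ?thesis using that u by blast
qed

lemma (in finite_measure) integrable_bounded':
  fixes F :: "'a \<Rightarrow> real"
  assumes "F \<in> borel_measurable M" and "\<And>x. \<bar>F x\<bar> \<le> B"
  shows "integrable M F"
  using assms by (intro integrable_const_bound[of _ B]) auto

definition near :: "real \<Rightarrow> real ^ 'n \<Rightarrow> real ^ 'n \<Rightarrow> real" where
  "near r x y = (if infnorm (x - y) \<le> r then 1 else 0)"

lemma near_measurable [measurable]:
  assumes [measurable]: "f \<in> borel_measurable N" "g \<in> borel_measurable N"
  shows "(\<lambda>z. near r (f z) (g z)) \<in> borel_measurable N"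
  unfolding near_def by measurable

lemma near_sym: "near r x y = near r y x"
  by (simp add: near_def infnorm_sub)

lemma near_nonneg [simp]: "0 \<le> near r x y" and near_le [simp]: "near r x y \<le> 1"
  by (auto simp: near_def)

lemma integral_near_lborel:
  fixes x :: "real ^ 'n"
  assumes "0 \<le> r"
  shows "(\<integral>y. near r x y \<partial>lborel) = (2 * r) ^ CARD('n)"
    and "integrable lborel (near r x)"
proof -
  have eq: "near r x = indicator {y. infnorm (x - y) \<le> r}" by (auto simp: near_def indicator_def fun_eq_iff)
  show "(\<integral>y. near r x y \<partial>lborel) = (2 * r) ^ CARD('n)" "integrable lborel (near r x)"
    unfolding eq using measure_infnorm_ball[OF assms, of x] emeasure_infnorm_ball[of x r] by auto
qed

lemma integral_near_le:
  fixes x :: "real ^ 'n"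
  assumes "0 \<le> r"
  shows "(\<integral>y. near r x y \<partial>cube_lborel a b) \<le> (2 * r) ^ CARD('n)"
  unfolding integral_near_lborel(1)[OF assms, of x, symmetric]
  by (subst integral_cube_lborel) (auto intro!: integral_mono' integral_near_lborel(2)[OF assms] simp: indicator_def)

lemma double_integral_near_le:
  fixes F :: "real ^ 'n \<Rightarrow> real"
  assumes [measurable]: "F \<in> borel_measurable borel" and F: "\<And>x. 0 \<le> F x" "\<And>x. F x \<le> W" and r: "0 \<le> r"
  shows "(\<integral>y. (\<integral>x. near r y x * F y \<partial>cube_lborel a b) \<partial>cube_lborel a b)
      \<le> (2 * r) ^ CARD('n) * (\<integral>y. F y \<partial>cube_lborel a b)"
    and "(\<integral>y. (\<integral>x. near r y x * F x \<partial>cube_lborel a b) \<partial>cube_lborel a b)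
      \<le> (2 * r) ^ CARD('n) * (\<integral>y. F y \<partial>cube_lborel a b)"
proof -
  let ?m = "cube_lborel a b :: (real ^ 'n) measure"
  interpret finite_measure ?m by (rule finite_measure_cube_lborel)
  interpret P: pair_sigma_finite ?m ?m ..
  interpret PF: finite_measure "?m \<Otimes>\<^sub>M ?m" by (rule finite_measure_pair_measure) unfold_locales
  have W: "0 \<le> W" using F order_trans by blast
  have nF: "\<bar>near r y x * F z\<bar> \<le> W" for x y z
    using F[of z] W by (auto simp: near_def)
  show 1: "(\<integral>y. (\<integral>x. near r y x * F y \<partial>?m) \<partial>?m) \<le> (2 * r) ^ CARD('n) * (\<integral>y. F y \<partial>?m)"
  proof -
    have "(\<integral>y. (\<integral>x. near r y x * F y \<partial>?m) \<partial>?m) = (\<integral>y. (\<integral>x. near r y x \<partial>?m) * F y \<partial>?m)" by simp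
    also have "\<dots> \<le> (\<integral>y. (2 * r) ^ CARD('n) * F y \<partial>?m)"
      using F r by (intro integral_mono' mult_right_mono integral_near_le integrable_mult_right
        integrable_bounded'[of F W]) auto
    finally show ?thesis by simp
  qed
  have "(\<integral>y. (\<integral>x. near r y x * F x \<partial>?m) \<partial>?m) = (\<integral>x. (\<integral>y. near r y x * F x \<partial>?m) \<partial>?m)"
    by (rule P.Fubini_integral) (unfold split_beta', rule PF.integrable_bounded'[of _ W], measurable, rule nF)
  also have "\<dots> \<le> (2 * r) ^ CARD('n) * (\<integral>y. F y \<partial>?m)"
    using 1 by (simp add: near_sym)
  finally show "(\<integral>y. (\<integral>x. near r y x * F x \<partial>?m) \<partial>?m) \<le> (2 * r) ^ CARD('n) * (\<integral>y. F y \<partial>?m)" .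
qed

text \<open>
  For a continuous function this is uniform continuity on the compact cube. In general \<open>w\<close> is
  replaced by a continuous \<open>u\<close> that is close in \<open>L\<^sup>1\<close>; since a ball of radius \<open>r\<close> has volume \<open>(2 * r) ^ d\<close>, each of
  the two replacements costs at most \<open>2 ^ d\<close> times the \<open>L\<^sup>1\<close> distance, uniformly in \<open>r\<close>.
\<close>
lemma oscillation_tendsto_0:
  fixes w :: "real ^ 'n \<Rightarrow> real" and r :: "nat \<Rightarrow> real"
  assumes w [measurable]: "w \<in> borel_measurable borel" and W: "\<And>x. \<bar>w x\<bar> \<le> W"
    and r: "\<forall>\<^sub>F n in sequentially. 0 < r n" and r0: "r \<longlonglongrightarrow> 0"
  shows "(\<lambda>n. (\<integral>y. (\<integral>x. near (r n) y x * \<bar>w x - w y\<bar> \<partial>cube_lborel a b) \<partial>cube_lborel a b) / r n ^ CARD('n)) \<longlonglongrightarrow> 0"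
proof (rule tendstoI)
  fix e :: real assume e: "0 < e"
  let ?m = "cube_lborel a b :: (real ^ 'n) measure"
  interpret finite_measure ?m by (rule finite_measure_cube_lborel)
  interpret P: pair_sigma_finite ?m ?m ..
  interpret PF: finite_measure "?m \<Otimes>\<^sub>M ?m" by (rule finite_measure_pair_measure) unfold_locales
  define d where "d = CARD('n)"
  define \<mu> where "\<mu> = measure ?m UNIV"
  define \<eta> where "\<eta> = e / (2 ^ d * (3 + \<mu>))"
  have \<mu>: "0 \<le> \<mu>" by (simp add: \<mu>_def)
  then have \<eta>: "0 < \<eta>" using e by (simp add: \<eta>_def add_pos_nonneg)
  have W0: "0 \<le> W" using W[of 0] by linarith
  obtain u where u: "continuous_on UNIV u" "\<And>x. \<bar>u x\<bar> \<le> W" "(\<integral>x. \<bar>w x - u x\<bar> \<partial>?m) < \<eta>"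
    using continuous_approx_L1[OF w W \<eta>] by blast
  have [measurable]: "u \<in> borel_measurable borel" by (rule borel_measurable_continuous_onI[OF u(1)])
  have "uniformly_continuous_on (cube a b) u"
    by (intro compact_uniformly_continuous continuous_on_subset[OF u(1)]) (auto simp: cube_def)
  then obtain \<delta> where \<delta>: "0 < \<delta>"
    "\<And>x y. x \<in> cube a b \<Longrightarrow> y \<in> cube a b \<Longrightarrow> dist y x < \<delta> \<Longrightarrow> dist (u y) (u x) < \<eta>"
    unfolding uniformly_continuous_on_def using \<eta> by metis
  define c where "c = sqrt (real d)"
  have c: "0 < c" by (simp add: c_def d_def)
  have "\<forall>\<^sub>F n in sequentially. r n < \<delta> / c"
    using \<delta>(1) c by (intro order_tendstoD(2)[OF r0]) auto
  with r show "\<forall>\<^sub>F n in sequentially.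
      dist ((\<integral>y. (\<integral>x. near (r n) y x * \<bar>w x - w y\<bar> \<partial>?m) \<partial>?m) / r n ^ CARD('n)) 0 < e"
  proof eventually_elim
    fix n assume rn: "0 < r n" "r n < \<delta> / c"
    let ?v = "\<lambda>x. \<bar>w x - u x\<bar>"
    have vB: "?v x \<le> 2 * W" for x using W[of x] u(2)[of x] by linarith
    have pt: "near (r n) y x * \<bar>w x - w y\<bar> \<le> near (r n) y x * ?v x + near (r n) y x * ?v y + near (r n) y x * \<eta>"
      if "x \<in> cube a b" "y \<in> cube a b" for x y
    proof (cases "infnorm (y - x) \<le> r n")
      case True
      have "dist y x \<le> c * infnorm (y - x)"
        using norm_le_infnorm[of "y - x"] by (simp add: dist_norm c_def d_def)
      also have "\<dots> \<le> c * r n" using True c by (intro mult_left_mono) auto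
      also have "\<dots> < \<delta>" using rn c by (simp add: field_simps)
      finally have "\<bar>u y - u x\<bar> < \<eta>" using \<delta>(2)[OF that] by (simp add: dist_real_def)
      then show ?thesis using True by (simp add: near_def)
    qed (simp add: near_def)
    let ?G = "\<lambda>y x. near (r n) y x * ?v x + near (r n) y x * ?v y + near (r n) y x * \<eta>"
    have near_B: "\<bar>near (r n) y x * z\<bar> \<le> B" if "\<bar>z\<bar> \<le> B" for x y z B
      using that by (auto simp: near_def)
    have int1: "integrable ?m (\<lambda>x. near (r n) y x * ?v x)" "integrable ?m (\<lambda>x. near (r n) y x * ?v y)"
        "integrable ?m (\<lambda>x. near (r n) y x * \<eta>)" "integrable ?m (\<lambda>x. near (r n) y x * \<bar>w x - w y\<bar>)" for y
    proof -
      have v: "\<bar>?v x\<bar> \<le> 2 * W" and ww: "\<bar>\<bar>w x - w y\<bar>\<bar> \<le> 2 * W" for x y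
        using vB[of x] W[of x] W[of y] by auto
      show "integrable ?m (\<lambda>x. near (r n) y x * ?v x)"
        by (rule integrable_bounded'[OF _ near_B[OF v]]) measurable
      show "integrable ?m (\<lambda>x. near (r n) y x * ?v y)"
        by (rule integrable_bounded'[OF _ near_B[OF v]]) measurable
      show "integrable ?m (\<lambda>x. near (r n) y x * \<eta>)"
        by (rule integrable_bounded'[OF _ near_B[OF order_refl]]) measurable
      show "integrable ?m (\<lambda>x. near (r n) y x * \<bar>w x - w y\<bar>)"
        by (rule integrable_bounded'[OF _ near_B[OF ww]]) measurable
    qed
    have int2: "integrable ?m (\<lambda>y. \<integral>x. near (r n) y x * ?v x \<partial>?m)"
      "integrable ?m (\<lambda>y. \<integral>x. near (r n) y x * ?v y \<partial>?m)"
      "integrable ?m (\<lambda>y. \<integral>x. near (r n) y x * \<eta> \<partial>?m)"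
    proof -
      have "integrable (?m \<Otimes>\<^sub>M ?m) (\<lambda>(y, x). near (r n) y x * ?v x)"
        unfolding split_beta' by (rule PF.integrable_bounded'[of _ "2 * W"], measurable) (rule near_B, use vB in auto)
      from P.integrable_fst[OF this] show "integrable ?m (\<lambda>y. \<integral>x. near (r n) y x * ?v x \<partial>?m)" .
      have "integrable (?m \<Otimes>\<^sub>M ?m) (\<lambda>(y, x). near (r n) y x * ?v y)"
        unfolding split_beta' by (rule PF.integrable_bounded'[of _ "2 * W"], measurable) (rule near_B, use vB in auto)
      from P.integrable_fst[OF this] show "integrable ?m (\<lambda>y. \<integral>x. near (r n) y x * ?v y \<partial>?m)" .
      have "integrable (?m \<Otimes>\<^sub>M ?m) (\<lambda>(y, x). near (r n) y x * \<eta>)"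
        unfolding split_beta' by (rule PF.integrable_bounded'[of _ \<eta>], measurable) (rule near_B, use \<eta> in auto)
      from P.integrable_fst[OF this] show "integrable ?m (\<lambda>y. \<integral>x. near (r n) y x * \<eta> \<partial>?m)" .
    qed
    have splitG: "(\<integral>x. ?G y x \<partial>?m) = (\<integral>x. near (r n) y x * ?v x \<partial>?m) + (\<integral>x. near (r n) y x * ?v y \<partial>?m)
        + (\<integral>x. near (r n) y x * \<eta> \<partial>?m)" for y
      using int1[of y] by simp
    have "(\<integral>y. (\<integral>x. near (r n) y x * \<bar>w x - w y\<bar> \<partial>?m) \<partial>?m) \<le> (\<integral>y. (\<integral>x. ?G y x \<partial>?m) \<partial>?m)"
    proof (rule integral_mono_AE')
      show "integrable ?m (\<lambda>y. \<integral>x. ?G y x \<partial>?m)" unfolding splitG using int2 by auto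
      show "AE y in ?m. (\<integral>x. near (r n) y x * \<bar>w x - w y\<bar> \<partial>?m) \<le> (\<integral>x. ?G y x \<partial>?m)"
        using AE_cube_lborel
      proof eventually_elim
        fix y :: "real ^ 'n" assume "y \<in> cube a b"
        have "AE x in ?m. near (r n) y x * \<bar>w x - w y\<bar> \<le> ?G y x"
          using AE_cube_lborel by eventually_elim (rule pt[OF _ \<open>y \<in> cube a b\<close>])
        then show "(\<integral>x. near (r n) y x * \<bar>w x - w y\<bar> \<partial>?m) \<le> (\<integral>x. ?G y x \<partial>?m)"
          by (intro integral_mono_AE Bochner_Integration.integrable_add int1)
      qed
      show "AE y in ?m. 0 \<le> (\<integral>x. ?G y x \<partial>?m)"
        using \<eta> by (intro AE_I2 Bochner_Integration.integral_nonneg_AE) auto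
    qed
    also have "\<dots> = (\<integral>y. (\<integral>x. near (r n) y x * ?v x \<partial>?m) \<partial>?m) + (\<integral>y. (\<integral>x. near (r n) y x * ?v y \<partial>?m) \<partial>?m)
        + (\<integral>y. (\<integral>x. near (r n) y x * \<eta> \<partial>?m) \<partial>?m)"
      unfolding splitG using int2 by simp
    also have "\<dots> \<le> (2 * r n) ^ d * (\<integral>y. ?v y \<partial>?m) + (2 * r n) ^ d * (\<integral>y. ?v y \<partial>?m)
        + (2 * r n) ^ d * (\<integral>y. \<eta> \<partial>?m)"
      unfolding d_def using rn \<eta> vB by (intro add_mono double_integral_near_le[where W = "2 * W"]
        double_integral_near_le(2)[where W = \<eta>]) auto
    also have "\<dots> = (2 * r n) ^ d * (2 * (\<integral>y. ?v y \<partial>?m) + \<mu> * \<eta>)"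
      by (simp add: \<mu>_def algebra_simps)
    also have "\<dots> \<le> (2 * r n) ^ d * (2 * \<eta> + \<mu> * \<eta>)"
      using u(3) rn by (intro mult_left_mono add_right_mono) auto
    also have "\<dots> < (2 * r n) ^ d * (\<eta> * (3 + \<mu>))"
      using rn \<eta> by (intro mult_strict_left_mono) (auto simp: algebra_simps)
    also have "\<dots> = e * r n ^ d"
      using \<mu> by (simp add: \<eta>_def power_mult_distrib)
    finally have "(\<integral>y. (\<integral>x. near (r n) y x * \<bar>w x - w y\<bar> \<partial>?m) \<partial>?m) < e * r n ^ d" .
    moreover have "0 \<le> (\<integral>y. (\<integral>x. near (r n) y x * \<bar>w x - w y\<bar> \<partial>?m) \<partial>?m)"
      by (intro Bochner_Integration.integral_nonneg_AE AE_I2) auto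
    ultimately show "dist ((\<integral>y. (\<integral>x. near (r n) y x * \<bar>w x - w y\<bar> \<partial>?m) \<partial>?m) / r n ^ CARD('n)) 0 < e"
      using rn by (simp add: dist_real_def d_def divide_less_eq)
  qed
qed

text \<open>
  Subtracting \<open>w y\<close> inside the integral leaves the oscillation of \<open>w\<close> and the defect of the mass of the
  kernel. The defect is at most \<open>2 ^ d + 1\<close>, and it vanishes except in a boundary layer of width
  \<open>2 * r\<close>, whose volume is the last factor.
\<close>
lemma approximate_identity_bound:
  fixes w :: "real ^ 'n \<Rightarrow> real" and k :: "real ^ 'n \<Rightarrow> real ^ 'n \<Rightarrow> real"
  assumes w [measurable]: "w \<in> borel_measurable borel" and W: "\<And>x. \<bar>w x\<bar> \<le> W"
    and r: "0 < r" "4 * r \<le> b - a"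
    and k [measurable]: "(\<lambda>(y, x). k y x) \<in> borel_measurable (borel \<Otimes>\<^sub>M borel)"
    and k0: "\<And>y x. 0 \<le> k y x" and kr: "\<And>y x. k y x \<le> near r y x / r ^ CARD('n)"
    and k1: "\<And>y. y \<in> cube (a + 2 * r) (b - 2 * r) \<Longrightarrow> (\<integral>x. k y x \<partial>cube_lborel a b) = 1"
  shows "(\<integral>y. \<bar>(\<integral>x. k y x * w x \<partial>cube_lborel a b) - w y\<bar> \<partial>cube_lborel a b)
    \<le> (\<integral>y. (\<integral>x. near r y x * \<bar>w x - w y\<bar> \<partial>cube_lborel a b) \<partial>cube_lborel a b) / r ^ CARD('n)
      + W * (2 ^ CARD('n) + 1) * ((b - a) ^ CARD('n) - (b - a - 4 * r) ^ CARD('n))"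
proof -
  let ?m = "cube_lborel a b :: (real ^ 'n) measure"
  interpret finite_measure ?m by (rule finite_measure_cube_lborel)
  interpret P: pair_sigma_finite ?m ?m ..
  interpret PF: finite_measure "?m \<Otimes>\<^sub>M ?m" by (rule finite_measure_pair_measure) unfold_locales
  define d where "d = CARD('n)"
  let ?inner = "cube (a + 2 * r) (b - 2 * r) :: (real ^ 'n) set"
  have W0: "0 \<le> W" using W[of 0] by linarith
  have [measurable]: "k y \<in> borel_measurable borel" for y
    using measurable_Pair2[OF k, of y] by simp
  have rd: "0 < r ^ d" using r by simp
  have kB: "k y x \<le> 1 / r ^ d" for y x
    using kr[of y x] near_le[of r y x] rd unfolding d_def[symmetric]
    by (meson divide_right_mono less_imp_le order_trans)
  have kf: "\<bar>k y x * z\<bar> \<le> B / r ^ d" if "\<bar>z\<bar> \<le> B" for y x z B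
  proof -
    have "\<bar>k y x * z\<bar> \<le> (1 / r ^ d) * B"
      unfolding abs_mult using that k0 kB rd by (intro mult_mono) auto
    then show ?thesis by simp
  qed
  have ww: "\<bar>\<bar>w x - w y\<bar>\<bar> \<le> 2 * W" for x y using W[of x] W[of y] by auto
  have ik: "integrable ?m (k y)" for y
    using k0 kB by (intro integrable_bounded'[of _ "1 / r ^ d"]) auto
  have ikw: "integrable ?m (\<lambda>x. k y x * w x)" "integrable ?m (\<lambda>x. k y x * \<bar>w x - w y\<bar>)" for y
    by (rule integrable_bounded'[OF _ kf[OF W]] integrable_bounded'[OF _ kf[OF ww]]; measurable)+
  have near_W: "\<bar>near r y x * \<bar>w x - w y\<bar>\<bar> \<le> 2 * W" for x y
    using ww[of x y] W0 by (auto simp: near_def)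
  have inw: "integrable ?m (\<lambda>x. near r y x * \<bar>w x - w y\<bar>)" for y
    by (rule integrable_bounded'[OF _ near_W]) measurable
  have "integrable (?m \<Otimes>\<^sub>M ?m) (\<lambda>(y, x). near r y x * \<bar>w x - w y\<bar>)"
    unfolding split_beta' by (rule PF.integrable_bounded'[of _ "2 * W"], measurable) (rule near_W)
  from P.integrable_fst[OF this]
  have io: "integrable ?m (\<lambda>y. (\<integral>x. near r y x * \<bar>w x - w y\<bar> \<partial>?m) / r ^ d)" by simp
  have mass: "\<bar>(\<integral>x. k y x \<partial>?m) - 1\<bar> \<le> (2 ^ d + 1) * indicator (- ?inner) y" for y
  proof (cases "y \<in> ?inner")
    case False
    have "(\<integral>x. k y x \<partial>?m) \<le> (\<integral>x. near r y x / r ^ d \<partial>?m)"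
      using kr[of y] near_le[of r y] unfolding d_def[symmetric]
      by (intro integral_mono ik integrable_bounded'[of _ "1 / r ^ d"])
         (use rd in \<open>auto simp: divide_right_mono\<close>)
    also have "\<dots> = (\<integral>x. near r y x \<partial>?m) / r ^ d" by simp
    also have "\<dots> \<le> (2 * r) ^ d / r ^ d"
      using integral_near_le[of r a b y] rd r by (intro divide_right_mono) (auto simp: d_def)
    also have "\<dots> = 2 ^ d" using r by (simp add: power_mult_distrib)
    finally have "(\<integral>x. k y x \<partial>?m) \<le> 2 ^ d" .
    moreover have "0 \<le> (\<integral>x. k y x \<partial>?m)" using k0 by (intro Bochner_Integration.integral_nonneg_AE AE_I2) auto
    ultimately show ?thesis using False by (simp add: abs_le_iff add_nonneg_nonneg)
  qed (simp add: k1)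
  have pt: "\<bar>(\<integral>x. k y x * w x \<partial>?m) - w y\<bar>
      \<le> (\<integral>x. near r y x * \<bar>w x - w y\<bar> \<partial>?m) / r ^ d + W * (2 ^ d + 1) * indicator (- ?inner) y" for y
  proof -
    have "(\<integral>x. k y x * w x \<partial>?m) - w y = (\<integral>x. k y x * (w x - w y) \<partial>?m) + w y * ((\<integral>x. k y x \<partial>?m) - 1)"
      using ikw(1)[of y] ik[of y] by (simp add: algebra_simps)
    also have "\<bar>\<dots>\<bar> \<le> (\<integral>x. \<bar>k y x * (w x - w y)\<bar> \<partial>?m) + \<bar>w y\<bar> * \<bar>(\<integral>x. k y x \<partial>?m) - 1\<bar>"
      by (intro order_trans[OF abs_triangle_ineq] add_mono integral_abs_bound) (simp add: abs_mult)
    also have "(\<integral>x. \<bar>k y x * (w x - w y)\<bar> \<partial>?m) = (\<integral>x. k y x * \<bar>w x - w y\<bar> \<partial>?m)"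
      using k0 by (simp add: abs_mult)
    also have "\<dots> \<le> (\<integral>x. near r y x * \<bar>w x - w y\<bar> / r ^ d \<partial>?m)"
    proof (intro integral_mono ikw)
      show "integrable ?m (\<lambda>x. near r y x * \<bar>w x - w y\<bar> / r ^ d)" using inw by simp
      show "k y x * \<bar>w x - w y\<bar> \<le> near r y x * \<bar>w x - w y\<bar> / r ^ d" for x
        using mult_right_mono[OF kr[of y x], of "\<bar>w x - w y\<bar>"] by (simp add: d_def)
    qed
    also have "\<dots> = (\<integral>x. near r y x * \<bar>w x - w y\<bar> \<partial>?m) / r ^ d" by simp
    also have "\<bar>w y\<bar> * \<bar>(\<integral>x. k y x \<partial>?m) - 1\<bar> \<le> W * ((2 ^ d + 1) * indicator (- ?inner) y)"
      by (intro mult_mono W mass) (use W0 in auto)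
    finally show ?thesis by (simp add: mult.assoc)
  qed
  have "(\<integral>y. \<bar>(\<integral>x. k y x * w x \<partial>?m) - w y\<bar> \<partial>?m)
      \<le> (\<integral>y. (\<integral>x. near r y x * \<bar>w x - w y\<bar> \<partial>?m) / r ^ d + W * (2 ^ d + 1) * indicator (- ?inner) y \<partial>?m)"
  proof (intro integral_mono' pt Bochner_Integration.integrable_add io integrable_mult_right
      integrable_real_indicator)
    show "0 \<le> (\<integral>x. near r y x * \<bar>w x - w y\<bar> \<partial>?m) / r ^ d + W * (2 ^ d + 1) * indicator (- ?inner) y" for y
      using W0 rd by (intro add_nonneg_nonneg mult_nonneg_nonneg divide_nonneg_pos
        Bochner_Integration.integral_nonneg_AE AE_I2) auto
  qed (auto simp: emeasure_eq_measure)
  also have "\<dots> = (\<integral>y. (\<integral>x. near r y x * \<bar>w x - w y\<bar> \<partial>?m) \<partial>?m) / r ^ d + W * (2 ^ d + 1) * measure ?m (- ?inner)"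
  proof -
    have "integrable ?m (indicator (- ?inner) :: _ \<Rightarrow> real)"
      by (intro integrable_real_indicator) (auto simp: emeasure_eq_measure)
    then show ?thesis using io by (subst Bochner_Integration.integral_add) auto
  qed
  also have "measure ?m (- ?inner) = (b - a) ^ d - (b - a - 4 * r) ^ d"
  proof -
    have sub: "?inner \<subseteq> cube a b" using r by (intro cube_mono) auto
    have "measure ?m (- ?inner) = measure lborel (cube a b - ?inner)"
      by (subst measure_cube_lborel) (auto intro!: arg_cong[where f = "measure lborel"])
    also have "\<dots> = measure lborel (cube a b :: (real ^ 'n) set) - measure lborel ?inner"
      using sub emeasure_cube_finite[of a b, THEN less_imp_neq] by (intro measure_Diff) auto
    finally show ?thesis using r by (simp add: measure_cube d_def)
  qed
  finally show ?thesis by (simp add: d_def)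
qed

text \<open>
  The kernel need not be symmetric. The result is applied to the kernel of a density estimate, which
  gives the convergence of its mean, and to the transposed kernel, which occurs when the effect of a
  single sample point is averaged over its neighbours.
\<close>
theorem approximate_identity_L1:
  fixes w :: "real ^ 'n \<Rightarrow> real" and k :: "nat \<Rightarrow> real ^ 'n \<Rightarrow> real ^ 'n \<Rightarrow> real"
  assumes ab: "a < b" and w: "w \<in> borel_measurable borel" and W: "\<And>x. \<bar>w x\<bar> \<le> W"
    and r: "\<forall>\<^sub>F n in sequentially. 0 < r n" and r0: "r \<longlonglongrightarrow> 0"
    and k: "\<And>n. (\<lambda>(y, x). k n y x) \<in> borel_measurable (borel \<Otimes>\<^sub>M borel)"
    and ev: "\<forall>\<^sub>F n in sequentially. \<forall>y x. 0 \<le> k n y x \<and> k n y x \<le> near (r n) y x / r n ^ CARD('n)"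
    and ev1: "\<forall>\<^sub>F n in sequentially. \<forall>y \<in> cube (a + 2 * r n) (b - 2 * r n). (\<integral>x. k n y x \<partial>cube_lborel a b) = 1"
  shows "(\<lambda>n. \<integral>y. \<bar>(\<integral>x. k n y x * w x \<partial>cube_lborel a b) - w y\<bar> \<partial>cube_lborel a b) \<longlonglongrightarrow> 0"
proof -
  let ?rhs = "\<lambda>n. (\<integral>y. (\<integral>x. near (r n) y x * \<bar>w x - w y\<bar> \<partial>cube_lborel a b) \<partial>cube_lborel a b) / r n ^ CARD('n)
      + W * (2 ^ CARD('n) + 1) * ((b - a) ^ CARD('n) - (b - a - 4 * r n) ^ CARD('n))"
  have "?rhs \<longlonglongrightarrow> 0 + W * (2 ^ CARD('n) + 1) * ((b - a) ^ CARD('n) - (b - a - 4 * 0) ^ CARD('n))"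
    by (intro tendsto_intros oscillation_tendsto_0[OF w W r r0] r0)
  then have lim: "?rhs \<longlonglongrightarrow> 0" by simp
  have "\<forall>\<^sub>F n in sequentially. r n < (b - a) / 4" using ab by (intro order_tendstoD(2)[OF r0]) auto
  then have upper: "\<forall>\<^sub>F n in sequentially.
      (\<integral>y. \<bar>(\<integral>x. k n y x * w x \<partial>cube_lborel a b) - w y\<bar> \<partial>cube_lborel a b) \<le> ?rhs n"
    using r ev ev1
  proof eventually_elim
    case (elim n)
    then show ?case by (intro approximate_identity_bound w W k) auto
  qed
  show ?thesis
    by (rule tendsto_sandwich[OF _ upper tendsto_const lim]) (auto intro!: always_eventually)
qed

lemma near_inner:
  assumes "y \<in> cube (a + 2 * r) (b - 2 * r)" "infnorm (y - x) \<le> r"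
  shows "x \<in> cube (a + r) (b - r)"
  unfolding mem_cube
proof
  fix i
  have "\<bar>y $ i - x $ i\<bar> \<le> r" using assms(2) by (simp add: infnorm_le_iff)
  then show "a + r \<le> x $ i \<and> x $ i \<le> b - r"
    using assms(1)[unfolded mem_cube, rule_format, of i] by linarith
qed

text \<open>
  A neighbour of a point at distance \<open>2 * r\<close> from the boundary has itself a full cell, so that \<open>q\<close> has
  its maximal value at both points.
\<close>
lemma kernel_mass_inner:
  fixes q :: "real ^ 'n \<Rightarrow> real"
  assumes r: "0 < r" and q: "\<And>x. x \<in> cube (a + r) (b - r) \<Longrightarrow> q x = (2 * r) ^ CARD('n)"
    and [measurable]: "q \<in> borel_measurable borel" and y: "y \<in> cube (a + 2 * r) (b - 2 * r)"
  shows "(\<integral>x. near r x y / q x \<partial>cube_lborel a b) = 1" and "(\<integral>x. near r y x / q y \<partial>cube_lborel a b) = 1"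
proof -
  have vol: "(\<integral>x. near r y x / (2 * r) ^ CARD('n) \<partial>cube_lborel a b) = 1"
  proof -
    have "(\<integral>x. near r y x / (2 * r) ^ CARD('n) \<partial>cube_lborel a b) = (\<integral>x. near r y x / (2 * r) ^ CARD('n) \<partial>lborel)"
    proof (subst integral_cube_lborel, measurable, intro Bochner_Integration.integral_cong refl)
      fix x
      have "x \<in> cube a b" if "infnorm (y - x) \<le> r"
        using near_inner[OF y that] r by (auto simp: mem_cube) (smt (verit))+
      then show "indicator (cube a b) x * (near r y x / (2 * r) ^ CARD('n)) = near r y x / (2 * r) ^ CARD('n)"
        by (auto simp: near_def indicator_def)
    qed
    also have "\<dots> = (2 * r) ^ CARD('n) / (2 * r) ^ CARD('n)"
      using r by (simp only: integral_divide_zero integral_near_lborel(1))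
    also have "\<dots> = 1" using r by simp
    finally show ?thesis .
  qed
  have "near r x y / q x = near r y x / (2 * r) ^ CARD('n)" for x
    using near_inner[OF y, of x] q by (auto simp: near_def infnorm_sub)
  then show "(\<integral>x. near r x y / q x \<partial>cube_lborel a b) = 1" using vol by presburger
  have "y \<in> cube (a + r) (b - r)" using y r by (auto simp: mem_cube) (smt (verit))+
  then show "(\<integral>x. near r y x / q y \<partial>cube_lborel a b) = 1" using vol q by presburger
qed

lemma kernel_region_eq:
  "kernel_region (cube a b) k m x = cube a b \<inter> {y. infnorm (x - y) \<le> (k / real m) powr (1 / real CARD('n)) / 2}"
  for x :: "real ^ 'n"
  by (auto simp: kernel_region_def)

text \<open>
  The truncated ball is a box. For \<open>r \<le> b - a\<close> truncation takes away at most half of each side.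
\<close>
lemma truncated_ball_volume:
  fixes x :: "real ^ 'n"
  assumes r: "0 < r" "r \<le> b - a" and x: "x \<in> cube a b"
  defines "V \<equiv> measure lborel (cube a b \<inter> {y. infnorm (x - y) \<le> r})"
  shows "r ^ CARD('n) \<le> V" "V \<le> (2 * r) ^ CARD('n)"
    and "x \<in> cube (a + r) (b - r) \<Longrightarrow> V = (2 * r) ^ CARD('n)"
proof -
  define lo where "lo i = max a (x $ i - r)" for i
  define up where "up i = min b (x $ i + r)" for i
  have eq: "cube a b \<inter> {y. infnorm (x - y) \<le> r} = cbox (\<chi> i. lo i) (\<chi> i. up i)"
    unfolding infnorm_ball_eq by (auto simp: mem_cube mem_box_cart lo_def up_def)
  have xi: "a \<le> x $ i" "x $ i \<le> b" for i using x by (auto simp: mem_cube)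
  have len: "r \<le> up i - lo i" "up i - lo i \<le> 2 * r" for i
    using xi[of i] r by (auto simp: lo_def up_def)
  have "cbox (\<chi> i. lo i) (\<chi> i. up i) \<noteq> {}"
  proof -
    have "lo i \<le> up i" for i using len(1)[of i] r by linarith
    then show ?thesis by (simp add: interval_ne_empty_cart)
  qed
  then have V: "V = (\<Prod>i\<in>UNIV. up i - lo i)"
    unfolding V_def eq by (subst content_cbox_cart) auto
  have "(\<Prod>i\<in>(UNIV :: 'n set). r) \<le> (\<Prod>i\<in>UNIV. up i - lo i)"
    using len r by (intro prod_mono) auto
  then show "r ^ CARD('n) \<le> V" by (simp add: V)
  have "(\<Prod>i\<in>UNIV. up i - lo i) \<le> (\<Prod>i\<in>(UNIV :: 'n set). 2 * r)"
  proof (rule prod_mono)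
    show "0 \<le> up i - lo i \<and> up i - lo i \<le> 2 * r" for i using len[of i] r by linarith
  qed
  then show "V \<le> (2 * r) ^ CARD('n)" by (simp add: V)
  assume "x \<in> cube (a + r) (b - r)"
  then have "up i - lo i = 2 * r" for i
    by (auto simp: mem_cube lo_def up_def) (smt (verit))+
  then show "V = (2 * r) ^ CARD('n)" by (simp add: V)
qed

lemma kernel_volume_measurable:
  fixes a b k :: real
  shows "kernel_volume (cube a b :: (real ^ 'n) set) k m \<in> borel_measurable borel"
proof -
  let ?r = "(k / real m) powr (1 / real CARD('n)) / 2"
  let ?Q = "{z \<in> space (borel \<Otimes>\<^sub>M lborel). snd z \<in> cube a b \<and> infnorm (fst z - snd z :: real ^ 'n) \<le> ?r}"
  have "?Q \<in> sets (borel \<Otimes>\<^sub>M lborel)" by measurable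
  then have "(\<lambda>x. emeasure lborel (Pair x -` ?Q)) \<in> borel_measurable borel"
    by (rule lborel.measurable_emeasure_Pair)
  then have meas: "(\<lambda>x. enn2real (emeasure lborel (Pair x -` ?Q))) \<in> borel_measurable borel" by measurable
  have eq: "Pair x -` ?Q = kernel_region (cube a b) k m x" for x
    by (auto simp: kernel_region_def space_pair_measure)
  show ?thesis using meas unfolding eq kernel_volume_def[abs_def] measure_def .
qed

section \<open>Bounds on the functional and its derivatives\<close>

lemma bandwidth_at_top:
  fixes k0 \<beta> :: real
  assumes "0 < k0" "0 < \<beta>"
  shows "filterlim (\<lambda>m. k0 * real m powr \<beta>) at_top sequentially"
  using assms by real_asymp

lemma sample_per_bandwidth_at_top:
  fixes k0 \<beta> :: real
  assumes "0 < k0" "\<beta> < 1"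
  shows "filterlim (\<lambda>m. real m / (k0 * real m powr \<beta>)) at_top sequentially"
  using assms by real_asymp

lemma bandwidth_radius_tendsto_0:
  fixes k0 \<beta> :: real
  assumes "0 < k0" "0 < \<beta>" "\<beta> < 1" "0 < n"
  shows "(\<lambda>m. (k0 * real m powr \<beta> / real m) powr (1 / real n) / 2) \<longlonglongrightarrow> 0"
proof -
  have "(\<lambda>m. (k0 * real m powr \<beta> / real m) powr (1 / real n)) \<longlonglongrightarrow> 0"
  proof (rule tendsto_zero_powrI[OF _ tendsto_const])
    show "(\<lambda>m. k0 * real m powr \<beta> / real m) \<longlonglongrightarrow> 0" using assms by real_asymp
  qed (use assms in auto)
  then show ?thesis using tendsto_divide_zero by blast
qed

lemma bandwidth_volume:
  fixes v :: real
  assumes "0 < v" "0 < n"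
  shows "(2 * (v powr (1 / real n) / 2)) ^ n = v"
proof -
  have "(v powr (1 / real n)) ^ n = (v powr (1 / real n)) powr real n"
    using assms(1) by (intro powr_realpow[symmetric]) simp
  also have "\<dots> = v" using assms by (simp add: powr_powr)
  finally show ?thesis by simp
qed

context
  fixes S :: "(real ^ 'n) set" and pl pu k0 \<beta> :: real and k C :: "nat \<Rightarrow> real"
    and h :: "real \<Rightarrow> real ^ 'n \<Rightarrow> real"
  assumes growth: "growth_condition S pl pu k C h"
    and k: "\<And>m. k m = k0 * real m powr \<beta>" and k0: "0 < k0" and \<beta>: "0 < \<beta>" "\<beta> < 1"
    and C: "\<And>m. 0 < C m" and p: "pl < pu" "0 < pu"
begin

lemma k_at_top: "filterlim k at_top sequentially"
  using bandwidth_at_top[OF k0 \<beta>(1)] unfolding k[symmetric] .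

lemma max_estimate_at_top: "filterlim (\<lambda>m. 2 ^ CARD('n) * real m / k m) at_top sequentially"
proof -
  have "filterlim (\<lambda>m. 2 ^ CARD('n) * (real m / k m)) at_top sequentially"
    unfolding k by (rule filterlim_tendsto_pos_mult_at_top[OF tendsto_const _ sample_per_bandwidth_at_top[OF k0 \<beta>(2)]]) simp
  then show ?thesis by simp
qed

lemma inverse_k_less:
  assumes "0 < e"
  shows "\<forall>\<^sub>F m in sequentially. 0 < k m \<and> 1 / k m < e"
proof -
  have "\<forall>\<^sub>F m in sequentially. max 1 (1 / e) < k m"
    using k_at_top unfolding filterlim_at_top_dense by blast
  then show ?thesis
  proof eventually_elim
    case (elim m)
    then show ?case using assms by (auto simp: divide_simps mult.commute)
  qed
qed

text \<open>
  The growth condition is imposed for every \<open>M\<close>, with bounds that may depend on \<open>M\<close>. Taken for one \<open>M\<close>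
  whose interval starts below \<open>\<tau>1\<close> and another whose interval ends above \<open>\<tau>2\<close>, it bounds \<open>h\<close> on the
  compact interval between them.
\<close>
lemma growth_condition_bounded:
  assumes \<tau>: "0 < \<tau>1"
  obtains B where "\<And>x t. x \<in> S \<Longrightarrow> t \<in> {\<tau>1..\<tau>2} \<Longrightarrow> \<bar>h t x\<bar> \<le> B"
proof -
  obtain G3 G4 where
    G3: "\<And>m x t. m \<ge> 1 \<Longrightarrow> x \<in> S \<Longrightarrow> t \<in> {1 / k m<..<pu} \<Longrightarrow> \<bar>h t x\<bar> * C m < G3" and
    G4: "\<And>m x t. m \<ge> 1 \<Longrightarrow> x \<in> S \<Longrightarrow> t \<in> {pl<..<2 ^ CARD('n) * real m / k m} \<Longrightarrow> \<bar>h t x\<bar> * C m < G4"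
    using growth unfolding growth_condition_def by blast
  obtain m where m: "m \<ge> 1" "1 / k m < \<tau>1"
    using eventually_happens'[OF sequentially_bot eventually_conj[OF inverse_k_less[OF \<tau>] eventually_ge_at_top[of 1]]]
    by blast
  have "\<forall>\<^sub>F m in sequentially. \<tau>2 < 2 ^ CARD('n) * real m / k m"
    using max_estimate_at_top unfolding filterlim_at_top_dense by blast
  then obtain m' where m': "m' \<ge> 1" "\<tau>2 < 2 ^ CARD('n) * real m' / k m'"
    using eventually_happens'[OF sequentially_bot eventually_conj[OF _ eventually_ge_at_top[of 1]]] by blast
  have "\<bar>h t x\<bar> \<le> max (G3 / C m) (G4 / C m')" if "x \<in> S" "t \<in> {\<tau>1..\<tau>2}" for x t
  proof (cases "t < pu")
    case True
    then have "\<bar>h t x\<bar> * C m < G3" using that m by (intro G3) auto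
    then have "\<bar>h t x\<bar> < G3 / C m" using C[of m] by (simp add: pos_less_divide_eq)
    then show ?thesis by simp
  next
    case False
    then have "\<bar>h t x\<bar> * C m' < G4" using that m' p by (intro G4) auto
    then have "\<bar>h t x\<bar> < G4 / C m'" using C[of m'] by (simp add: pos_less_divide_eq)
    then show ?thesis by simp
  qed
  then show ?thesis using that by blast
qed

text \<open>
  The interval contains all values that a density estimate can take, if \<open>0\<close> is added for an empty
  cell. Its end points are attained, but excluded from the growth condition; they are reached
  by continuity.
\<close>
lemma growth_condition_range:
  assumes cont: "\<And>x. x \<in> S \<Longrightarrow> continuous_on {0<..} (\<lambda>t. h t x)"
  obtains G where "0 < G" and "\<forall>\<^sub>F m in sequentially. \<forall>x\<in>S. \<forall>t\<in>insert 0 {1 / k m..2 ^ CARD('n) * real m / k m}.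
      \<bar>h t x\<bar> \<le> G * (1 + 1 / C m)"
proof -
  obtain G1 G3 G4 where G1: "\<And>x. x \<in> S \<Longrightarrow> \<bar>h 0 x\<bar> < G1" and
    G3: "\<And>m x t. m \<ge> 1 \<Longrightarrow> x \<in> S \<Longrightarrow> t \<in> {1 / k m<..<pu} \<Longrightarrow> \<bar>h t x\<bar> * C m < G3" and
    G4: "\<And>m x t. m \<ge> 1 \<Longrightarrow> x \<in> S \<Longrightarrow> t \<in> {pl<..<2 ^ CARD('n) * real m / k m} \<Longrightarrow> \<bar>h t x\<bar> * C m < G4"
  proof -
    obtain G1 where 1: "\<forall>x\<in>S. \<bar>h 0 x\<bar> < G1" using growth unfolding growth_condition_def by blast
    obtain G3 where 3: "\<forall>m\<ge>1. \<forall>x\<in>S. \<forall>t\<in>{1 / k m<..<pu}. \<bar>h t x\<bar> * C m < G3"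
      using growth unfolding growth_condition_def by blast
    obtain G4 where 4: "\<forall>m\<ge>1. \<forall>x\<in>S. \<forall>t\<in>{pl<..<2 ^ CARD('n) * real m / k m}. \<bar>h t x\<bar> * C m < G4"
      using growth unfolding growth_condition_def by blast
    show ?thesis
    proof (rule that)
      show "\<bar>h 0 x\<bar> < G1" if "x \<in> S" for x using 1 that by blast
      show "\<bar>h t x\<bar> * C m < G3" if "m \<ge> 1" "x \<in> S" "t \<in> {1 / k m<..<pu}" for m x t
        using 3 that by blast
      show "\<bar>h t x\<bar> * C m < G4" if "m \<ge> 1" "x \<in> S" "t \<in> {pl<..<2 ^ CARD('n) * real m / k m}" for m x t
        using 4 that by blast
    qed
  qed
  define G where "G = Max {1, G1, G3, G4}"
  have G: "1 \<le> G" "G1 \<le> G" "G3 \<le> G" "G4 \<le> G" by (auto simp: G_def)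
  have "\<forall>\<^sub>F m in sequentially. pl < 2 ^ CARD('n) * real m / k m"
    using max_estimate_at_top unfolding filterlim_at_top_dense by blast
  then have "\<forall>\<^sub>F m in sequentially. \<forall>x\<in>S. \<forall>t\<in>insert 0 {1 / k m..2 ^ CARD('n) * real m / k m}.
      \<bar>h t x\<bar> \<le> G * (1 + 1 / C m)"
    using inverse_k_less[OF p(2)] eventually_ge_at_top[of 1]
  proof eventually_elim
    case (elim m)
    let ?u = "2 ^ CARD('n) * real m / k m"
    have GC: "G \<le> G * (1 + 1 / C m)" "G / C m \<le> G * (1 + 1 / C m)"
      using G C[of m] by (auto simp: field_simps)
    show ?case
    proof (intro ballI)
      fix x t assume x: "x \<in> S" and t: "t \<in> insert 0 {1 / k m..?u}"
      show "\<bar>h t x\<bar> \<le> G * (1 + 1 / C m)"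
      proof (cases "t = 0")
        case True
        then show ?thesis using G1[OF x] G(2) GC(1) by simp
      next
        case False
        have "1 * 1 < (2::real) ^ CARD('n) * real m"
          using elim by (intro mult_less_le_imp_less one_less_power) auto
        then have lu: "1 / k m < ?u" using elim by (intro divide_strict_right_mono) auto
        have int: "\<bar>h s x\<bar> \<le> G / C m" if "s \<in> {1 / k m<..<?u}" for s
        proof (cases "s < pu")
          case True
          then have "\<bar>h s x\<bar> * C m < G3" using that elim x by (intro G3) auto
          then show ?thesis using C[of m] G by (simp add: pos_le_divide_eq)
        next
          case False
          then have "\<bar>h s x\<bar> * C m < G4" using that elim x p by (intro G4) auto
          then show ?thesis using C[of m] G by (simp add: pos_le_divide_eq)
        qed
        have cl: "closure {1 / k m<..<?u} = {1 / k m..?u}" using lu by simp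
        have "0 < 1 / k m" using elim by simp
        then have "{1 / k m..?u} \<subseteq> {0<..}" by (meson atLeastAtMost_iff greaterThan_iff less_le_trans subsetI)
        then have ct: "continuous_on (closure {1 / k m<..<?u}) (\<lambda>s. \<bar>h s x\<bar>)"
          unfolding cl by (intro continuous_intros continuous_on_subset[OF cont[OF x]])
        have "t \<in> closure {1 / k m<..<?u}" unfolding cl using t False by simp
        from continuous_le_on_closure[OF ct this int] have "\<bar>h t x\<bar> \<le> G / C m" .
        then show ?thesis using GC by linarith
      qed
    qed
  qed
  then show ?thesis using that[of G] G by auto
qed

end

lemma bounded_derivative_lipschitz:
  fixes F F' :: "real \<Rightarrow> real"
  assumes "\<And>t. t \<in> {\<tau>1..\<tau>2} \<Longrightarrow> (F has_real_derivative F' t) (at t)"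
    and "\<And>t. t \<in> {\<tau>1..\<tau>2} \<Longrightarrow> \<bar>F' t\<bar> \<le> B" and "s \<in> {\<tau>1..\<tau>2}" "t \<in> {\<tau>1..\<tau>2}"
  shows "\<bar>F t - F s\<bar> \<le> B * \<bar>t - s\<bar>"
  using field_differentiable_bound[of "{\<tau>1..\<tau>2}" F F' B t s] assms
  by (auto intro: has_field_derivative_at_within)

lemma bounded_derivative_bounded:
  fixes F F' :: "real \<Rightarrow> real"
  assumes "\<And>t. t \<in> {\<tau>1..\<tau>2} \<Longrightarrow> (F has_real_derivative F' t) (at t)"
    and "\<And>t. t \<in> {\<tau>1..\<tau>2} \<Longrightarrow> \<bar>F' t\<bar> \<le> B" and s: "s \<in> {\<tau>1..\<tau>2}" "\<bar>F s\<bar> \<le> B0" and t: "t \<in> {\<tau>1..\<tau>2}"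
  shows "\<bar>F t\<bar> \<le> B0 + B * (\<tau>2 - \<tau>1)"
proof -
  have "\<bar>F t - F s\<bar> \<le> B * \<bar>t - s\<bar>" by (rule bounded_derivative_lipschitz[OF assms(1,2) s(1) t])
  also have "\<dots> \<le> B * (\<tau>2 - \<tau>1)"
    using s t assms(2)[OF t] by (intro mult_left_mono) (auto intro: order_trans[OF abs_ge_zero])
  finally show ?thesis using s by linarith
qed

text \<open>
  A bound on the third derivative gives bounds on the lower ones, by the mean value theorem, starting
  from the bounds at a single argument \<open>t0\<close>.
\<close>
lemma first_arg_derivs_lipschitz:
  fixes g :: "real \<Rightarrow> real ^ 'n \<Rightarrow> real"
  assumes gd: "first_arg_derivs m S g gd" and m: "3 \<le> m"
    and ref: "\<And>n. n \<le> 2 \<Longrightarrow> \<exists>B. \<forall>x\<in>S. \<bar>gd n t0 x\<bar> \<le> B"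
    and third: "\<And>x t. x \<in> S \<Longrightarrow> t \<in> {\<tau>1..\<tau>2} \<Longrightarrow> \<bar>gd 3 t x\<bar> \<le> B3"
    and \<tau>: "0 < \<tau>1" "t0 \<in> {\<tau>1..\<tau>2}"
  obtains L where "0 < L"
    and "\<And>x t. x \<in> S \<Longrightarrow> t \<in> {\<tau>1..\<tau>2} \<Longrightarrow> \<bar>g t x\<bar> \<le> L \<and> \<bar>gd 1 t x\<bar> \<le> L"
    and "\<And>x s t. x \<in> S \<Longrightarrow> s \<in> {\<tau>1..\<tau>2} \<Longrightarrow> t \<in> {\<tau>1..\<tau>2} \<Longrightarrow> \<bar>g t x - g s x\<bar> \<le> L * \<bar>t - s\<bar>"
    and "\<And>x s t. x \<in> S \<Longrightarrow> s \<in> {\<tau>1..\<tau>2} \<Longrightarrow> t \<in> {\<tau>1..\<tau>2} \<Longrightarrow> \<bar>gd 1 t x - gd 1 s x\<bar> \<le> L * \<bar>t - s\<bar>"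
proof -
  have g0: "gd 0 = g" using gd by (simp add: first_arg_derivs_def)
  have der: "((\<lambda>s. gd n s x) has_real_derivative gd (Suc n) t x) (at t)"
    if "n < 3" "x \<in> S" "t \<in> {\<tau>1..\<tau>2}" for n x t
    using gd that m \<tau> unfolding first_arg_derivs_def by (auto simp: less_le_trans)
  have step: "\<exists>B. \<forall>x\<in>S. \<forall>t\<in>{\<tau>1..\<tau>2}. \<bar>gd n t x\<bar> \<le> B"
    if n: "n < 3" and ex: "\<exists>B. \<forall>x\<in>S. \<forall>t\<in>{\<tau>1..\<tau>2}. \<bar>gd (Suc n) t x\<bar> \<le> B" for n
  proof -
    obtain B where B: "\<And>x t. x \<in> S \<Longrightarrow> t \<in> {\<tau>1..\<tau>2} \<Longrightarrow> \<bar>gd (Suc n) t x\<bar> \<le> B" using ex by blast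
    obtain B0 where B0: "\<And>x. x \<in> S \<Longrightarrow> \<bar>gd n t0 x\<bar> \<le> B0" using ref[of n] n by auto
    have "\<bar>gd n t x\<bar> \<le> B0 + B * (\<tau>2 - \<tau>1)" if "x \<in> S" "t \<in> {\<tau>1..\<tau>2}" for x t
      by (rule bounded_derivative_bounded[where F = "\<lambda>s. gd n s x", OF der[OF n that(1)] B[OF that(1)] \<tau>(2) B0[OF that(1)] that(2)])
    then show ?thesis by blast
  qed
  have "\<exists>B. \<forall>x\<in>S. \<forall>t\<in>{\<tau>1..\<tau>2}. \<bar>gd (Suc 2) t x\<bar> \<le> B" by (intro exI[of _ B3]) (use third in \<open>auto simp: eval_nat_numeral\<close>)
  then have b2: "\<exists>B. \<forall>x\<in>S. \<forall>t\<in>{\<tau>1..\<tau>2}. \<bar>gd (Suc 1) t x\<bar> \<le> B"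
    using step[of 2] by (simp add: numeral_2_eq_2)
  then have b1: "\<exists>B. \<forall>x\<in>S. \<forall>t\<in>{\<tau>1..\<tau>2}. \<bar>gd (Suc 0) t x\<bar> \<le> B"
    using step[of 1] by simp
  then have b0: "\<exists>B. \<forall>x\<in>S. \<forall>t\<in>{\<tau>1..\<tau>2}. \<bar>gd 0 t x\<bar> \<le> B"
    using step[of 0] by simp
  from b0 b1 b2 obtain B0 B1 B2 where
    B0: "\<And>x t. x \<in> S \<Longrightarrow> t \<in> {\<tau>1..\<tau>2} \<Longrightarrow> \<bar>gd 0 t x\<bar> \<le> B0" and
    B1: "\<And>x t. x \<in> S \<Longrightarrow> t \<in> {\<tau>1..\<tau>2} \<Longrightarrow> \<bar>gd (Suc 0) t x\<bar> \<le> B1" and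
    B2: "\<And>x t. x \<in> S \<Longrightarrow> t \<in> {\<tau>1..\<tau>2} \<Longrightarrow> \<bar>gd (Suc 1) t x\<bar> \<le> B2"
    by blast
  define L where "L = Max {1, B0, B1, B2}"
  have L: "1 \<le> L" "B0 \<le> L" "B1 \<le> L" "B2 \<le> L" by (auto simp: L_def)
  show ?thesis
  proof (rule that[of L])
    fix x s t assume x: "x \<in> S" and st: "s \<in> {\<tau>1..\<tau>2}" "t \<in> {\<tau>1..\<tau>2}"
    show "\<bar>g t x - g s x\<bar> \<le> L * \<bar>t - s\<bar>"
      unfolding g0[symmetric]
      by (rule bounded_derivative_lipschitz[where F = "\<lambda>s. gd 0 s x", OF der[OF _ x] _ st])
         (use B1[OF x] L in \<open>auto intro: order_trans\<close>)
    show "\<bar>gd 1 t x - gd 1 s x\<bar> \<le> L * \<bar>t - s\<bar>"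
      by (rule bounded_derivative_lipschitz[where F = "\<lambda>s. gd 1 s x", OF der[OF _ x] _ st])
         (use B2[OF x] L in \<open>auto intro: order_trans\<close>)
  next
    fix x t assume "x \<in> S" "t \<in> {\<tau>1..\<tau>2}"
    then show "\<bar>g t x\<bar> \<le> L \<and> \<bar>gd 1 t x\<bar> \<le> L"
      using B0[of x t] B1[of x t] L g0 by (auto intro: order_trans)
  qed (use L in auto)
qed

lemma difference_quotient_error:
  fixes F F' :: "real \<Rightarrow> real"
  assumes "\<And>t. t \<in> {\<tau>1..\<tau>2} \<Longrightarrow> (F has_real_derivative F' t) (at t)"
    and "\<And>t. t \<in> {\<tau>1..\<tau>2} \<Longrightarrow> \<bar>F' t - F' s\<bar> \<le> L * \<bar>t - s\<bar>" and "0 \<le> L"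
    and "0 < e" "t \<in> {\<tau>1..\<tau>2}" "t + e \<in> {\<tau>1..\<tau>2}"
  shows "\<bar>(F (t + e) - F t) / e - F' s\<bar> \<le> L * (\<bar>t - s\<bar> + e)"
proof -
  obtain z where z: "t < z" "z < t + e" "F (t + e) - F t = (t + e - t) * F' z"
    using MVT2[of t "t + e" F F'] assms by auto
  have "\<bar>F' z - F' s\<bar> \<le> L * \<bar>z - s\<bar>" using z assms by (intro assms(2)) auto
  also have "\<dots> \<le> L * (\<bar>t - s\<bar> + e)" using z assms by (intro mult_left_mono) auto
  finally show ?thesis using z assms by simp
qed

text \<open>
  In terms of \<open>z = m powr \<beta>\<close> the growth exponent is \<open>z powr (1 - \<delta>)\<close>, which is at most \<open>sqrt z\<close> since
  \<open>1 - \<delta> < 1 / 2\<close>, and thus of lower order than the exponent \<open>c * k0 * z\<close> of the decay.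
\<close>
lemma superpolynomial_decay:
  fixes k0 \<beta> \<delta> c :: real
  assumes "0 < k0" "0 < \<beta>" "2 / 3 < \<delta>" "0 < c"
  shows "(\<lambda>m. (k0 * real m powr \<beta>)\<^sup>2 * (exp (real m powr (\<beta> * (1 - \<delta>))))\<^sup>2
    * exp (- c * (k0 * real m powr \<beta>))) \<longlonglongrightarrow> 0"
proof -
  have "((\<lambda>z. (k0 * z)\<^sup>2 * (exp (sqrt z))\<^sup>2 * exp (- c * (k0 * z))) \<longlongrightarrow> 0) at_top"
    using assms(1,4) by real_asymp
  then have lim: "(\<lambda>m. (k0 * (real m powr \<beta>))\<^sup>2 * (exp (sqrt (real m powr \<beta>)))\<^sup>2 * exp (- c * (k0 * (real m powr \<beta>)))) \<longlonglongrightarrow> 0"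
    by (rule filterlim_compose) (use assms(2) in real_asymp)
  show ?thesis
  proof (rule tendsto_sandwich[OF _ _ tendsto_const lim])
    show "\<forall>\<^sub>F m in sequentially. (k0 * real m powr \<beta>)\<^sup>2 * (exp (real m powr (\<beta> * (1 - \<delta>))))\<^sup>2
        * exp (- c * (k0 * real m powr \<beta>))
      \<le> (k0 * (real m powr \<beta>))\<^sup>2 * (exp (sqrt (real m powr \<beta>)))\<^sup>2 * exp (- c * (k0 * (real m powr \<beta>)))"
      using eventually_ge_at_top[of 1]
    proof eventually_elim
      case (elim m)
      have "sqrt (real m powr \<beta>) = real m powr (\<beta> / 2)"
        by (simp add: powr_half_sqrt[symmetric] powr_powr)
      moreover have "real m powr (\<beta> * (1 - \<delta>)) \<le> real m powr (\<beta> / 2)"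
        using elim assms by (intro powr_mono) auto
      ultimately show ?case
        by (intro mult_right_mono mult_left_mono power_mono) auto
    qed
  qed auto
qed

text \<open>
  The derivative is the limit of a sequence of difference quotients, each of which is measurable by
  the joint measurability of \<open>g\<close>.
\<close>
lemma measurable_derivative_along:
  fixes g :: "real \<Rightarrow> 'a \<Rightarrow> real"
  assumes g: "(\<lambda>(t, x). g t x) \<in> borel_measurable (borel \<Otimes>\<^sub>M M)"
    and f [measurable]: "f \<in> borel_measurable M" and S [measurable]: "S \<in> sets M"
    and der: "\<And>x. x \<in> S \<Longrightarrow> ((\<lambda>s. g s x) has_real_derivative g' x) (at (f x))"
  shows "(\<lambda>x. if x \<in> S then g' x else 0) \<in> borel_measurable M"
proof (rule borel_measurable_LIMSEQ_real)
  let ?u = "\<lambda>n x. if x \<in> S then (g (f x + 1 / real (Suc n)) x - g (f x) x) / (1 / real (Suc n)) else 0"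
  fix x
  have "(\<lambda>n. 1 / real (Suc n)) \<longlonglongrightarrow> 0" by real_asymp
  then have lim: "filterlim (\<lambda>n. 1 / real (Suc n)) (at 0) sequentially"
    by (simp add: filterlim_at)
  show "(\<lambda>n. ?u n x) \<longlonglongrightarrow> (if x \<in> S then g' x else 0)"
  proof (cases "x \<in> S")
    case True
    show ?thesis
      using filterlim_compose[OF der[OF True, unfolded DERIV_def] lim] True by simp
  qed simp
next
  fix n
  have [measurable]: "(\<lambda>x. g (F x) x) \<in> borel_measurable M" if "F \<in> borel_measurable M" for F
    using measurable_compose[OF measurable_Pair[OF that measurable_ident] g] by simp
  show "(\<lambda>x. if x \<in> S then (g (f x + 1 / real (Suc n)) x - g (f x) x) / (1 / real (Suc n)) else 0) \<in> borel_measurable M"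
    by measurable
qed

section \<open>Error bounds at one sample size\<close>

lemma iid_sample_distr:
  fixes X :: "nat \<Rightarrow> 'w \<Rightarrow> real ^ 'n"
  assumes X: "iid_sample P X f" and I: "I \<noteq> {}" "I \<subseteq> {1..}"
  shows "distr P (PiM I (\<lambda>_. borel)) (\<lambda>x. \<lambda>i\<in>I. X i x) = PiM I (\<lambda>_. density lborel (\<lambda>x. ennreal (f x)))"
proof -
  interpret prob_space P using X by (simp add: iid_sample_def)
  have d: "distributed P lborel (X i) (\<lambda>x. ennreal (f x))" if "i \<in> I" for i
    using X I that by (auto simp: iid_sample_def)
  have rv: "random_variable borel (X i)" if "i \<in> I" for i
    using distributed_measurable[OF d[OF that]] by simp
  have "indep_vars (\<lambda>_. borel) X I"
    using X I by (auto simp: iid_sample_def intro: indep_vars_subset)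
  then have "distr P (PiM I (\<lambda>_. borel)) (\<lambda>x. \<lambda>i\<in>I. X i x) = PiM I (\<lambda>i. distr P borel (X i))"
    using indep_vars_iff_distr_eq_PiM'[OF I(1) rv] by simp
  also have "\<dots> = PiM I (\<lambda>_. density lborel (\<lambda>x. ennreal (f x)))"
  proof (intro PiM_cong refl)
    fix i assume i: "i \<in> I"
    have "distr P borel (X i) = distr P lborel (X i)" by (intro distr_cong) auto
    then show "distr P borel (X i) = density lborel (\<lambda>x. ennreal (f x))"
      using distributed_distr_eq_density[OF d[OF i]] by simp
  qed
  finally show ?thesis .
qed

text \<open>
  Both estimators are of this form, and for both the expansion is proved with a general \<open>q\<close>.
\<close>
definition kde_with_volume ::
    "(real ^ 'n \<Rightarrow> real) \<Rightarrow> (real ^ 'n) set \<Rightarrow> real \<Rightarrow> nat \<Rightarrow> nat \<Rightarrow> (nat \<Rightarrow> real ^ 'n) \<Rightarrow> real ^ 'n \<Rightarrow> real"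
  where "kde_with_volume q S k N M X x = real (kernel_count S k N M X x) / (real M * q x)"

lemma truncated_kde_eq: "truncated_kde S k N M = kde_with_volume (kernel_volume S k M) S k N M"
  and standard_kde_eq: "standard_kde S k N M = kde_with_volume (\<lambda>_. k / real M) S k N M"
  by (simp_all add: truncated_kde_def standard_kde_def kde_with_volume_def fun_eq_iff)

locale density_on_cube =
  fixes f :: "real ^ 'n \<Rightarrow> real" and a b eps0 eps_inf :: real
  assumes ab: "a < b" and f_measurable [measurable]: "f \<in> borel_measurable borel"
    and f_nonneg: "\<And>x. 0 \<le> f x" and f_mass: "(\<integral>\<^sup>+ x. ennreal (f x) \<partial>lborel) = 1"
    and f_outside: "\<And>x. x \<notin> cube a b \<Longrightarrow> f x = 0"
    and eps0: "0 < eps0" and f_bounds: "\<And>x. x \<in> cube a b \<Longrightarrow> eps0 \<le> f x \<and> f x \<le> eps_inf"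
begin

abbreviation \<mu> :: "(real ^ 'n) measure" where "\<mu> \<equiv> cube_lborel a b"

definition "D = density lborel (\<lambda>x. ennreal (f x))"

lemma sets_D [simp, measurable_cong]: "sets D = sets borel"
  and space_D [simp]: "space D = UNIV"
  by (auto simp: D_def)

sublocale mu: finite_measure \<mu> by (rule finite_measure_cube_lborel)

sublocale D: prob_space D
proof
  show "emeasure D (space D) = 1" using f_mass by (simp add: D_def emeasure_density)
qed

lemma eps_inf: "eps0 \<le> eps_inf"
proof -
  have "(\<chi> i. a) \<in> cube a b" using ab by (simp add: mem_cube)
  from f_bounds[OF this] show ?thesis by linarith
qed

lemma f_le: "\<bar>f x\<bar> \<le> eps_inf"
  using f_bounds[of x] f_outside[of x] eps0 eps_inf by (cases "x \<in> cube a b") auto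

lemma integral_D:
  fixes F :: "real ^ 'n \<Rightarrow> real"
  assumes [measurable]: "F \<in> borel_measurable borel"
  shows "(\<integral>x. F x \<partial>D) = (\<integral>x. f x * F x \<partial>\<mu>)"
proof -
  have "(\<integral>x. F x \<partial>D) = (\<integral>x. f x * F x \<partial>lborel)"
    unfolding D_def by (subst integral_density) (auto simp: f_nonneg)
  also have "\<dots> = (\<integral>x. indicator (cube a b) x * (f x * F x) \<partial>lborel)"
    by (intro Bochner_Integration.integral_cong) (auto simp: indicator_def f_outside)
  also have "\<dots> = (\<integral>x. f x * F x \<partial>\<mu>)" by (subst integral_cube_lborel) auto
  finally show ?thesis .
qed

lemma AE_D: "AE x in D. x \<in> cube a b"
proof -
  have "x \<in> cube a b" if "0 < ennreal (f x)" for x using f_outside[of x] that by fastforce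
  then show ?thesis unfolding D_def by (subst AE_density) auto
qed

lemma integral_D_le:
  fixes F G :: "real ^ 'n \<Rightarrow> real"
  assumes F: "F \<in> borel_measurable borel" and FG: "\<And>x. x \<in> cube a b \<Longrightarrow> 0 \<le> F x \<and> F x \<le> G x"
    and G: "integrable \<mu> G"
  shows "(\<integral>x. F x \<partial>D) \<le> eps_inf * (\<integral>x. G x \<partial>\<mu>)"
proof -
  have "(\<integral>x. F x \<partial>D) \<le> (\<integral>x. eps_inf * G x \<partial>\<mu>)"
    unfolding integral_D[OF F]
  proof (rule integral_mono_AE')
    show "AE x in \<mu>. f x * F x \<le> eps_inf * G x"
      using AE_cube_lborel
    proof eventually_elim
      fix x :: "real ^ 'n" assume "x \<in> cube a b"
      then show "f x * F x \<le> eps_inf * G x" using FG[of x] f_bounds[of x] eps0 by (intro mult_mono) auto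
    qed
    show "AE x in \<mu>. 0 \<le> eps_inf * G x"
      using AE_cube_lborel
    proof eventually_elim
      fix x :: "real ^ 'n" assume "x \<in> cube a b"
      then show "0 \<le> eps_inf * G x" using FG[of x] eps0 eps_inf by auto
    qed
  qed (use G in auto)
  then show ?thesis by simp
qed

end

text \<open>
  The situation for a fixed sample size \<open>m\<close>. Here \<open>r\<close> is half the side of a cell, \<open>q x\<close> the volume used at
  \<open>x\<close>, and \<open>w\<close> the derivative of the functional at the true density, extended by \<open>0\<close> outside the
  cube. Except with exponentially small probability the estimate lies
  in \<open>{\<tau>1..\<tau>2}\<close>, where \<open>L\<close> is a bound and a Lipschitz constant. The bound \<open>B\<close> covers all values that the
  estimate can take and may grow with \<open>m\<close>.
\<close>
locale bandwidth_stage = density_on_cube f a b eps0 eps_inf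
  for f :: "real ^ 'n \<Rightarrow> real" and a b eps0 eps_inf :: real +
  fixes g g' :: "real \<Rightarrow> real ^ 'n \<Rightarrow> real" and w q :: "real ^ 'n \<Rightarrow> real"
    and m :: nat and k r L B two_pow \<tau>1 \<tau>2 :: real
  assumes two_pow_def: "two_pow = 2 ^ CARD('n)"
    and tau_def: "\<tau>1 = eps0 / two_pow / 8" "\<tau>2 = two_pow * (3 * eps_inf + 1)"
    and g_measurable: "(\<lambda>(t, x). g t x) \<in> borel_measurable (borel \<Otimes>\<^sub>M borel)"
    and w_measurable [measurable]: "w \<in> borel_measurable borel"
    and q_measurable [measurable]: "q \<in> borel_measurable borel"
    and w_eq: "\<And>x. x \<in> cube a b \<Longrightarrow> w x = g' (f x) x" and w_outside: "\<And>x. x \<notin> cube a b \<Longrightarrow> w x = 0"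
    and r: "0 < r" "r \<le> b - a" and volume: "(2 * r) ^ CARD('n) = k / real m"
    and m: "2 \<le> m" and k: "1 \<le> k"
    and q: "\<And>x. r ^ CARD('n) \<le> q x \<and> q x \<le> (2 * r) ^ CARD('n)"
    and L: "0 < L"
    and derivative: "\<And>x t. x \<in> cube a b \<Longrightarrow> t \<in> {\<tau>1..\<tau>2}
       \<Longrightarrow> ((\<lambda>s. g s x) has_real_derivative g' t x) (at t)"
    and g_bounded: "\<And>x t. x \<in> cube a b \<Longrightarrow> t \<in> {\<tau>1..\<tau>2}
       \<Longrightarrow> \<bar>g t x\<bar> \<le> L \<and> \<bar>g' t x\<bar> \<le> L"
    and g_lipschitz: "\<And>x s t. x \<in> cube a b \<Longrightarrow> s \<in> {\<tau>1..\<tau>2}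
       \<Longrightarrow> t \<in> {\<tau>1..\<tau>2} \<Longrightarrow> \<bar>g t x - g s x\<bar> \<le> L * \<bar>t - s\<bar>"
    and g'_lipschitz: "\<And>x s t. x \<in> cube a b \<Longrightarrow> s \<in> {\<tau>1..\<tau>2}
       \<Longrightarrow> t \<in> {\<tau>1..\<tau>2} \<Longrightarrow> \<bar>g' t x - g' s x\<bar> \<le> L * \<bar>t - s\<bar>"
    and B: "L \<le> B" and range_bound: "\<And>x n. x \<in> cube a b \<Longrightarrow> n \<le> m \<Longrightarrow> \<bar>g (real n / (real m * q x)) x\<bar> \<le> B"
begin

definition R :: "((real ^ 'n) \<times> (real ^ 'n)) set" where
  "R = {(x, y). x \<in> cube a b \<and> y \<in> cube a b \<and> infnorm (x - y) \<le> r}"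
definition "h n x = (if x \<in> cube a b then g (real n / (real m * q x)) x else 0)"
definition "\<psi> x = (if x \<in> cube a b then g (f x) x else 0)"
definition "\<Phi> x = f x * w x"
definition "mean x = (\<integral>y. indicator R (x, y) / q x \<partial>D)"

lemma two_pow: "1 \<le> two_pow" by (simp add: two_pow_def)

lemma tau_bounds: "0 < \<tau>1" "\<tau>1 \<le> eps0" "eps_inf \<le> \<tau>2"
proof -
  show "0 < \<tau>1" using eps0 two_pow by (simp add: tau_def)
  have "\<tau>1 \<le> eps0 / 1 / 1" unfolding tau_def using eps0 two_pow by (intro frac_le) auto
  then show "\<tau>1 \<le> eps0" by simp
  have "1 * eps_inf \<le> \<tau>2" unfolding tau_def using two_pow eps0 eps_inf by (intro mult_mono) auto
  then show "eps_inf \<le> \<tau>2" by simp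
qed

lemma density_in_range: "x \<in> cube a b \<Longrightarrow> f x \<in> {\<tau>1..\<tau>2}"
  using f_bounds[of x] tau_bounds by auto

lemma w_le: "\<bar>w x\<bar> \<le> L"
  using g_bounded[OF _ density_in_range, of x x] w_eq[of x] w_outside[of x] L
  by (cases "x \<in> cube a b") auto

lemma psi_le: "\<bar>\<psi> x\<bar> \<le> L"
  using g_bounded[OF _ density_in_range, of x x] L by (cases "x \<in> cube a b") (auto simp: \<psi>_def)

lemma Phi_le: "\<bar>\<Phi> x\<bar> \<le> eps_inf * L"
  unfolding \<Phi>_def abs_mult using f_le[of x] w_le[of x] eps0 eps_inf by (intro mult_mono) auto

lemma g_compose [measurable]:
  assumes "F \<in> borel_measurable N" "G \<in> borel_measurable N"
  shows "(\<lambda>z. g (F z) (G z)) \<in> borel_measurable N"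
  using measurable_compose[OF measurable_Pair[OF assms] g_measurable] by simp

lemma R_measurable [measurable]: "R \<in> sets (borel \<Otimes>\<^sub>M borel)"
proof -
  have "{z \<in> space (borel \<Otimes>\<^sub>M borel). fst z \<in> cube a b \<and> snd z \<in> cube a b \<and> infnorm (fst z - snd z) \<le> r}
      \<in> sets (borel \<Otimes>\<^sub>M borel :: ((real ^ 'n) \<times> (real ^ 'n)) measure)"
    by measurable
  also have "{z \<in> space (borel \<Otimes>\<^sub>M borel). fst z \<in> cube a b \<and> snd z \<in> cube a b \<and> infnorm (fst z - snd z) \<le> r} = R"
    by (auto simp: R_def space_pair_measure)
  finally show ?thesis .
qed

lemma h_measurable [measurable]: "h n \<in> borel_measurable borel"
  unfolding h_def by measurable

lemma psi_measurable [measurable]: "\<psi> \<in> borel_measurable borel"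
  unfolding \<psi>_def by measurable

lemma Phi_measurable [measurable]: "\<Phi> \<in> borel_measurable borel"
  unfolding \<Phi>_def by measurable

lemma rd: "0 < r ^ CARD('n)" "(2 * r) ^ CARD('n) = two_pow * r ^ CARD('n)"
  using r by (auto simp: two_pow_def power_mult_distrib)

lemma q_pos: "0 < q x" using q[of x] rd by linarith

lemma mq: "k / two_pow \<le> real m * q x" "real m * q x \<le> k"
proof -
  have "real m * (two_pow * r ^ CARD('n)) = k" using volume m unfolding rd(2) by (simp add: field_simps)
  then have "k / two_pow = real m * r ^ CARD('n)" using two_pow by (simp add: field_simps)
  then show "k / two_pow \<le> real m * q x" using q[of x] by (simp add: mult_left_mono)
  have "k = real m * (2 * r) ^ CARD('n)" using volume m by (simp add: field_simps)
  then show "real m * q x \<le> k" using q[of x] by (simp add: mult_left_mono)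
qed

lemma indicator_R: "indicator R (x, y) = (if x \<in> cube a b \<and> y \<in> cube a b then near r x y else 0)"
  by (auto simp: R_def near_def indicator_def)

lemma near_over_q_le: "near r x y / q x \<le> near r x y / r ^ CARD('n)"
  by (rule divide_left_mono) (use q[of x] rd q_pos[of x] in simp_all)

lemma indicator_R_le: "indicator R (x, y) / q x \<le> near r x y / r ^ CARD('n)"
proof -
  have "0 \<le> near r x y / r ^ CARD('n)" using rd by simp
  then show ?thesis unfolding indicator_R using near_over_q_le[of x y] by simp
qed

lemma near_integral_le:
  "(\<integral>y. near r x y / r ^ CARD('n) \<partial>\<mu>) \<le> two_pow" "integrable \<mu> (\<lambda>y. near r x y / r ^ CARD('n))"
proof -
  show "integrable \<mu> (\<lambda>y. near r x y / r ^ CARD('n))"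
    by (intro integrable_divide mu.integrable_bounded'[of _ 1]) auto
  have "(\<integral>y. near r x y \<partial>\<mu>) \<le> two_pow * r ^ CARD('n)"
    using integral_near_le[of r a b x] r unfolding rd(2) by simp
  then show "(\<integral>y. near r x y / r ^ CARD('n) \<partial>\<mu>) \<le> two_pow" using rd by (simp add: divide_le_eq)
qed

lemma mass_source: "(\<integral>x. indicator R (x, y) / q x \<partial>D) \<le> two_pow * eps_inf"
proof -
  have "(\<integral>x. indicator R (x, y) / q x \<partial>D) \<le> eps_inf * (\<integral>x. near r y x / r ^ CARD('n) \<partial>\<mu>)"
  proof (rule integral_D_le)
    fix x
    show "0 \<le> indicator R (x, y) / q x \<and> indicator R (x, y) / q x \<le> near r y x / r ^ CARD('n)"
      using q_pos[of x] indicator_R_le[of x y] by (simp add: near_sym[of r y x] less_imp_le)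
  qed (use near_integral_le(2) in auto)
  also have "\<dots> \<le> eps_inf * two_pow" using near_integral_le(1) eps0 eps_inf by (intro mult_left_mono) auto
  finally show ?thesis by (simp add: mult.commute)
qed

lemma mass_target: "mean x \<le> two_pow * eps_inf"
proof -
  have "mean x \<le> eps_inf * (\<integral>y. near r x y / r ^ CARD('n) \<partial>\<mu>)"
    unfolding mean_def using q_pos[of x] indicator_R_le[of x] near_integral_le(2)
    by (intro integral_D_le) (auto simp: less_imp_le)
  also have "\<dots> \<le> eps_inf * two_pow" using near_integral_le(1) eps0 eps_inf by (intro mult_left_mono) auto
  finally show ?thesis by (simp add: mult.commute)
qed

lemma mean_nonneg: "0 \<le> mean x"
  unfolding mean_def using q_pos[of x] by (intro Bochner_Integration.integral_nonneg_AE AE_I2) (auto simp: less_imp_le)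

lemma mean_measurable [measurable]: "mean \<in> borel_measurable borel"
proof -
  have "(\<lambda>x. \<integral>y. indicator R (x, y) / q x \<partial>D) \<in> borel_measurable borel"
    by (rule D.borel_measurable_lebesgue_integral) measurable
  then show ?thesis unfolding mean_def[abs_def] .
qed

lemma neighbourhood_prob:
  fixes x :: "real ^ 'n"
  defines "S \<equiv> {y. (x, y) \<in> R}"
  shows "S \<in> sets borel" "measure D S = q x * mean x"
    and "x \<in> cube a b \<Longrightarrow> eps0 * r ^ CARD('n) \<le> measure D S"
    and "measure D S \<le> eps_inf * (2 * r) ^ CARD('n)"
proof -
  show S: "S \<in> sets borel"
    using sets_Pair1[OF R_measurable, of x] by (simp add: S_def vimage_def)
  have mean: "mean x = measure D S / q x"
  proof -
    have "mean x = (\<integral>y. indicator S y / q x \<partial>D)"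
      unfolding mean_def by (intro Bochner_Integration.integral_cong) (auto simp: S_def indicator_def)
    then show ?thesis using S by simp
  qed
  then show eq: "measure D S = q x * mean x" using q_pos[of x] by simp
  have S': "measure D S = (\<integral>y. indicator S y \<partial>D)" using S by simp
  have "measure D S \<le> eps_inf * (\<integral>y. near r x y \<partial>\<mu>)"
    unfolding S' using S
    by (intro integral_D_le mu.integrable_bounded'[of _ 1]) (auto simp: S_def R_def near_def indicator_def)
  also have "\<dots> \<le> eps_inf * (2 * r) ^ CARD('n)"
    using r eps0 eps_inf by (intro mult_left_mono integral_near_le) auto
  finally show "measure D S \<le> eps_inf * (2 * r) ^ CARD('n)" .
  assume x: "x \<in> cube a b"
  have "eps0 * r ^ CARD('n) \<le> eps0 * measure lborel (cube a b \<inter> {y. infnorm (x - y) \<le> r})"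
    using truncated_ball_volume(1)[OF r x] eps0 by (intro mult_left_mono) auto
  also have "cube a b \<inter> {y. infnorm (x - y) \<le> r} = S" using x by (auto simp: S_def R_def)
  also have "measure lborel S = (\<integral>y. indicator S y \<partial>\<mu>)"
    using S by (simp add: measure_cube_lborel) (auto intro!: arg_cong[where f = "measure lborel"] simp: S_def R_def)
  also have "eps0 * \<dots> = (\<integral>y. eps0 * indicator S y \<partial>\<mu>)" by simp
  also have "\<dots> \<le> (\<integral>y. f y * indicator S y \<partial>\<mu>)"
  proof (rule integral_mono)
    show "integrable \<mu> (\<lambda>y. eps0 * indicator S y)"
      using S by (intro mu.integrable_bounded'[of _ eps0]) (use eps0 in \<open>auto simp: indicator_def\<close>)
    show "integrable \<mu> (\<lambda>y. f y * indicator S y)"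
      using S f_le eps0 eps_inf by (intro mu.integrable_bounded'[of _ eps_inf]) (auto simp: indicator_def)
    show "eps0 * indicator S y \<le> f y * indicator S y" for y
      using f_bounds[of y] by (auto simp: S_def R_def indicator_def)
  qed
  also have "\<dots> = measure D S" unfolding S' using S by (subst integral_D) auto
  finally show "eps0 * r ^ CARD('n) \<le> measure D S" .
qed

text \<open>
  The first term comes from the tails of the count, the second from its variance, the third from
  the index that is missing when one point is left out, and the last from the step \<open>1 / (m * q x)\<close> of the
  difference quotients. The bias \<open>mean x - f x\<close> is kept apart, as it is small only on average over
  \<open>x\<close>.
\<close>
definition "err = 18 * k\<^sup>2 * B\<^sup>2 * exp (- (\<tau>1 * k))
  + 2 * L\<^sup>2 * (eps_inf * two_pow\<^sup>2 / k + 2 * (two_pow * eps_inf / real m)\<^sup>2) + 2 * L\<^sup>2 * two_pow\<^sup>2 / k\<^sup>2"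

text \<open>
  The count at a point \<open>x\<close> of the cube is binomial, with an expectation between constant multiples of
  \<open>k\<close>. The two values of \<open>card J\<close> correspond to the full sample and to the sample without one
  point.
\<close>
lemma counting_error:
  fixes I J :: "'i set"
  assumes x: "x \<in> cube a b" and I: "finite I" "J \<subseteq> I" and J: "m - 1 \<le> card J" "card J \<le> m"
    and bd: "\<And>n. n \<le> card J \<Longrightarrow> \<bar>\<phi> n\<bar> \<le> 3 * k * B"
    and good: "\<And>n. n \<le> card J \<Longrightarrow> \<tau>1 * k < real n \<Longrightarrow> real n < 3 * eps_inf * k \<Longrightarrow>
       \<bar>\<phi> n\<bar> \<le> L * (\<bar>real n / (real m * q x) - f x\<bar> + two_pow / k)"
  shows "(\<integral>\<xi>. (\<phi> (count_in R J x \<xi>))\<^sup>2 \<partial>PiM I (\<lambda>_. D)) \<le> err + 4 * L\<^sup>2 * (mean x - f x)\<^sup>2"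
proof -
  define S where "S = {y. (x, y) \<in> R}"
  define p where "p = measure D S"
  define s where "s = real m * q x"
  have S: "S \<in> sets D" using neighbourhood_prob(1)[of x] by (simp add: S_def)
  have s: "0 < s" "k / two_pow \<le> s" using mq(1)[of x] q_pos[of x] m by (auto simp: s_def)
  have M0: "0 < real m" using m by simp
  have mp: "eps0 / two_pow * k \<le> real m * p" "real m * p \<le> eps_inf * k"
  proof -
    have "k = real m * (two_pow * r ^ CARD('n))" using volume m unfolding rd(2) by (simp add: field_simps)
    then have "eps0 / two_pow * k = real m * (eps0 * r ^ CARD('n))" using two_pow by (simp add: field_simps)
    then show "eps0 / two_pow * k \<le> real m * p"
      using neighbourhood_prob(3)[OF x] by (simp add: p_def S_def mult_left_mono)
    have "real m * p \<le> real m * (eps_inf * (2 * r) ^ CARD('n))"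
      using neighbourhood_prob(4)[of x] unfolding p_def S_def by (intro mult_left_mono) auto
    also have "\<dots> = eps_inf * k" unfolding volume using m by simp
    finally show "real m * p \<le> eps_inf * k" .
  qed
  have p0: "0 \<le> p" by (simp add: p_def)
  have cJ: "real m / 2 \<le> real (card J)" "real (card J) \<le> real m" "real m - 1 \<le> real (card J)" using J m by auto
  have lo: "\<tau>1 * k - real (card J) * p * (1 - exp (-1)) \<le> - (\<tau>1 * k)"
  proof -
    have "2 \<le> exp (1::real)" using exp_ge_add_one_self[of "1::real"] by simp
    then have e: "1 / 2 \<le> 1 - exp (-1::real)" by (simp add: exp_minus field_simps)
    \<comment> \<open>the factor \<open>8\<close> in \<open>\<tau>1\<close> is \<open>2 * 2 * 2\<close>: one factor each for \<open>card J \<ge> m / 2\<close>, for \<open>1 - exp (-1) \<ge> 1 / 2\<close>, and for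
        keeping \<open>- \<tau>1 * k\<close> as exponent\<close>
    have "2 * (\<tau>1 * k) = (eps0 / two_pow * k) / 2 * (1 / 2)" by (simp add: tau_def)
    also have "\<dots> \<le> (real m * p) / 2 * (1 / 2)" using mp(1) by simp
    also have "\<dots> \<le> (real (card J) * p) * (1 - exp (-1))"
      using mult_right_mono[OF cJ(1) p0] e p0 by (intro mult_mono) auto
    finally show ?thesis by linarith
  qed
  have hi: "real (card J) * p * (exp 1 - 1) - 3 * eps_inf * k \<le> - (\<tau>1 * k)"
  proof -
    have "real (card J) * p * (exp 1 - 1) \<le> eps_inf * k * 2"
    proof (rule mult_mono)
      show "real (card J) * p \<le> eps_inf * k" using mult_right_mono[OF cJ(2) p0] mp(2) by linarith
      show "exp 1 - 1 \<le> (2::real)" using exp_le by linarith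
    qed (use eps0 eps_inf k in auto)
    moreover have "\<tau>1 * k \<le> eps_inf * k" using tau_bounds eps_inf k by (intro mult_right_mono) auto
    ultimately show ?thesis by linarith
  qed
  have "(\<integral>\<xi>. (\<phi> (card {j \<in> J. \<xi> j \<in> S}))\<^sup>2 \<partial>PiM I (\<lambda>_. D))
    \<le> (3 * k * B)\<^sup>2 * (exp (\<tau>1 * k - real (card J) * p * (1 - exp (-1))) + exp (real (card J) * p * (exp 1 - 1) - 3 * eps_inf * k))
      + 2 * L\<^sup>2 * (real (card J) * p / s\<^sup>2 + (real (card J) * p / s - f x)\<^sup>2) + 2 * L\<^sup>2 * two_pow\<^sup>2 / k\<^sup>2"
    unfolding p_def
  proof (rule D.hits_functional_error[OF S I bd])
    fix n assume n: "n \<le> card J" "\<tau>1 * k < real n" "real n < 3 * eps_inf * k"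
    let ?u = "\<bar>real n / s - f x\<bar>"
    have "(\<phi> n)\<^sup>2 \<le> (L * (?u + two_pow / k))\<^sup>2"
    proof -
      have "0 \<le> L * (?u + two_pow / k)" using L two_pow k by (intro mult_nonneg_nonneg add_nonneg_nonneg divide_nonneg_nonneg) auto
      then show ?thesis
        using good[OF n] unfolding s_def[symmetric] abs_le_square_iff[symmetric] by linarith
    qed
    also have "\<dots> = L\<^sup>2 * (?u + two_pow / k)\<^sup>2" by (simp add: power_mult_distrib)
    also have "\<dots> \<le> L\<^sup>2 * (2 * ?u\<^sup>2 + 2 * (two_pow / k)\<^sup>2)"
      by (intro mult_left_mono power2_sum_le) auto
    finally show "(\<phi> n)\<^sup>2 \<le> 2 * L\<^sup>2 * (real n / s - f x)\<^sup>2 + 2 * L\<^sup>2 * two_pow\<^sup>2 / k\<^sup>2"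
      by (simp add: distrib_left power_divide mult_ac)
  qed (use s in auto)
  also have "\<dots> \<le> (3 * k * B)\<^sup>2 * (exp (- (\<tau>1 * k)) + exp (- (\<tau>1 * k)))
      + 2 * L\<^sup>2 * (eps_inf * two_pow\<^sup>2 / k + (2 * (mean x - f x)\<^sup>2 + 2 * (two_pow * eps_inf / real m)\<^sup>2)) + 2 * L\<^sup>2 * two_pow\<^sup>2 / k\<^sup>2"
  proof (intro add_mono mult_left_mono order_refl)
    show "exp (\<tau>1 * k - real (card J) * p * (1 - exp (-1))) \<le> exp (- (\<tau>1 * k))" using lo by simp
    show "exp (real (card J) * p * (exp 1 - 1) - 3 * eps_inf * k) \<le> exp (- (\<tau>1 * k))" using hi by simp
    have "real (card J) * p / s\<^sup>2 \<le> (eps_inf * k) / (k / two_pow)\<^sup>2"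
    proof (intro frac_le)
      show "real (card J) * p \<le> eps_inf * k" using mult_right_mono[OF cJ(2) p0] mp(2) by linarith
      show "(k / two_pow)\<^sup>2 \<le> s\<^sup>2" using s k two_pow by (intro power_mono) auto
    qed (use eps0 eps_inf k two_pow in auto)
    also have "\<dots> = eps_inf * two_pow\<^sup>2 / k" using k two_pow by (simp add: power2_eq_square)
    finally show "real (card J) * p / s\<^sup>2 \<le> eps_inf * two_pow\<^sup>2 / k" .
    have mean: "mean x = p / q x" using neighbourhood_prob(2)[of x] q_pos[of x] by (simp add: p_def S_def)
    \<comment> \<open>the change of the expected estimate when one of the \<open>m\<close> points is missing\<close>
    define \<theta> where "\<theta> = (real m - real (card J)) / real m * mean x"
    have "real (card J) * p / s = mean x - \<theta>"
      using M0 q_pos[of x] by (simp add: mean \<theta>_def s_def field_simps)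
    moreover have "\<bar>\<theta>\<bar> \<le> two_pow * eps_inf / real m"
    proof -
      have "\<bar>\<theta>\<bar> = (real m - real (card J)) * mean x / real m"
        using cJ M0 mean_nonneg[of x] by (simp add: \<theta>_def abs_mult)
      also have "\<dots> \<le> 1 * (two_pow * eps_inf) / real m"
        using cJ mass_target[of x] mean_nonneg[of x] M0 by (intro divide_right_mono mult_mono) auto
      finally show ?thesis by simp
    qed
    moreover have "(mean x - \<theta> - f x)\<^sup>2 \<le> 2 * (mean x - f x)\<^sup>2 + 2 * \<theta>\<^sup>2"
      using power2_sum_le[of "mean x - f x" "- \<theta>"] by (simp add: algebra_simps)
    moreover have "\<theta>\<^sup>2 \<le> (two_pow * eps_inf / real m)\<^sup>2"
      using calculation(2) unfolding abs_le_square_iff[symmetric] by linarith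
    ultimately show "(real (card J) * p / s - f x)\<^sup>2 \<le> 2 * (mean x - f x)\<^sup>2 + 2 * (two_pow * eps_inf / real m)\<^sup>2"
      by simp
  qed auto
  also have "\<dots> = err + 4 * L\<^sup>2 * (mean x - f x)\<^sup>2"
    by (simp add: err_def algebra_simps power_mult_distrib)
  finally show ?thesis unfolding count_in_def S_def by simp
qed

lemma ratio_in_range:
  assumes "\<tau>1 * k < real n" "real n < 3 * eps_inf * k"
  shows "real n / (real m * q x) \<in> {\<tau>1..\<tau>2}" "real (Suc n) / (real m * q x) \<in> {\<tau>1..\<tau>2}"
    and "1 / (real m * q x) \<le> two_pow / k"
proof -
  define s where "s = real m * q x"
  have s: "0 < s" "k / two_pow \<le> s" "s \<le> k" using mq[of x] q_pos[of x] m by (auto simp: s_def)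
  have "\<tau>1 * s \<le> \<tau>1 * k" using s tau_bounds by (intro mult_left_mono) auto
  then have lo: "\<tau>1 \<le> real n / s" using assms s by (simp add: pos_le_divide_eq)
  have "k \<le> two_pow * s" using s two_pow by (simp add: field_simps)
  show "1 / (real m * q x) \<le> two_pow / k" using \<open>k \<le> two_pow * s\<close> s k unfolding s_def[symmetric] by (simp add: field_simps)
  have "real (Suc n) \<le> 3 * eps_inf * k + 1 * k" using assms k by simp
  also have "\<dots> = (3 * eps_inf + 1) * k" by (simp add: algebra_simps)
  also have "\<dots> \<le> (3 * eps_inf + 1) * (two_pow * s)" using \<open>k \<le> two_pow * s\<close> eps0 eps_inf by (intro mult_left_mono) auto
  finally have "real (Suc n) / s \<le> \<tau>2" using s by (simp add: tau_def pos_divide_le_eq algebra_simps)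
  moreover have "real n / s \<le> real (Suc n) / s" using s by (simp add: divide_right_mono)
  ultimately show "real n / (real m * q x) \<in> {\<tau>1..\<tau>2}" "real (Suc n) / (real m * q x) \<in> {\<tau>1..\<tau>2}"
    using lo unfolding s_def[symmetric] by auto
qed

lemma B0: "0 < B" using L B by linarith

lemma kB: "B \<le> k * B" "L \<le> k * B"
proof -
  show "B \<le> k * B" using mult_right_mono[OF k, of B] B0 by simp
  then show "L \<le> k * B" using B by simp
qed

lemma plug_in_pointwise_error:
  fixes I J :: "'i set"
  assumes I: "finite I" "J \<subseteq> I" "card J = m"
  shows "(\<integral>\<xi>. (h (count_in R J x \<xi>) x - \<psi> x)\<^sup>2 \<partial>PiM I (\<lambda>_. D)) \<le> err + 4 * L\<^sup>2 * (mean x - f x)\<^sup>2"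
proof (cases "x \<in> cube a b")
  case x: True
  show ?thesis
  proof (rule counting_error[OF x I(1,2), where \<phi> = "\<lambda>n. h n x - \<psi> x"])
    fix n assume n: "n \<le> card J"
    show "\<bar>h n x - \<psi> x\<bar> \<le> 3 * k * B"
      using range_bound[OF x, of n] g_bounded[OF x density_in_range[OF x]] n I kB x B0
      unfolding h_def \<psi>_def if_P[OF x] by linarith
    assume "\<tau>1 * k < real n" "real n < 3 * eps_inf * k"
    note in_range = ratio_in_range(1)[OF this, of x]
    have "\<bar>h n x - \<psi> x\<bar> \<le> L * \<bar>real n / (real m * q x) - f x\<bar>"
      unfolding h_def \<psi>_def if_P[OF x]
      by (rule g_lipschitz[OF x density_in_range[OF x] in_range])
    also have "\<dots> \<le> L * (\<bar>real n / (real m * q x) - f x\<bar> + two_pow / k)"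
      using L two_pow k by (intro mult_left_mono) auto
    finally show "\<bar>h n x - \<psi> x\<bar> \<le> L * (\<bar>real n / (real m * q x) - f x\<bar> + two_pow / k)" .
  qed (use I in auto)
next
  case False
  then show ?thesis using B0 L eps0 eps_inf k by (auto simp: h_def \<psi>_def err_def)
qed

lemma slope_pointwise_error:
  fixes I J :: "'i set"
  assumes I: "finite I" "J \<subseteq> I" "card J = m - 1"
  shows "(\<integral>\<xi>. (real m * q x * (h (Suc (count_in R J x \<xi>)) x - h (count_in R J x \<xi>) x) - w x)\<^sup>2 \<partial>PiM I (\<lambda>_. D))
    \<le> err + 4 * L\<^sup>2 * (mean x - f x)\<^sup>2"
proof (cases "x \<in> cube a b")
  case x: True
  define s where "s = real m * q x"
  have s: "0 < s" "s \<le> k" using mq[of x] q_pos[of x] m by (auto simp: s_def)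
  show ?thesis
  proof (rule counting_error[OF x I(1,2), where \<phi> = "\<lambda>n. real m * q x * (h (Suc n) x - h n x) - w x"])
    fix n assume n: "n \<le> card J"
    have n': "Suc n \<le> m" "n \<le> m" using n I m by auto
    have "\<bar>h (Suc n) x - h n x\<bar> \<le> 2 * B"
      using range_bound[OF x n'(1)] range_bound[OF x n'(2)] x unfolding h_def if_P[OF x] by linarith
    then have "\<bar>s * (h (Suc n) x - h n x)\<bar> \<le> k * (2 * B)"
      unfolding abs_mult using s k by (intro mult_mono) auto
    moreover have "\<bar>w x\<bar> \<le> L"
      using g_bounded[OF x density_in_range[OF x]] w_eq[OF x] by simp
    ultimately show "\<bar>real m * q x * (h (Suc n) x - h n x) - w x\<bar> \<le> 3 * k * B"
      using kB unfolding s_def[symmetric] by linarith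
    assume "\<tau>1 * k < real n" "real n < 3 * eps_inf * k"
    note in_range = ratio_in_range[OF this, of x, folded s_def]
    have eq: "real n / s + 1 / s = real (Suc n) / s" by (simp add: add_divide_distrib)
    have "\<bar>(g (real n / s + 1 / s) x - g (real n / s) x) / (1 / s) - g' (f x) x\<bar>
        \<le> L * (\<bar>real n / s - f x\<bar> + 1 / s)"
    proof (rule difference_quotient_error[where F = "\<lambda>t. g t x" and F' = "\<lambda>t. g' t x"])
      show "((\<lambda>t. g t x) has_real_derivative g' t x) (at t)" if "t \<in> {\<tau>1..\<tau>2}" for t
        using derivative[OF x that] .
      show "\<bar>g' t x - g' (f x) x\<bar> \<le> L * \<bar>t - f x\<bar>" if "t \<in> {\<tau>1..\<tau>2}" for t
        using g'_lipschitz[OF x density_in_range[OF x] that] .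
      show "real n / s \<in> {\<tau>1..\<tau>2}" "real n / s + 1 / s \<in> {\<tau>1..\<tau>2}"
        using in_range(1,2) unfolding eq .
    qed (use L s in auto)
    also have "\<dots> \<le> L * (\<bar>real n / s - f x\<bar> + two_pow / k)"
      using L in_range(3) by (intro mult_left_mono add_left_mono) auto
    finally show "\<bar>real m * q x * (h (Suc n) x - h n x) - w x\<bar> \<le> L * (\<bar>real n / (real m * q x) - f x\<bar> + two_pow / k)"
      unfolding eq h_def if_P[OF x] w_eq[OF x] s_def[symmetric] by (simp add: mult.commute)
  qed (use I m in auto)
next
  case False
  then show ?thesis using B0 L eps0 eps_inf k by (auto simp: h_def w_outside err_def)
qed

definition "smoothing_err = (\<integral>y. ((\<integral>x. indicator R (x, y) / q x * w x \<partial>D) - \<Phi> y)\<^sup>2 \<partial>D)"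
definition "total_err = err + 4 * L\<^sup>2 * (\<integral>x. (mean x - f x)\<^sup>2 \<partial>D)"

lemma integrate_pointwise_error:
  assumes "\<And>x. F x \<le> err + 4 * L\<^sup>2 * (mean x - f x)\<^sup>2"
  shows "(\<integral>x. F x \<partial>D) \<le> total_err"
proof -
  have "integrable D (\<lambda>x. (mean x - f x)\<^sup>2)"
  proof (rule D.integrable_square_bounded[of _ "two_pow * eps_inf + eps_inf"])
    fix x show "\<bar>mean x - f x\<bar> \<le> two_pow * eps_inf + eps_inf"
      using mean_nonneg[of x] mass_target[of x] f_le[of x] by linarith
  qed measurable
  moreover have "0 \<le> err" using B0 L eps0 eps_inf k by (auto simp: err_def)
  ultimately have "(\<integral>x. F x \<partial>D) \<le> (\<integral>x. err + 4 * L\<^sup>2 * (mean x - f x)\<^sup>2 \<partial>D)"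
    using assms by (intro integral_mono') auto
  also have "\<dots> = total_err"
    using \<open>integrable D (\<lambda>x. (mean x - f x)\<^sup>2)\<close> by (simp add: total_err_def D.prob_space[unfolded space_D])
  finally show ?thesis .
qed

text \<open>
  An instance of \<open>variance_linearisation_error\<close>. The same bound \<open>total_err\<close> serves for the plug-in error
  and for the slope error, because both are functions of a count as in \<open>counting_error\<close>.
\<close>
theorem linearisation_variance:
  fixes A J :: "'i set"
  assumes A: "finite A" "A \<noteq> {}" and J: "finite J" "card J = m" "A \<inter> J = {}"
  shows "prob_space.variance (PiM (A \<union> J) (\<lambda>_. D))
      (\<lambda>\<xi>. (\<Sum>i\<in>A. h (count_in R J (\<xi> i) \<xi>) (\<xi> i)) / real (card A)
        - ((\<Sum>i\<in>A. \<psi> (\<xi> i)) / real (card A) + (\<Sum>j\<in>J. \<Phi> (\<xi> j)) / real m))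
    \<le> 2 * total_err / real (card A) + (4 * (two_pow * eps_inf)\<^sup>2 * total_err + 4 * smoothing_err) / real m"
proof -
  define C where "C = Max {B, L, eps_inf * L, (2 * r) ^ CARD('n), 1 / r ^ CARD('n)}"
  have C: "B \<le> C" "L \<le> C" "eps_inf * L \<le> C" "(2 * r) ^ CARD('n) \<le> C" "1 / r ^ CARD('n) \<le> C"
    unfolding C_def by (intro Max_ge; simp)+
  interpret ks: kernel_statistic D R q w \<psi> \<Phi> h A J C "two_pow * eps_inf" total_err total_err smoothing_err
  proof
    show "R \<in> sets (D \<Otimes>\<^sub>M D)" using R_measurable by (simp cong: sets_pair_measure_cong)
    show "q x \<le> C" "1 / q x \<le> C" "0 < q x" for x
    proof -
      show "0 < q x" by (rule q_pos)
      show "q x \<le> C" using q[of x] C by linarith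
      have "1 / q x \<le> 1 / r ^ CARD('n)" using q[of x] rd by (intro divide_left_mono) (auto simp: q_pos)
      then show "1 / q x \<le> C" using C by linarith
    qed
    show "\<bar>w x\<bar> \<le> C" for x using w_le[of x] C by linarith
    show "\<bar>\<psi> x\<bar> \<le> C" for x using psi_le[of x] C by linarith
    show "\<bar>\<Phi> x\<bar> \<le> C" for x using Phi_le[of x] C by linarith
    show "\<bar>h n x\<bar> \<le> C" if "n \<le> card J" for n x
      using range_bound[of x n] that J C B0 by (cases "x \<in> cube a b") (auto simp: h_def)
    show "0 < two_pow * eps_inf" using two_pow eps0 eps_inf by auto
    show "(\<integral>x. indicator R (x, y) / q x \<partial>D) \<le> two_pow * eps_inf" for y by (rule mass_source)
    show "(\<integral>y. indicator R (x, y) / q x \<partial>D) \<le> two_pow * eps_inf" for x using mass_target by (simp add: mean_def)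
    show "(\<integral>x. (\<integral>\<xi>. (h (count_in R J x \<xi>) x - \<psi> x)\<^sup>2 \<partial>PiM (A \<union> J) (\<lambda>_. D)) \<partial>D) \<le> total_err"
      using A J by (intro integrate_pointwise_error plug_in_pointwise_error) auto
    show "(\<integral>x. (\<integral>\<xi>. (real (card J) * q x * (h (Suc (count_in R (J - {j}) x \<xi>)) x - h (count_in R (J - {j}) x \<xi>) x)
         - w x)\<^sup>2 \<partial>PiM (A \<union> J) (\<lambda>_. D)) \<partial>D) \<le> total_err" if "j \<in> J" for j
      unfolding J(2) using A J that by (intro integrate_pointwise_error slope_pointwise_error) auto
    show "(\<integral>y. ((\<integral>x. indicator R (x, y) / q x * w x \<partial>D) - \<Phi> y)\<^sup>2 \<partial>D) \<le> smoothing_err"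
      by (simp add: smoothing_err_def)
    show "q \<in> borel_measurable D" "w \<in> borel_measurable D" "\<psi> \<in> borel_measurable D"
      "\<Phi> \<in> borel_measurable D" "h n \<in> borel_measurable D" for n
      by measurable
    show "finite A" "finite J" "A \<inter> J = {}" "A \<noteq> {}" "J \<noteq> {}"
      using A J m by auto
  qed
  show ?thesis using ks.variance_linearisation_error J by simp
qed

text \<open>
  The difference is bounded, so its square is at most a multiple of its absolute value; and the
  density is bounded, so an integral over \<open>D\<close> is at most a multiple of the one over the cube. The
  next lemma is proved in the same way.
\<close>
lemma smoothing_err_le:
  "smoothing_err \<le> eps_inf * (two_pow * eps_inf * L + eps_inf * L) *
    (\<integral>y. \<bar>(\<integral>x. near r x y / q x * \<Phi> x \<partial>\<mu>) - \<Phi> y\<bar> \<partial>\<mu>)"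
proof -
  define T where "T y = (\<integral>x. near r x y / q x * \<Phi> x \<partial>\<mu>)" for y
  have [measurable]: "T \<in> borel_measurable borel"
  proof -
    have "(\<lambda>y. \<integral>x. near r x y / q x * \<Phi> x \<partial>\<mu>) \<in> borel_measurable borel"
      by (rule mu.borel_measurable_lebesgue_integral) measurable
    then show ?thesis unfolding T_def[abs_def] .
  qed
  have TL: "\<bar>T y\<bar> \<le> two_pow * eps_inf * L" for y
  proof -
    have "\<bar>T y\<bar> \<le> (\<integral>x. \<bar>near r x y / q x * \<Phi> x\<bar> \<partial>\<mu>)" unfolding T_def by (rule integral_abs_bound)
    also have "\<dots> \<le> (\<integral>x. near r y x / r ^ CARD('n) * (eps_inf * L) \<partial>\<mu>)"
    proof (rule integral_mono')
      show "integrable \<mu> (\<lambda>x. near r y x / r ^ CARD('n) * (eps_inf * L))"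
        using near_integral_le(2) by (rule integrable_mult_left)
      fix x
      have "\<bar>near r x y / q x\<bar> \<le> near r y x / r ^ CARD('n)"
        using near_over_q_le[of x y] q_pos[of x] unfolding near_sym[of r y x] by simp
      then show "\<bar>near r x y / q x * \<Phi> x\<bar> \<le> near r y x / r ^ CARD('n) * (eps_inf * L)"
        unfolding abs_mult[of "near r x y / q x"] using Phi_le[of x] rd by (intro mult_mono) auto
    qed (use rd eps0 eps_inf L in auto)
    also have "\<dots> = (\<integral>x. near r y x / r ^ CARD('n) \<partial>\<mu>) * (eps_inf * L)" by (rule integral_mult_left_zero)
    also have "\<dots> \<le> two_pow * (eps_inf * L)"
      using near_integral_le(1) eps0 eps_inf L by (intro mult_right_mono) auto
    finally show ?thesis by (simp add: mult.assoc)
  qed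
  have eq: "(\<integral>x. indicator R (x, y) / q x * w x \<partial>D) = T y" if y: "y \<in> cube a b" for y
  proof -
    have "(\<integral>x. indicator R (x, y) / q x * w x \<partial>D) = (\<integral>x. f x * (indicator R (x, y) / q x * w x) \<partial>\<mu>)"
      by (rule integral_D) measurable
    also have "\<dots> = T y"
      unfolding T_def \<Phi>_def by (intro Bochner_Integration.integral_cong) (auto simp: indicator_R y f_outside)
    finally show ?thesis .
  qed
  have TP: "\<bar>T y - \<Phi> y\<bar> \<le> two_pow * eps_inf * L + eps_inf * L" for y
    using TL[of y] Phi_le[of y] by linarith
  have "smoothing_err \<le> eps_inf * (\<integral>y. (two_pow * eps_inf * L + eps_inf * L) * \<bar>T y - \<Phi> y\<bar> \<partial>\<mu>)"
    unfolding smoothing_err_def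
  proof (rule integral_D_le)
    have "(\<lambda>y. \<integral>x. indicator R (x, y) / q x * w x \<partial>D) \<in> borel_measurable borel"
      by (rule D.borel_measurable_lebesgue_integral) measurable
    then show "(\<lambda>y. ((\<integral>x. indicator R (x, y) / q x * w x \<partial>D) - \<Phi> y)\<^sup>2) \<in> borel_measurable borel" by measurable
    show "integrable \<mu> (\<lambda>y. (two_pow * eps_inf * L + eps_inf * L) * \<bar>T y - \<Phi> y\<bar>)"
      using TP by (intro integrable_mult_right mu.integrable_bounded'[of _ "two_pow * eps_inf * L + eps_inf * L"]) auto
    fix y :: "real ^ 'n" assume "y \<in> cube a b"
    then show "0 \<le> ((\<integral>x. indicator R (x, y) / q x * w x \<partial>D) - \<Phi> y)\<^sup>2 \<and>
        ((\<integral>x. indicator R (x, y) / q x * w x \<partial>D) - \<Phi> y)\<^sup>2 \<le> (two_pow * eps_inf * L + eps_inf * L) * \<bar>T y - \<Phi> y\<bar>"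
      using mult_right_mono[OF TP[of y], of "\<bar>T y - \<Phi> y\<bar>"]
      unfolding eq[OF \<open>y \<in> cube a b\<close>] by (simp add: power2_eq_square flip: abs_mult)
  qed
  then show ?thesis by (simp add: T_def mult.assoc)
qed

lemma bias_le:
  "(\<integral>x. (mean x - f x)\<^sup>2 \<partial>D) \<le> eps_inf * (two_pow * eps_inf + eps_inf) *
    (\<integral>x. \<bar>(\<integral>y. near r x y / q x * f y \<partial>\<mu>) - f x\<bar> \<partial>\<mu>)"
proof -
  have mf: "\<bar>mean x - f x\<bar> \<le> two_pow * eps_inf + eps_inf" for x
    using mean_nonneg[of x] mass_target[of x] f_le[of x] by linarith
  have eq: "(\<integral>y. near r x y / q x * f y \<partial>\<mu>) = mean x" if x: "x \<in> cube a b" for x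
  proof -
    have "mean x = (\<integral>y. f y * (indicator R (x, y) / q x) \<partial>\<mu>)"
      unfolding mean_def by (rule integral_D) measurable
    also have "\<dots> = (\<integral>y. near r x y / q x * f y \<partial>\<mu>)"
      by (intro Bochner_Integration.integral_cong) (auto simp: indicator_R x f_outside)
    finally show ?thesis by simp
  qed
  have "(\<integral>x. (mean x - f x)\<^sup>2 \<partial>D) \<le> eps_inf * (\<integral>x. (two_pow * eps_inf + eps_inf) * \<bar>mean x - f x\<bar> \<partial>\<mu>)"
  proof (rule integral_D_le)
    show "integrable \<mu> (\<lambda>x. (two_pow * eps_inf + eps_inf) * \<bar>mean x - f x\<bar>)"
      using mf by (intro integrable_mult_right mu.integrable_bounded'[of _ "two_pow * eps_inf + eps_inf"]) auto
    fix x
    show "0 \<le> (mean x - f x)\<^sup>2 \<and> (mean x - f x)\<^sup>2 \<le> (two_pow * eps_inf + eps_inf) * \<bar>mean x - f x\<bar>"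
      using mult_right_mono[OF mf[of x], of "\<bar>mean x - f x\<bar>"] by (simp add: power2_eq_square flip: abs_mult)
  qed measurable
  also have "\<dots> = eps_inf * (two_pow * eps_inf + eps_inf) * (\<integral>x. \<bar>mean x - f x\<bar> \<partial>\<mu>)" by simp
  also have "(\<integral>x. \<bar>mean x - f x\<bar> \<partial>\<mu>) = (\<integral>x. \<bar>(\<integral>y. near r x y / q x * f y \<partial>\<mu>) - f x\<bar> \<partial>\<mu>)"
  proof (rule integral_cong_AE)
    have "(\<lambda>x. \<integral>y. near r x y / q x * f y \<partial>\<mu>) \<in> borel_measurable borel"
      by (rule mu.borel_measurable_lebesgue_integral) measurable
    then show "(\<lambda>x. \<bar>(\<integral>y. near r x y / q x * f y \<partial>\<mu>) - f x\<bar>) \<in> borel_measurable \<mu>" by simp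
    show "AE x in \<mu>. \<bar>mean x - f x\<bar> = \<bar>(\<integral>y. near r x y / q x * f y \<partial>\<mu>) - f x\<bar>"
      using AE_cube_lborel by eventually_elim (simp only: eq)
  qed simp
  finally show ?thesis .
qed

lemma bandwidth_eq: "(k / real m) powr (1 / real CARD('n)) / 2 = r"
proof -
  have "(k / real m) powr (1 / real CARD('n)) = ((2 * r) powr real CARD('n)) powr (1 / real CARD('n))"
    using r by (simp add: volume[symmetric] powr_realpow)
  also have "\<dots> = 2 * r" using r by (simp add: powr_powr)
  finally show ?thesis by simp
qed

lemma kernel_region_stage:
  fixes x :: "real ^ 'n"
  shows "kernel_region (cube a b) k m x = {y \<in> cube a b. infnorm (x - y) \<le> r}"
  unfolding kernel_region_def bandwidth_eq ..

definition "statistic N \<xi> = (\<Sum>i\<in>{1..N}. h (count_in R {N + 1..N + m} (\<xi> i) \<xi>) (\<xi> i)) / real N"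

lemma statistic_measurable:
  "statistic N \<in> borel_measurable (PiM {1..N + m} (\<lambda>_. borel))"
proof -
  have "(\<lambda>\<xi>. h (count_in R {N + 1..N + m} (\<xi> i) \<xi>) (\<xi> i)) \<in> borel_measurable (PiM {1..N + m} (\<lambda>_. borel))"
    if "i \<in> {1..N}" for i
  proof -
    have [measurable]: "(\<lambda>\<xi>. \<xi> i) \<in> measurable (PiM {1..N + m} (\<lambda>_. borel)) borel" using that by simp
    have [measurable]: "(\<lambda>\<xi>. count_in R {N + 1..N + m} (\<xi> i) \<xi>)
        \<in> measurable (PiM {1..N + m} (\<lambda>_. borel)) (count_space UNIV)"
    proof (rule measurable_count_in[OF R_measurable])
      show "(\<lambda>\<xi>. \<xi> j) \<in> measurable (PiM {1..N + m} (\<lambda>_. borel)) borel" if "j \<in> {N + 1..N + m}" for j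
        by (rule measurable_component_singleton) (use that in auto)
    qed measurable
    show ?thesis by (rule measurable_compose_countable) measurable
  qed
  then show ?thesis unfolding statistic_def[abs_def] by (intro borel_measurable_divide borel_measurable_sum) auto
qed

lemma statistic_bounded:
  assumes "1 \<le> N"
  shows "\<bar>statistic N \<xi>\<bar> \<le> B"
proof -
  have "\<bar>h (count_in R {N + 1..N + m} (\<xi> i) \<xi>) (\<xi> i)\<bar> \<le> B" for i
  proof -
    have "count_in R {N + 1..N + m} (\<xi> i) \<xi> \<le> m"
      using count_in_le[of "{N + 1..N + m}" R "\<xi> i" \<xi>] by simp
    then show ?thesis using range_bound[of "\<xi> i"] B0 by (auto simp: h_def)
  qed
  then have "\<bar>\<Sum>i\<in>{1..N}. h (count_in R {N + 1..N + m} (\<xi> i) \<xi>) (\<xi> i)\<bar> \<le> (\<Sum>i\<in>{1..N}. B)"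
    by (intro order_trans[OF sum_abs] sum_mono)
  then show ?thesis using assms by (simp add: statistic_def divide_simps mult.commute)
qed

text \<open>
  The sample points lie in the cube almost surely. This allows replacing the functional by \<open>0\<close>
  outside the cube, where nothing is known about \<open>g\<close>, and passing to the product measure.
\<close>
lemma variance_plug_in_eq:
  fixes X :: "nat \<Rightarrow> 'w \<Rightarrow> real ^ 'n"
  assumes X: "iid_sample P X f" and q0 [measurable]: "q0 \<in> borel_measurable borel"
    and q0_eq: "\<And>x. x \<in> cube a b \<Longrightarrow> q0 x = q x" and N: "1 \<le> N"
  shows "prob_space.variance P (\<lambda>\<zeta>. plug_in g (kde_with_volume q0 (cube a b) k N m (\<lambda>i. X i \<zeta>)) N (\<lambda>i. X i \<zeta>))
    = prob_space.variance (PiM {1..N + m} (\<lambda>_. D)) (statistic N)"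
proof -
  interpret P: prob_space P using X by (simp add: iid_sample_def)
  let ?I = "{1..N + m}"
  let ?res = "\<lambda>\<zeta>. \<lambda>i\<in>?I. X i \<zeta>"
  let ?W = "\<lambda>\<zeta>. plug_in g (kde_with_volume q0 (cube a b) k N m (\<lambda>i. X i \<zeta>)) N (\<lambda>i. X i \<zeta>)"
  have distrD: "distributed P lborel (X i) (\<lambda>x. ennreal (f x))" if "i \<in> ?I" for i
    using X that by (auto simp: iid_sample_def)
  have X_meas [measurable]: "X i \<in> borel_measurable P" if "i \<in> ?I" for i
    using distributed_measurable[OF distrD[OF that]] by simp
  have res [measurable]: "?res \<in> measurable P (PiM ?I (\<lambda>_. borel))"
    by (intro measurable_restrict) (use X_meas in auto)
  have law: "distr P (PiM ?I (\<lambda>_. borel)) ?res = PiM ?I (\<lambda>_. D)"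
    unfolding D_def by (rule iid_sample_distr[OF X]) (use N in auto)
  have push: "(\<integral>\<zeta>. F (?res \<zeta>) \<partial>P) = (\<integral>\<xi>. F \<xi> \<partial>PiM ?I (\<lambda>_. D))"
    if "F \<in> borel_measurable (PiM ?I (\<lambda>_. borel))" for F :: "(nat \<Rightarrow> real ^ 'n) \<Rightarrow> real"
    using integral_distr[OF res that] unfolding law by simp
  have AE_cube: "AE \<zeta> in P. \<forall>i\<in>?I. X i \<zeta> \<in> cube a b"
  proof (rule AE_finite_allI)
    fix i assume i: "i \<in> ?I"
    have "AE x in distr P lborel (X i). x \<in> cube a b"
      using AE_D unfolding distributed_distr_eq_density[OF distrD[OF i]] D_def .
    then show "AE \<zeta> in P. X i \<zeta> \<in> cube a b"
      by (subst (asm) AE_distr_iff) (use X_meas[OF i] in auto)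
  qed simp
  have W_meas: "?W \<in> borel_measurable P"
  proof -
    let ?R0 = "{z \<in> space (borel \<Otimes>\<^sub>M borel). snd z \<in> cube a b \<and> infnorm (fst z - snd z) \<le> r}"
    have R0: "?R0 \<in> sets (borel \<Otimes>\<^sub>M borel :: ((real ^ 'n) \<times> (real ^ 'n)) measure)" by measurable
    have "(\<lambda>\<zeta>. g (real (kernel_count (cube a b) k N m (\<lambda>i. X i \<zeta>) (X i \<zeta>)) / (real m * q0 (X i \<zeta>))) (X i \<zeta>))
        \<in> borel_measurable P" if "i \<in> {1..N}" for i
    proof -
      have Xi [measurable]: "X i \<in> borel_measurable P" using that by (intro X_meas) auto
      have "(\<lambda>\<zeta>. count_in ?R0 {N + 1..N + m} (X i \<zeta>) (\<lambda>i. X i \<zeta>)) \<in> measurable P (count_space UNIV)"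
        by (rule measurable_count_in[OF R0 _ Xi]) (auto intro!: X_meas)
      then have [measurable]: "(\<lambda>\<zeta>. kernel_count (cube a b) k N m (\<lambda>i. X i \<zeta>) (X i \<zeta>)) \<in> measurable P (count_space UNIV)"
        unfolding kernel_count_def kernel_region_stage count_in_def by (simp add: space_pair_measure)
      show ?thesis by measurable
    qed
    then show ?thesis
      unfolding plug_in_def kde_with_volume_def by (intro borel_measurable_times borel_measurable_sum) auto
  qed
  have W_eq: "AE \<zeta> in P. ?W \<zeta> = statistic N (?res \<zeta>)"
    using AE_cube
  proof eventually_elim
    fix \<zeta> assume cube: "\<forall>i\<in>?I. X i \<zeta> \<in> cube a b"
    have "g (real (kernel_count (cube a b) k N m (\<lambda>i. X i \<zeta>) (X i \<zeta>)) / (real m * q0 (X i \<zeta>))) (X i \<zeta>)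
        = h (count_in R {N + 1..N + m} (?res \<zeta> i) (?res \<zeta>)) (?res \<zeta> i)" if i: "i \<in> {1..N}" for i
    proof -
      have x: "X i \<zeta> \<in> cube a b" using cube i by auto
      have "kernel_count (cube a b) k N m (\<lambda>i. X i \<zeta>) (X i \<zeta>) = count_in R {N + 1..N + m} (?res \<zeta> i) (?res \<zeta>)"
        unfolding kernel_count_def kernel_region_stage count_in_def
        by (rule arg_cong[where f = card]) (use x i in \<open>auto simp: R_def\<close>)
      then show ?thesis using x i by (simp add: h_def q0_eq)
    qed
    then show "?W \<zeta> = statistic N (?res \<zeta>)"
      by (simp add: plug_in_def kde_with_volume_def statistic_def)
  qed
  have S_meas: "(\<lambda>\<zeta>. statistic N (?res \<zeta>)) \<in> borel_measurable P"
    using measurable_compose[OF res statistic_measurable] .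
  have E: "P.expectation ?W = (\<integral>\<xi>. statistic N \<xi> \<partial>PiM ?I (\<lambda>_. D))"
    unfolding push[OF statistic_measurable, symmetric] using W_eq W_meas S_meas by (intro integral_cong_AE) auto
  let ?e = "\<integral>\<xi>. statistic N \<xi> \<partial>PiM ?I (\<lambda>_. D)"
  have "P.variance ?W = (\<integral>\<zeta>. (statistic N (?res \<zeta>) - ?e)\<^sup>2 \<partial>P)"
    unfolding E using W_eq W_meas S_meas by (intro integral_cong_AE) auto
  also have "\<dots> = (\<integral>\<xi>. (statistic N \<xi> - ?e)\<^sup>2 \<partial>PiM ?I (\<lambda>_. D))"
    by (rule push) (use statistic_measurable in measurable)
  finally show ?thesis .
qed

lemma error_bounds:
  defines "bias \<equiv> \<integral>x. \<bar>(\<integral>y. near r x y / q x * f y \<partial>\<mu>) - f x\<bar> \<partial>\<mu>"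
    and "blur \<equiv> \<integral>y. \<bar>(\<integral>x. near r x y / q x * \<Phi> x \<partial>\<mu>) - \<Phi> y\<bar> \<partial>\<mu>"
  shows "total_err \<le> err + 4 * L\<^sup>2 * (eps_inf * (two_pow * eps_inf + eps_inf) * bias)"
    and "smoothing_err \<le> eps_inf * (two_pow * eps_inf * L + eps_inf * L) * blur"
proof -
  have "0 \<le> 4 * L\<^sup>2" by simp
  from mult_left_mono[OF bias_le this]
  show "total_err \<le> err + 4 * L\<^sup>2 * (eps_inf * (two_pow * eps_inf + eps_inf) * bias)"
    unfolding total_err_def bias_def by (rule add_left_mono)
  show "smoothing_err \<le> eps_inf * (two_pow * eps_inf * L + eps_inf * L) * blur"
    unfolding blur_def by (rule smoothing_err_le)
qed

text \<open>
  The linear statistic is a sum of independent terms, so that its variance is exactly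
  \<open>c4 / N + c5 / m\<close>. The error terms \<open>E\<close> and \<open>F\<close> are stated without reference to this locale, since \<open>m\<close>
  varies when the limit is taken.
\<close>
theorem stage_expansion:
  fixes X :: "nat \<Rightarrow> 'w \<Rightarrow> real ^ 'n"
  assumes X: "iid_sample P X f" and q0: "q0 \<in> borel_measurable borel"
    and q0_eq: "\<And>x. x \<in> cube a b \<Longrightarrow> q0 x = q x" and N: "1 \<le> N" and t: "0 < t"
    and c4: "c4 = D.variance (\<lambda>x. if x \<in> cube a b then g (f x) x else 0)"
    and c5: "c5 = D.variance (\<lambda>x. f x * w x)"
    and E: "18 * k\<^sup>2 * B\<^sup>2 * exp (- (\<tau>1 * k))
       + 2 * L\<^sup>2 * (eps_inf * two_pow\<^sup>2 / k + 2 * (two_pow * eps_inf / real m)\<^sup>2) + 2 * L\<^sup>2 * two_pow\<^sup>2 / k\<^sup>2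
       + 4 * L\<^sup>2 * (eps_inf * (two_pow * eps_inf + eps_inf) *
       (\<integral>x. \<bar>(\<integral>y. near r x y / q x * f y \<partial>\<mu>) - f x\<bar> \<partial>\<mu>)) \<le> E"
    and F: "eps_inf * (two_pow * eps_inf * L + eps_inf * L) *
       (\<integral>y. \<bar>(\<integral>x. near r x y / q x * (f x * w x) \<partial>\<mu>) - f y * w y\<bar> \<partial>\<mu>) \<le> F"
  shows "\<bar>prob_space.variance P (\<lambda>\<zeta>. plug_in g (kde_with_volume q0 (cube a b) k N m (\<lambda>i. X i \<zeta>)) N (\<lambda>i. X i \<zeta>))
      - (c4 * (1 / real N) + c5 * (1 / real m))\<bar>
    \<le> t * (c4 * (1 / real N) + c5 * (1 / real m))
      + (1 + 1 / t) * (2 * E * (1 / real N) + (4 * (two_pow * eps_inf)\<^sup>2 * E + 4 * F) * (1 / real m))"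
proof -
  let ?A = "{1..N}" and ?J = "{N + 1..N + m}" and ?I = "{1..N + m}"
  have I: "?A \<union> ?J = ?I" by auto
  let ?P = "PiM ?I (\<lambda>_. D)"
  interpret P: prob_space ?P by (intro prob_space_PiM D.prob_space_axioms)
  define lin where "lin \<xi> = (\<Sum>i\<in>?A. \<psi> (\<xi> i)) / real N + (\<Sum>j\<in>?J. \<Phi> (\<xi> j)) / real m" for \<xi>
  define part where "part i x = (if i \<le> N then \<psi> x / real N else \<Phi> x / real m)" for i :: nat and x
  have lin_eq: "lin \<xi> = (\<Sum>i\<in>?I. part i (\<xi> i))" for \<xi>
  proof -
    have "(\<Sum>i\<in>?I. part i (\<xi> i)) = (\<Sum>i\<in>?A. part i (\<xi> i)) + (\<Sum>i\<in>?J. part i (\<xi> i))"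
      unfolding I[symmetric] by (rule sum.union_disjoint) auto
    then show ?thesis by (simp add: lin_def part_def sum_divide_distrib)
  qed
  define C where "C = Max {L, eps_inf * L, B}"
  have C: "L \<le> C" "eps_inf * L \<le> C" "B \<le> C" by (auto simp: C_def)
  have psiC: "\<bar>\<psi> x\<bar> \<le> C" for x using psi_le[of x] C by linarith
  have PhiC: "\<bar>\<Phi> x\<bar> \<le> C" for x using Phi_le[of x] C by linarith
  have m1: "1 \<le> m" using m by simp
  have divC: "\<bar>z / real n\<bar> \<le> C" if "\<bar>z\<bar> \<le> C" "1 \<le> n" for z and n :: nat
  proof -
    have "\<bar>z\<bar> / real n \<le> \<bar>z\<bar> / 1" using that by (intro divide_left_mono) auto
    then show ?thesis using that by simp
  qed
  have part_meas: "part i \<in> borel_measurable D" for i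
    unfolding part_def[abs_def] by (cases "i \<le> N") auto
  have part_bd: "\<bar>part i x\<bar> \<le> C" for i x
    unfolding part_def using divC[OF psiC N] divC[OF PhiC m1] by auto
  have "P.variance lin = (\<Sum>i\<in>?I. D.variance (part i))"
    unfolding lin_eq by (rule D.variance_coordinate_sum[where B = C]) (auto intro: part_meas part_bd)
  also have "\<dots> = (\<Sum>i\<in>?A. D.variance (part i)) + (\<Sum>i\<in>?J. D.variance (part i))"
    unfolding I[symmetric] by (rule sum.union_disjoint) auto
  also have "(\<Sum>i\<in>?A. D.variance (part i)) = (\<Sum>i\<in>?A. c4 / (real N)\<^sup>2)"
  proof (intro sum.cong refl)
    fix i assume "i \<in> ?A"
    then have "part i = (\<lambda>x. (if x \<in> cube a b then g (f x) x else 0) / real N)"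
      by (auto simp: part_def \<psi>_def fun_eq_iff)
    then show "D.variance (part i) = c4 / (real N)\<^sup>2" unfolding c4 by (simp only: D.variance_divide)
  qed
  also have "(\<Sum>i\<in>?J. D.variance (part i)) = (\<Sum>i\<in>?J. c5 / (real m)\<^sup>2)"
  proof (intro sum.cong refl)
    fix i assume "i \<in> ?J"
    then have "part i = (\<lambda>x. f x * w x / real m)" by (auto simp: part_def \<Phi>_def fun_eq_iff)
    then show "D.variance (part i) = c5 / (real m)\<^sup>2" unfolding c5 by (simp only: D.variance_divide)
  qed
  finally have var_lin: "P.variance lin = c4 * (1 / real N) + c5 * (1 / real m)"
    using N m by (simp add: power2_eq_square)
  have meas: "statistic N \<in> borel_measurable ?P" "lin \<in> borel_measurable ?P"
  proof -
    have s: "sets ?P = sets (PiM ?I (\<lambda>_. borel))" by (intro sets_PiM_cong) auto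
    show "statistic N \<in> borel_measurable ?P"
      using statistic_measurable[of N] by (simp add: measurable_cong_sets[OF s refl])
    show "lin \<in> borel_measurable ?P"
      unfolding lin_eq[abs_def] by (intro borel_measurable_sum measurable_compose[OF _ part_meas]) auto
  qed
  have bd: "\<bar>statistic N \<xi>\<bar> \<le> 2 * C" "\<bar>lin \<xi>\<bar> \<le> 2 * C" for \<xi>
  proof -
    show "\<bar>statistic N \<xi>\<bar> \<le> 2 * C" using statistic_bounded[OF N, of \<xi>] C B0 by linarith
    have "\<bar>\<Sum>i\<in>?A. \<psi> (\<xi> i)\<bar> \<le> (\<Sum>i\<in>?A. C)" "\<bar>\<Sum>i\<in>?J. \<Phi> (\<xi> i)\<bar> \<le> (\<Sum>i\<in>?J. C)"
      by (intro order_trans[OF sum_abs] sum_mono psiC PhiC)+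
    then have "\<bar>(\<Sum>i\<in>?A. \<psi> (\<xi> i)) / real N\<bar> \<le> C" "\<bar>(\<Sum>i\<in>?J. \<Phi> (\<xi> i)) / real m\<bar> \<le> C"
      using N m by (auto simp: divide_simps mult.commute)
    then show "\<bar>lin \<xi>\<bar> \<le> 2 * C" unfolding lin_def by linarith
  qed
  have E': "total_err \<le> E" using error_bounds(1) E unfolding err_def by linarith
  have F': "smoothing_err \<le> F" using error_bounds(2) F by (simp add: \<Phi>_def)
  have "P.variance (\<lambda>\<xi>. statistic N \<xi> - lin \<xi>)
      \<le> 2 * total_err / real N + (4 * (two_pow * eps_inf)\<^sup>2 * total_err + 4 * smoothing_err) / real m"
    using linearisation_variance[of ?A ?J] N unfolding I statistic_def lin_def by simp
  also have "\<dots> \<le> 2 * E / real N + (4 * (two_pow * eps_inf)\<^sup>2 * E + 4 * F) / real m"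
    using E' F' by (intro add_mono divide_right_mono mult_left_mono) auto
  finally have diff: "P.variance (\<lambda>\<xi>. statistic N \<xi> - lin \<xi>)
      \<le> 2 * E * (1 / real N) + (4 * (two_pow * eps_inf)\<^sup>2 * E + 4 * F) * (1 / real m)" by simp
  have "\<bar>P.variance (statistic N) - P.variance lin\<bar>
      \<le> t * P.variance lin + (1 + 1 / t) * P.variance (\<lambda>\<xi>. statistic N \<xi> - lin \<xi>)"
    by (rule P.variance_perturbation[OF meas bd t])
  also have "\<dots> \<le> t * P.variance lin + (1 + 1 / t) * (2 * E * (1 / real N) + (4 * (two_pow * eps_inf)\<^sup>2 * E + 4 * F) * (1 / real m))"
    using t diff by (intro add_left_mono mult_left_mono) auto
  finally have bound: "\<bar>P.variance (statistic N) - (c4 * (1 / real N) + c5 * (1 / real m))\<bar>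
    \<le> t * (c4 * (1 / real N) + c5 * (1 / real m))
      + (1 + 1 / t) * (2 * E * (1 / real N) + (4 * (two_pow * eps_inf)\<^sup>2 * E + 4 * F) * (1 / real m))"
    unfolding var_lin .
  note V = variance_plug_in_eq[OF X q0 q0_eq N]
  show ?thesis by (subst V) (fact bound | assumption)+
qed

end

section \<open>The expansion of the variance\<close>

lemma filterlim_at_top_of_proportion:
  fixes M :: "nat \<Rightarrow> nat"
  assumes "0 < \<alpha>" "\<And>T. \<bar>real (M T) - \<alpha> * real T\<bar> < 1"
  shows "filterlim M at_top sequentially"
proof -
  have "filterlim (\<lambda>T. \<alpha> * real T - 1) at_top sequentially" using assms(1) by real_asymp
  then have "filterlim (\<lambda>T. real (M T)) at_top sequentially"
    by (rule filterlim_at_top_mono) (use assms(2) in \<open>auto intro!: always_eventually simp: abs_less_iff less_imp_le algebra_simps\<close>)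
  then show ?thesis by (simp add: filterlim_sequentially_iff_filterlim_real)
qed

text \<open>
  The bounds of \<open>stage_expansion\<close> hold for all large sample sizes, and their error terms \<open>E\<close> and \<open>F\<close>
  vanish in the limit: the tail term by \<open>superpolynomial_decay\<close>, the variance of the counts because
  \<open>k\<close> tends to infinity, and the bias and the smoothing error by \<open>approximate_identity_L1\<close>.
\<close>
lemma (in density_on_cube) plug_in_variance_expansion:
  fixes g :: "real \<Rightarrow> real ^ 'n \<Rightarrow> real" and gd :: "nat \<Rightarrow> real \<Rightarrow> real ^ 'n \<Rightarrow> real" and l :: nat
    and X :: "nat \<Rightarrow> 'w \<Rightarrow> real ^ 'n" and q0 :: "nat \<Rightarrow> real ^ 'n \<Rightarrow> real" and k C r :: "nat \<Rightarrow> real"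
    and M N :: "nat \<Rightarrow> nat"
  assumes g: "(\<lambda>(t, x). g t x) \<in> borel_measurable (borel \<Otimes>\<^sub>M borel)" and X: "iid_sample P X f"
    and k0: "0 < k0" and \<beta>: "0 < \<beta>" "\<beta> < 1" and k: "\<And>m. k m = k0 * real m powr \<beta>"
    and \<alpha>: "0 < \<alpha>" "\<alpha> < 1" and MN: "\<And>T. N T + M T = T" "\<And>T. \<bar>real (M T) - \<alpha> * real T\<bar> < 1"
    and gd: "first_arg_derivs (max 3 (max l CARD('n))) (cube a b) g gd"
    and gd_bounded: "\<And>n. n \<le> max 3 (max l CARD('n)) \<Longrightarrow>
         \<exists>B. \<forall>x\<in>cube a b. \<forall>t\<in>{eps0..eps_inf}. \<bar>gd n t x\<bar> < B"
    and \<epsilon>: "0 < \<epsilon>" "\<epsilon> < 1" and \<delta>: "2 / 3 < \<delta>" "\<delta> < 1"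
    and C: "\<And>m. 0 < C m" "C \<in> \<Theta>(\<lambda>m. exp (- (real m powr (\<beta> * (1 - \<delta>)))))"
    and growth: "\<And>n. n \<in> {0, 3} \<Longrightarrow>
         growth_condition (cube a b) ((1 - \<epsilon>) * eps0) ((1 + \<epsilon>) * eps_inf) k C (gd n)"
    and r: "\<And>m. r m = (k m / real m) powr (1 / real CARD('n)) / 2"
    and q0_meas: "\<And>m. q0 m \<in> borel_measurable borel"
    and q0_bounds: "\<forall>\<^sub>F m in sequentially. \<forall>x\<in>cube a b. r m ^ CARD('n) \<le> q0 m x \<and> q0 m x \<le> (2 * r m) ^ CARD('n)"
    and q0_inner: "\<forall>\<^sub>F m in sequentially. \<forall>x\<in>cube (a + r m) (b - r m). q0 m x = (2 * r m) ^ CARD('n)"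
    and c4: "c4 = D.variance (\<lambda>x. if x \<in> cube a b then g (f x) x else 0)"
    and c5: "c5 = D.variance (\<lambda>x. f x * (if x \<in> cube a b then deriv (\<lambda>s. g s x) (f x) else 0))"
  shows "(\<lambda>T. prob_space.variance P (\<lambda>\<zeta>. plug_in g (kde_with_volume (q0 (M T)) (cube a b) (k (M T)) (N T) (M T) (\<lambda>i. X i \<zeta>)) (N T) (\<lambda>i. X i \<zeta>))
       - (c4 * (1 / real (N T)) + c5 * (1 / real (M T))))
     \<in> o(\<lambda>T. 1 / real (M T) + 1 / real (N T))"
proof -
  define two_pow :: real where "two_pow = 2 ^ CARD('n)"
  define \<tau>1 \<tau>2 where tau_def: "\<tau>1 = eps0 / two_pow / 8" "\<tau>2 = two_pow * (3 * eps_inf + 1)"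
  let ?pl = "(1 - \<epsilon>) * eps0" and ?pu = "(1 + \<epsilon>) * eps_inf"
  define w where "w x = (if x \<in> cube a b then deriv (\<lambda>s. g s x) (f x) else 0)" for x
  define q where "q m x = (if x \<in> cube a b then q0 m x else (2 * r m) ^ CARD('n))" for m x
  have p: "?pl < ?pu" "0 < ?pu"
  proof -
    have "?pl < 1 * eps0" using \<epsilon> eps0 by (intro mult_strict_right_mono) auto
    also have "\<dots> \<le> ?pu" using \<epsilon> eps0 eps_inf by (intro mult_mono) auto
    finally show "?pl < ?pu" .
    show "0 < ?pu" using \<epsilon> eps0 eps_inf by (intro mult_pos_pos) auto
  qed
  have range: "0 < \<tau>1" "eps0 \<in> {\<tau>1..\<tau>2}" "\<And>x. x \<in> cube a b \<Longrightarrow> f x \<in> {\<tau>1..\<tau>2}"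
  proof -
    have d1: "1 \<le> two_pow" by (simp add: two_pow_def)
    have "\<tau>1 \<le> eps0 / 1 / 1" unfolding tau_def using eps0 d1 by (intro frac_le) auto
    moreover have "1 * eps_inf \<le> \<tau>2" unfolding tau_def using d1 eps0 eps_inf by (intro mult_mono) auto
    moreover show "0 < \<tau>1" using eps0 d1 by (simp add: tau_def)
    ultimately show "eps0 \<in> {\<tau>1..\<tau>2}" "\<And>x. x \<in> cube a b \<Longrightarrow> f x \<in> {\<tau>1..\<tau>2}"
      using eps_inf f_bounds by (auto intro: order_trans)
  qed
  have g0: "gd 0 = g" using gd by (simp add: first_arg_derivs_def)
  have der: "((\<lambda>s. gd n s x) has_real_derivative gd (Suc n) t x) (at t)"
    if "n < 3" "x \<in> cube a b" "0 < t" for n x t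
    using gd that unfolding first_arg_derivs_def by auto
  obtain B3 where B3: "\<And>x t. x \<in> cube a b \<Longrightarrow> t \<in> {\<tau>1..\<tau>2} \<Longrightarrow> \<bar>gd 3 t x\<bar> \<le> B3"
    using growth_condition_bounded[OF growth[of 3] k k0 \<beta> C(1) p range(1), of \<tau>2] by blast
  have ref: "\<exists>B. \<forall>x\<in>cube a b. \<bar>gd n eps0 x\<bar> \<le> B" if "n \<le> 2" for n
    using gd_bounded[of n] that eps_inf by (force intro: less_imp_le)
  obtain L where L: "0 < L"
    and g_bd: "\<And>x t. x \<in> cube a b \<Longrightarrow> t \<in> {\<tau>1..\<tau>2} \<Longrightarrow> \<bar>g t x\<bar> \<le> L \<and> \<bar>gd 1 t x\<bar> \<le> L"
    and g_lip: "\<And>x s t. x \<in> cube a b \<Longrightarrow> s \<in> {\<tau>1..\<tau>2} \<Longrightarrow> t \<in> {\<tau>1..\<tau>2} \<Longrightarrow> \<bar>g t x - g s x\<bar> \<le> L * \<bar>t - s\<bar>"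
    and g'_lip: "\<And>x s t. x \<in> cube a b \<Longrightarrow> s \<in> {\<tau>1..\<tau>2} \<Longrightarrow> t \<in> {\<tau>1..\<tau>2} \<Longrightarrow> \<bar>gd 1 t x - gd 1 s x\<bar> \<le> L * \<bar>t - s\<bar>"
  proof (rule first_arg_derivs_lipschitz[OF gd _ ref B3 range(1,2)])
    show "3 \<le> max 3 (max l CARD('n))" by simp
  qed (assumption | (rule that; assumption))+
  have w_eq: "w x = gd 1 (f x) x" if "x \<in> cube a b" for x
  proof -
    have "0 < f x" using f_bounds[OF that] eps0 by linarith
    from DERIV_imp_deriv[OF der[OF _ that this, of 0]] show ?thesis using that by (simp add: w_def g0)
  qed
  have w_meas: "w \<in> borel_measurable borel"
  proof -
    have "(\<lambda>x. if x \<in> cube a b then gd 1 (f x) x else 0) \<in> borel_measurable borel"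
    proof (rule measurable_derivative_along[OF g])
      fix x :: "real ^ 'n" assume x: "x \<in> cube a b"
      then have "0 < f x" using f_bounds[OF x] eps0 by linarith
      from der[OF _ x this, of 0] show "((\<lambda>s. g s x) has_real_derivative gd 1 (f x) x) (at (f x))"
        by (simp add: g0)
    qed auto
    moreover have "w = (\<lambda>x. if x \<in> cube a b then gd 1 (f x) x else 0)" using w_eq by (auto simp: w_def)
    ultimately show ?thesis by simp
  qed
  obtain G where G: "0 < G" and range_bd: "\<forall>\<^sub>F m in sequentially. \<forall>x\<in>cube a b.
      \<forall>t\<in>insert 0 {1 / k m..2 ^ CARD('n) * real m / k m}. \<bar>g t x\<bar> \<le> G * (1 + 1 / C m)"
  proof (rule growth_condition_range[OF growth[of 0] k k0 \<beta> C(1) p])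
    fix x :: "real ^ 'n" assume x: "x \<in> cube a b"
    show "continuous_on {0<..} (\<lambda>t. gd 0 t x)"
      using der[OF _ x, of 0] by (intro DERIV_continuous_on[where D = "\<lambda>t. gd 1 t x"]) (auto intro: has_field_derivative_at_within)
  qed (use that g0 in auto)
  obtain cc where cc: "0 < cc" and C_lower: "\<forall>\<^sub>F m in sequentially. norm (C m) \<ge> cc * norm (exp (- (real m powr (\<beta> * (1 - \<delta>)))))"
    using C(2) landau_omega.bigE[of C sequentially] bigthetaD2 by blast
  define B where "B m = (L + G * (1 + 1 / cc)) * exp (real m powr (\<beta> * (1 - \<delta>)))" for m
  have k_top: "filterlim k at_top sequentially"
    using bandwidth_at_top[OF k0 \<beta>(1)] unfolding k[symmetric] .
  have r0: "r \<longlonglongrightarrow> 0"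
    unfolding r k by (rule bandwidth_radius_tendsto_0[OF k0 \<beta>]) simp
  have r_pos: "\<forall>\<^sub>F m in sequentially. 0 < r m"
    using eventually_gt_at_top[of 0] by eventually_elim (use k0 in \<open>simp add: r k\<close>)
  have volume: "(2 * r m) ^ CARD('n) = k m / real m" if "0 < m" for m
  proof -
    have "0 < k m / real m" using that k0 by (simp add: k)
    then show ?thesis unfolding r by (rule bandwidth_volume) simp
  qed
  have stage: "\<forall>\<^sub>F m in sequentially.
      bandwidth_stage f a b eps0 eps_inf g (gd 1) w (q m) m (k m) (r m) L (B m) two_pow \<tau>1 \<tau>2"
  proof -
    have "\<forall>\<^sub>F m in sequentially. r m < b - a" using ab by (intro order_tendstoD(2)[OF r0]) auto
    moreover have "\<forall>\<^sub>F m in sequentially. 1 \<le> k m" using k_top unfolding filterlim_at_top by blast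
    ultimately show ?thesis
      using eventually_ge_at_top[of 2] r_pos q0_bounds range_bd C_lower
    proof eventually_elim
      case (elim m)
      have q_bd: "r m ^ CARD('n) \<le> q m x \<and> q m x \<le> (2 * r m) ^ CARD('n)" for x
        using elim by (auto simp: q_def intro: power_mono)
      have q_meas: "q m \<in> borel_measurable borel"
        unfolding q_def[abs_def] using q0_meas[of m] by measurable
      have exp1: "1 \<le> exp (real m powr (\<beta> * (1 - \<delta>)))" by simp
      have BL: "L \<le> B m"
      proof -
        have "L * 1 \<le> (L + G * (1 + 1 / cc)) * exp (real m powr (\<beta> * (1 - \<delta>)))"
          using L G cc exp1 by (intro mult_mono) auto
        then show ?thesis by (simp add: B_def)
      qed
      have GB: "G * (1 + 1 / C m) \<le> B m"
      proof -
        have "cc / exp (real m powr (\<beta> * (1 - \<delta>))) \<le> C m"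
          using elim(7) C(1)[of m] by (simp add: exp_minus divide_inverse)
        then have "1 / C m \<le> 1 / (cc / exp (real m powr (\<beta> * (1 - \<delta>))))"
          using C(1)[of m] cc by (intro divide_left_mono) auto
        also have "\<dots> = (1 / cc) * exp (real m powr (\<beta> * (1 - \<delta>)))" by simp
        finally have "1 + 1 / C m \<le> (1 + 1 / cc) * exp (real m powr (\<beta> * (1 - \<delta>)))"
          using exp1 unfolding distrib_right by linarith
        then have "G * (1 + 1 / C m) \<le> G * ((1 + 1 / cc) * exp (real m powr (\<beta> * (1 - \<delta>))))"
          using G by (intro mult_left_mono) auto
        also have "\<dots> \<le> B m" using L by (simp add: B_def distrib_right mult.assoc)
        finally show ?thesis .
      qed
      have rB: "\<bar>g (real n / (real m * q m x)) x\<bar> \<le> B m" if x: "x \<in> cube a b" and n: "n \<le> m" for x n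
      proof -
        have qp: "0 < q m x" using q_bd[of x] elim by (smt (verit) zero_less_power)
        have mq: "real m * q m x \<le> k m" "k m \<le> 2 ^ CARD('n) * (real m * q m x)"
        proof -
          have v: "real m * (2 * r m) ^ CARD('n) = k m" using volume[of m] elim by simp
          show "real m * q m x \<le> k m" using q_bd[of x] v by (metis mult_left_mono of_nat_0_le_iff)
          have "k m = 2 ^ CARD('n) * (real m * r m ^ CARD('n))" unfolding v[symmetric] power_mult_distrib by simp
          also have "\<dots> \<le> 2 ^ CARD('n) * (real m * q m x)"
            using q_bd[of x] by (intro mult_left_mono) auto
          finally show "k m \<le> 2 ^ CARD('n) * (real m * q m x)" .
        qed
        have "real n / (real m * q m x) \<in> insert 0 {1 / k m..2 ^ CARD('n) * real m / k m}"
        proof (cases "n = 0")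
          case False
          have "1 / k m \<le> real n / (real m * q m x)"
            using False mq(1) qp elim by (intro frac_le) auto
          moreover have "real n / (real m * q m x) \<le> real m / (k m / 2 ^ CARD('n))"
            using n mq(2) elim by (intro frac_le) (auto simp: divide_le_eq mult.commute)
          ultimately show ?thesis by (simp add: mult.commute)
        qed simp
        then show ?thesis using elim(6) x GB by (meson order_trans)
      qed
      have w0: "w x = 0" if "x \<notin> cube a b" for x using that by (simp add: w_def)
      have v: "(2 * r m) ^ CARD('n) = k m / real m" using elim by (intro volume) simp
      have der_g: "((\<lambda>s. g s x) has_real_derivative gd 1 t x) (at t)"
        if "x \<in> cube a b" "t \<in> {\<tau>1..\<tau>2}" for x t
        using der[OF _ that(1), of 0 t] that(2) range(1) by (simp add: g0)
      have ok: "0 < r m" "r m \<le> b - a" "2 \<le> m" "1 \<le> k m" using elim by simp_all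
      show ?case
        by unfold_locales
          (assumption | rule two_pow_def tau_def g w_meas q_meas w_eq w0 v ok q_bd L der_g g_bd g_lip g'_lip BL rB)+
    qed
  qed
  define bias where "bias m = (\<integral>x. \<bar>(\<integral>y. near (r m) x y / q m x * f y \<partial>\<mu>) - f x\<bar> \<partial>\<mu>)" for m
  define blur where "blur m = (\<integral>y. \<bar>(\<integral>x. near (r m) x y / q m x * (f x * w x) \<partial>\<mu>) - f y * w y\<bar> \<partial>\<mu>)" for m
  have q_meas [measurable]: "q m \<in> borel_measurable borel" for m
    unfolding q_def[abs_def] using q0_meas[of m] by measurable
  have kernel_ev: "\<forall>\<^sub>F m in sequentially. \<forall>x y. 0 \<le> near (r m) x y / q m x \<and> near (r m) x y / q m x \<le> near (r m) x y / r m ^ CARD('n)"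
    using stage
  proof eventually_elim
    case (elim m)
    then interpret bandwidth_stage f a b eps0 eps_inf g "gd 1" w "q m" m "k m" "r m" L "B m" two_pow \<tau>1 \<tau>2 .
    show ?case using near_over_q_le q_pos by (auto simp: less_imp_le)
  qed
  have mass_ev: "\<forall>\<^sub>F m in sequentially. \<forall>y \<in> cube (a + 2 * r m) (b - 2 * r m).
      (\<integral>x. near (r m) x y / q m x \<partial>\<mu>) = 1 \<and> (\<integral>x. near (r m) y x / q m y \<partial>\<mu>) = 1"
    using r_pos q0_inner
  proof eventually_elim
    case (elim m)
    have "q m x = (2 * r m) ^ CARD('n)" if "x \<in> cube (a + r m) (b - r m)" for x
      using elim that by (simp add: q_def)
    then show ?case using kernel_mass_inner[OF elim(1) _ q_meas] by blast
  qed
  have bias0: "bias \<longlonglongrightarrow> 0"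
    unfolding bias_def[abs_def]
  proof (rule approximate_identity_L1[OF ab f_measurable f_le r_pos r0])
    show "(\<lambda>(x, y). near (r n) x y / q n x) \<in> borel_measurable (borel \<Otimes>\<^sub>M borel)" for n
      unfolding split_beta' by measurable
    show "\<forall>\<^sub>F n in sequentially. \<forall>x y. 0 \<le> near (r n) x y / q n x \<and> near (r n) x y / q n x \<le> near (r n) x y / r n ^ CARD('n)"
      by (rule kernel_ev)
    show "\<forall>\<^sub>F n in sequentially. \<forall>x\<in>cube (a + 2 * r n) (b - 2 * r n). (\<integral>y. near (r n) x y / q n x \<partial>\<mu>) = 1"
      using mass_ev by eventually_elim blast
  qed
  have wL: "\<bar>w x\<bar> \<le> L" for x
    using g_bd[OF _ range(3), of x x] w_eq[of x] L by (cases "x \<in> cube a b") (auto simp: w_def)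
  have fw: "\<bar>f x * w x\<bar> \<le> eps_inf * L" for x
    unfolding abs_mult using f_le[of x] wL[of x] eps0 eps_inf by (intro mult_mono) auto
  have blur0: "blur \<longlonglongrightarrow> 0"
    unfolding blur_def[abs_def]
  proof (rule approximate_identity_L1[OF ab _ fw r_pos r0])
    show "(\<lambda>x. f x * w x) \<in> borel_measurable borel" using w_meas by measurable
    show "(\<lambda>(y, x). near (r n) x y / q n x) \<in> borel_measurable (borel \<Otimes>\<^sub>M borel)" for n
      unfolding split_beta' by measurable
    show "\<forall>\<^sub>F n in sequentially. \<forall>y x. 0 \<le> near (r n) x y / q n x \<and> near (r n) x y / q n x \<le> near (r n) y x / r n ^ CARD('n)"
      using kernel_ev
    proof eventually_elim
      case (elim n)
      then show ?case by (metis near_sym)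
    qed
    show "\<forall>\<^sub>F n in sequentially. \<forall>y\<in>cube (a + 2 * r n) (b - 2 * r n). (\<integral>x. near (r n) x y / q n x \<partial>\<mu>) = 1"
      using mass_ev by eventually_elim blast
  qed
  define E where "E m = 18 * (k m)\<^sup>2 * (B m)\<^sup>2 * exp (- (\<tau>1 * k m))
       + 2 * L\<^sup>2 * (eps_inf * two_pow\<^sup>2 / k m + 2 * (two_pow * eps_inf / real m)\<^sup>2) + 2 * L\<^sup>2 * two_pow\<^sup>2 / (k m)\<^sup>2
       + 4 * L\<^sup>2 * (eps_inf * (two_pow * eps_inf + eps_inf) * bias m)" for m
  define F where "F m = eps_inf * (two_pow * eps_inf * L + eps_inf * L) * blur m" for m
  have E0: "E \<longlonglongrightarrow> 0"
  proof -
    have decay: "(\<lambda>m. (k m)\<^sup>2 * (B m)\<^sup>2 * exp (- (\<tau>1 * k m))) \<longlonglongrightarrow> 0"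
    proof -
      have "(\<lambda>m. (L + G * (1 + 1 / cc))\<^sup>2 * ((k0 * real m powr \<beta>)\<^sup>2 * (exp (real m powr (\<beta> * (1 - \<delta>))))\<^sup>2
          * exp (- \<tau>1 * (k0 * real m powr \<beta>)))) \<longlonglongrightarrow> (L + G * (1 + 1 / cc))\<^sup>2 * 0"
        by (intro tendsto_intros superpolynomial_decay k0 \<beta>(1) \<delta>(1) range(1))
      then show ?thesis by (simp add: k B_def power_mult_distrib mult_ac)
    qed
    have k1: "(\<lambda>m. 1 / k m) \<longlonglongrightarrow> 0"
      unfolding k using k0 \<beta> by real_asymp
    have m1: "(\<lambda>m. 1 / real m) \<longlonglongrightarrow> 0" by real_asymp
    have "(\<lambda>m. 18 * ((k m)\<^sup>2 * (B m)\<^sup>2 * exp (- (\<tau>1 * k m)))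
       + 2 * L\<^sup>2 * (eps_inf * two_pow\<^sup>2 * (1 / k m) + 2 * (two_pow * eps_inf * (1 / real m))\<^sup>2) + 2 * L\<^sup>2 * two_pow\<^sup>2 * (1 / k m)\<^sup>2
       + 4 * L\<^sup>2 * (eps_inf * (two_pow * eps_inf + eps_inf) * bias m))
      \<longlonglongrightarrow> 18 * 0 + 2 * L\<^sup>2 * (eps_inf * two_pow\<^sup>2 * 0 + 2 * (two_pow * eps_inf * 0)\<^sup>2) + 2 * L\<^sup>2 * two_pow\<^sup>2 * 0\<^sup>2
       + 4 * L\<^sup>2 * (eps_inf * (two_pow * eps_inf + eps_inf) * 0)"
      by (intro tendsto_intros decay k1 m1 bias0)
    then show ?thesis by (simp add: E_def[abs_def] power_divide mult.assoc)
  qed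
  have F0: "F \<longlonglongrightarrow> 0"
    using tendsto_mult_left[OF blur0, of "eps_inf * (two_pow * eps_inf * L + eps_inf * L)"] by (simp add: F_def[abs_def])
  have c45: "0 \<le> c4" "0 \<le> c5" by (simp_all add: c4 c5)
  have M_top: "filterlim M at_top sequentially" by (rule filterlim_at_top_of_proportion[OF \<alpha>(1) MN(2)])
  have N_top: "filterlim N at_top sequentially"
  proof (rule filterlim_at_top_of_proportion[of "1 - \<alpha>"])
    fix T
    have "real (N T) + real (M T) = real T" using MN(1)[of T] by linarith
    then show "\<bar>real (N T) - (1 - \<alpha>) * real T\<bar> < 1" using MN(2)[of T] by (simp add: algebra_simps abs_less_iff)
  qed (use \<alpha> in simp)
  show ?thesis
  proof (rule landau_o.smallI)
    fix c :: real assume c: "0 < c"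
    define K where "K = c4 + c5 + 1"
    define t where "t = c / (2 * K)"
    have K: "0 < K" "c4 \<le> K" "c5 \<le> K" using c45 by (auto simp: K_def)
    have t: "0 < t" using c K by (simp add: t_def)
    define H where "H m = (1 + 1 / t) * (2 * \<bar>E m\<bar> + (4 * (two_pow * eps_inf)\<^sup>2 * \<bar>E m\<bar> + 4 * \<bar>F m\<bar>))" for m
    have "H \<longlonglongrightarrow> (1 + 1 / t) * (2 * \<bar>0\<bar> + (4 * (two_pow * eps_inf)\<^sup>2 * \<bar>0\<bar> + 4 * \<bar>0\<bar>))"
      unfolding H_def[abs_def] by (intro tendsto_intros E0 F0)
    then have "\<forall>\<^sub>F m in sequentially. H m < c / 2" using c by (intro order_tendstoD(2)) auto
    then have ev: "\<forall>\<^sub>F T in sequentially. H (M T) < c / 2 \<and>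
        bandwidth_stage f a b eps0 eps_inf g (gd 1) w (q (M T)) (M T) (k (M T)) (r (M T)) L (B (M T)) two_pow \<tau>1 \<tau>2"
      by (intro eventually_conj eventually_compose_filterlim[OF _ M_top] stage)
    moreover have "\<forall>\<^sub>F T in sequentially. 1 \<le> N T" using N_top unfolding filterlim_at_top by blast
    ultimately show "\<forall>\<^sub>F T in sequentially. norm (prob_space.variance P (\<lambda>\<zeta>. plug_in g (kde_with_volume (q0 (M T)) (cube a b) (k (M T)) (N T) (M T) (\<lambda>i. X i \<zeta>)) (N T) (\<lambda>i. X i \<zeta>))
       - (c4 * (1 / real (N T)) + c5 * (1 / real (M T)))) \<le> c * norm (1 / real (M T) + 1 / real (N T))"
    proof eventually_elim
      case (elim T)
      then interpret bandwidth_stage f a b eps0 eps_inf g "gd 1" w "q (M T)" "M T" "k (M T)" "r (M T)" L "B (M T)" two_pow \<tau>1 \<tau>2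
        by simp
      let ?n = "1 / real (N T)" and ?m = "1 / real (M T)"
      have nm: "0 \<le> ?n" "0 \<le> ?m" by auto
      have "\<bar>prob_space.variance P (\<lambda>\<zeta>. plug_in g (kde_with_volume (q0 (M T)) (cube a b) (k (M T)) (N T) (M T) (\<lambda>i. X i \<zeta>)) (N T) (\<lambda>i. X i \<zeta>)) - (c4 * ?n + c5 * ?m)\<bar>
          \<le> t * (c4 * ?n + c5 * ?m) + (1 + 1 / t) * (2 * E (M T) * ?n + (4 * (two_pow * eps_inf)\<^sup>2 * E (M T) + 4 * F (M T)) * ?m)"
      proof (rule stage_expansion[OF X q0_meas])
        show "q0 (M T) x = q (M T) x" if "x \<in> cube a b" for x using that by (simp add: q_def)
        show "c5 = D.variance (\<lambda>x. f x * w x)" by (simp add: c5 w_def)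
      qed (use elim t c4 in \<open>simp_all add: E_def F_def bias_def blur_def\<close>)
      also have "t * (c4 * ?n + c5 * ?m) \<le> t * (K * ?n + K * ?m)"
        using t K nm by (intro mult_left_mono add_mono mult_right_mono) auto
      also have "t * (K * ?n + K * ?m) = c / 2 * (?n + ?m)" using K by (simp add: t_def field_simps)
      also have "(1 + 1 / t) * (2 * E (M T) * ?n + (4 * (two_pow * eps_inf)\<^sup>2 * E (M T) + 4 * F (M T)) * ?m) \<le> H (M T) * (?n + ?m)"
      proof -
        let ?e = "2 * \<bar>E (M T)\<bar> + (4 * (two_pow * eps_inf)\<^sup>2 * \<bar>E (M T)\<bar> + 4 * \<bar>F (M T)\<bar>)"
        have pos: "0 \<le> 4 * (two_pow * eps_inf)\<^sup>2 * \<bar>E (M T)\<bar>" by simp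
        have "4 * (two_pow * eps_inf)\<^sup>2 * E (M T) \<le> 4 * (two_pow * eps_inf)\<^sup>2 * \<bar>E (M T)\<bar>" by (intro mult_left_mono) auto
        then have "2 * E (M T) \<le> ?e" "4 * (two_pow * eps_inf)\<^sup>2 * E (M T) + 4 * F (M T) \<le> ?e" using pos by linarith+
        then have "2 * E (M T) * ?n + (4 * (two_pow * eps_inf)\<^sup>2 * E (M T) + 4 * F (M T)) * ?m \<le> ?e * ?n + ?e * ?m"
          using nm by (intro add_mono[OF mult_right_mono mult_right_mono])
        also have "\<dots> = ?e * (?n + ?m)" by (simp only: distrib_left)
        finally have "(1 + 1 / t) * (2 * E (M T) * ?n + (4 * (two_pow * eps_inf)\<^sup>2 * E (M T) + 4 * F (M T)) * ?m)
            \<le> (1 + 1 / t) * (?e * (?n + ?m))"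
          using t by (intro mult_left_mono) auto
        then show ?thesis by (simp only: H_def mult.assoc)
      qed
      also have "H (M T) * (?n + ?m) \<le> c / 2 * (?n + ?m)" using elim nm by (intro mult_right_mono) auto
      finally show ?case using nm by (simp add: algebra_simps)
    qed
  qed
qed

theorem theorem3:
  fixes f :: "real ^ 'n \<Rightarrow> real" and g :: "real \<Rightarrow> real ^ 'n \<Rightarrow> real" and a b :: real
  assumes "a < b"
    and "density_with_support f (cube a b)"
    and "bounded_cont_partials CARD('n) (interior (cube a b)) f"
    and "(\<lambda>(t, x). g t x) \<in> borel_measurable (borel \<Otimes>\<^sub>M borel)"
  shows "\<exists>c4 c5 :: real.
    \<forall>(eps0 :: real) (eps_inf :: real) (k0 :: real) (\<beta> :: real) (\<alpha> :: real) (l :: nat)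
      (\<epsilon> :: real) (\<delta> :: real) (C :: nat \<Rightarrow> real) (gd :: nat \<Rightarrow> real \<Rightarrow> real ^ 'n \<Rightarrow> real)
      (k :: nat \<Rightarrow> real) (M :: nat \<Rightarrow> nat) (N :: nat \<Rightarrow> nat)
      (P :: 'w measure) (X :: nat \<Rightarrow> 'w \<Rightarrow> real ^ 'n).
      iid_sample P X f \<and>
      0 < k0 \<and> 0 < \<beta> \<and> \<beta> < 1 \<and> (\<forall>m. k m = k0 * real m powr \<beta>) \<and>
      0 < \<alpha> \<and> \<alpha> < 1 \<and>
      (\<forall>T. N T + M T = T \<and> \<bar>real (M T) - \<alpha> * real T\<bar> < 1) \<and>
      0 < eps0 \<and> (\<forall>x\<in>cube a b. eps0 \<le> f x \<and> f x \<le> eps_inf) \<and>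
      real l * \<beta> > 1 \<and>
      first_arg_derivs (max 3 (max l CARD('n))) (cube a b) g gd \<and>
      (\<forall>n \<le> max 3 (max l CARD('n)).
         \<exists>B. \<forall>x\<in>cube a b. \<forall>t\<in>{eps0..eps_inf}. \<bar>gd n t x\<bar> < B) \<and>
      0 < \<epsilon> \<and> \<epsilon> < 1 \<and> 2 / 3 < \<delta> \<and> \<delta> < 1 \<and>
      (\<forall>m. 0 < C m) \<and> C \<in> \<Theta>(\<lambda>m. exp (- (real m powr (\<beta> * (1 - \<delta>))))) \<and>
      (\<forall>n\<in>{0, 3, l}.
         growth_condition (cube a b) ((1 - \<epsilon>) * eps0) ((1 + \<epsilon>) * eps_inf) k C (gd n))
      \<longrightarrow>
      (\<lambda>T. prob_space.variance P (\<lambda>\<omega>. G_hat g (cube a b) (k (M T)) (N T) (M T) (\<lambda>i. X i \<omega>))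
            - (c4 * (1 / real (N T)) + c5 * (1 / real (M T))))
        \<in> o(\<lambda>T. 1 / real (M T) + 1 / real (N T)) \<and>
      (\<lambda>T. prob_space.variance P (\<lambda>\<omega>. G_tilde g (cube a b) (k (M T)) (N T) (M T) (\<lambda>i. X i \<omega>))
            - (c4 * (1 / real (N T)) + c5 * (1 / real (M T))))
        \<in> o(\<lambda>T. 1 / real (M T) + 1 / real (N T))"
proof -
  let ?Q = "cube a b :: (real ^ 'n) set"
  define c4 where "c4 = prob_space.variance (density lborel (\<lambda>x. ennreal (f x)))
    (\<lambda>x. if x \<in> ?Q then g (f x) x else 0)"
  define c5 where "c5 = prob_space.variance (density lborel (\<lambda>x. ennreal (f x)))
    (\<lambda>x. f x * (if x \<in> ?Q then deriv (\<lambda>s. g s x) (f x) else 0))"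
  show ?thesis
  proof (rule exI[of _ c4], rule exI[of _ c5], intro allI impI, elim conjE)
    fix eps0 eps_inf k0 \<beta> \<alpha> \<epsilon> \<delta> :: real and l :: nat and C k :: "nat \<Rightarrow> real"
      and gd :: "nat \<Rightarrow> real \<Rightarrow> real ^ 'n \<Rightarrow> real" and M N :: "nat \<Rightarrow> nat"
      and P :: "'w measure" and X :: "nat \<Rightarrow> 'w \<Rightarrow> real ^ 'n"
    assume X: "iid_sample P X f"
      and k0: "0 < k0" and \<beta>: "0 < \<beta>" "\<beta> < 1" and k: "\<forall>m. k m = k0 * real m powr \<beta>"
      and \<alpha>: "0 < \<alpha>" "\<alpha> < 1" and MN: "\<forall>T. N T + M T = T \<and> \<bar>real (M T) - \<alpha> * real T\<bar> < 1"
      and eps0: "0 < eps0" and f_bounds: "\<forall>x\<in>?Q. eps0 \<le> f x \<and> f x \<le> eps_inf"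
      and gd: "first_arg_derivs (max 3 (max l CARD('n))) ?Q g gd"
      and gd_bounded: "\<forall>n\<le>max 3 (max l CARD('n)). \<exists>B. \<forall>x\<in>?Q. \<forall>t\<in>{eps0..eps_inf}. \<bar>gd n t x\<bar> < B"
      and \<epsilon>: "0 < \<epsilon>" "\<epsilon> < 1" and \<delta>: "2 / 3 < \<delta>" "\<delta> < 1"
      and C: "\<forall>m. 0 < C m" "C \<in> \<Theta>(\<lambda>m. exp (- (real m powr (\<beta> * (1 - \<delta>)))))"
      and growth: "\<forall>n\<in>{0, 3, l}. growth_condition ?Q ((1 - \<epsilon>) * eps0) ((1 + \<epsilon>) * eps_inf) k C (gd n)"
    have dens: "f \<in> borel_measurable borel" "\<And>x. 0 \<le> f x" "(\<integral>\<^sup>+ x. ennreal (f x) \<partial>lborel) = 1"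
      "closure {x. f x \<noteq> 0} = ?Q"
      using assms(2) by (auto simp: density_with_support_def)
    have outside: "f x = 0" if "x \<notin> ?Q" for x
      using closure_subset[of "{x. f x \<noteq> 0}"] dens(4) that by auto
    interpret density_on_cube f a b eps0 eps_inf
      by unfold_locales (use assms(1) dens outside eps0 f_bounds in auto)
    define r where "r m = (k m / real m) powr (1 / real CARD('n)) / 2" for m
    have k_pos: "0 < k m / real m" if "0 < m" for m using that k k0 by simp
    have volume: "(2 * r m) ^ CARD('n) = k m / real m" if "0 < m" for m
      unfolding r_def using k_pos[OF that] by (rule bandwidth_volume) simp
    have r_pos: "\<forall>\<^sub>F m in sequentially. 0 < r m"
      using eventually_gt_at_top[of 0]
    proof eventually_elim
      case (elim m)
      have "0 < (k m / real m) powr (1 / real CARD('n))"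
        unfolding powr_gt_zero using k_pos[OF elim] by linarith
      then show ?case by (simp add: r_def)
    qed
    have r0: "r \<longlonglongrightarrow> 0"
      unfolding r_def[abs_def] k[rule_format] by (rule bandwidth_radius_tendsto_0[OF k0 \<beta>]) simp
    have "\<forall>\<^sub>F m in sequentially. r m < b - a" using assms(1) by (intro order_tendstoD(2)[OF r0]) auto
    with r_pos have r_ok: "\<forall>\<^sub>F m in sequentially. 0 < r m \<and> r m \<le> b - a"
      by eventually_elim simp
    have region: "kernel_volume ?Q (k m) m x = measure lborel (?Q \<inter> {y. infnorm (x - y) \<le> r m})" for m x
      unfolding kernel_volume_def kernel_region_eq r_def ..
    note expansion = plug_in_variance_expansion[OF assms(4) X k0 \<beta> k[rule_format] \<alpha> _ _ gd
      gd_bounded[rule_format] \<epsilon> \<delta> C(1)[rule_format] C(2) growth[rule_format] r_def,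
      where N = N and M = M and ?c4.0 = c4 and ?c5.0 = c5]
    have "(\<lambda>T. prob_space.variance P (\<lambda>\<zeta>. plug_in g (kde_with_volume (kernel_volume ?Q (k (M T)) (M T)) ?Q (k (M T)) (N T) (M T) (\<lambda>i. X i \<zeta>)) (N T) (\<lambda>i. X i \<zeta>))
         - (c4 * (1 / real (N T)) + c5 * (1 / real (M T)))) \<in> o(\<lambda>T. 1 / real (M T) + 1 / real (N T))"
    proof (rule expansion)
      show "\<forall>\<^sub>F m in sequentially. \<forall>x\<in>?Q. r m ^ CARD('n) \<le> kernel_volume ?Q (k m) m x \<and>
          kernel_volume ?Q (k m) m x \<le> (2 * r m) ^ CARD('n)"
        using r_ok
      proof eventually_elim
        case (elim m)
        then show ?case unfolding region using truncated_ball_volume(1,2) by blast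
      qed
      show "\<forall>\<^sub>F m in sequentially. \<forall>x\<in>cube (a + r m) (b - r m). kernel_volume ?Q (k m) m x = (2 * r m) ^ CARD('n)"
        using r_ok
      proof eventually_elim
        case (elim m)
        have "cube (a + r m) (b - r m) \<subseteq> ?Q" using elim by (intro cube_mono) auto
        then show ?case using truncated_ball_volume(3) elim unfolding region by blast
      qed
    qed (use MN in \<open>auto simp: c4_def c5_def D_def kernel_volume_measurable\<close>)
    moreover have "(\<lambda>T. prob_space.variance P (\<lambda>\<zeta>. plug_in g (kde_with_volume (\<lambda>_. k (M T) / real (M T)) ?Q (k (M T)) (N T) (M T) (\<lambda>i. X i \<zeta>)) (N T) (\<lambda>i. X i \<zeta>))
         - (c4 * (1 / real (N T)) + c5 * (1 / real (M T)))) \<in> o(\<lambda>T. 1 / real (M T) + 1 / real (N T))"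
    proof (rule expansion[where ?q0.0 = "\<lambda>m x. k m / real m"])
      show "\<forall>\<^sub>F m in sequentially. \<forall>x\<in>?Q. r m ^ CARD('n) \<le> k m / real m \<and> k m / real m \<le> (2 * r m) ^ CARD('n)"
        using r_pos eventually_gt_at_top[of 0]
        by eventually_elim (auto simp: volume[symmetric] intro!: power_mono)
      show "\<forall>\<^sub>F m in sequentially. \<forall>x\<in>cube (a + r m) (b - r m). k m / real m = (2 * r m) ^ CARD('n)"
        using eventually_gt_at_top[of 0] by eventually_elim (simp only: volume, blast)
    qed (use MN in \<open>auto simp: c4_def c5_def D_def\<close>)
    ultimately show "(\<lambda>T. prob_space.variance P (\<lambda>\<zeta>. G_hat g ?Q (k (M T)) (N T) (M T) (\<lambda>i. X i \<zeta>))
            - (c4 * (1 / real (N T)) + c5 * (1 / real (M T))))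
        \<in> o(\<lambda>T. 1 / real (M T) + 1 / real (N T)) \<and>
      (\<lambda>T. prob_space.variance P (\<lambda>\<zeta>. G_tilde g ?Q (k (M T)) (N T) (M T) (\<lambda>i. X i \<zeta>))
            - (c4 * (1 / real (N T)) + c5 * (1 / real (M T))))
        \<in> o(\<lambda>T. 1 / real (M T) + 1 / real (N T))"
      unfolding G_hat_def G_tilde_def truncated_kde_eq standard_kde_eq by blast
  qed
qed

end
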